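(* The property $\mathrm{Reg}(p,q)$ holds whenever $q\ge p=1$, and also when $p=q=2$.
   Context: For a simplicial complex $K$, the simplicial regularity constant is $$\vartheta_K=\sup_{\sigma\in K}\frac{\operatorname{diam}(\sigma)\operatorname{perimeter}(\sigma)}{B_\sigma}+2\sup_{\sigma\in K}\frac{\operatorname{diam}(\sigma)}{\operatorname{inradius}(\sigma)},$$ suprema over simplices of positive dimension, where for an $\ell$-simplex $\sigma$, $\operatorname{perimeter}(\sigma)$ is the $(\ell-1)$-volume of $\partial\sigma$ ($0$-volume being counting measure) and $B_\sigma$ is the $\ell$-volume of a ball of radius $\operatorname{inradius}(\sigma)/2$ in $\mathbb R^\ell$. $\mathrm{Reg}(p,q)$ is the statement: there is a constant $\beta$ such that for every finite $p$-dimensional simplicial complex $K$ in $\mathbb R^q$ there is a constant $\alpha_K$ such that for every $\epsilon>0$ there exist a subdivision $M_\epsilon$ of $K$ and a subcomplex $M'_\epsilon$ of $M_\epsilon$ with (1) $M_\epsilon\setminus M'_\epsilon\subseteq\{x\in\mathbb R^q:\|x-y\|<\epsilon\text{ for some }y\text{ in the }(p-1)\text{-skeleton of }K\}$ (as point sets), (2) $\vartheta_{M_\epsilon}\le\alpha_K$, (3) $\vartheta_{M'_\epsilon}\le\beta$. (So $\alpha_K$ does not depend on $\epsilon$, and $\beta$ does not depend on $K$ or $\epsilon$.) *)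

theory Defs
  imports "HOL-Analysis.Analysis"
begin

(* k-dimensional volume of a subset of a Euclidean space: k-dimensional Hausdorff
   measure, normalised to agree with Lebesgue measure on k-planes; counting measure for k = 0.
   Boundedness of the covering sets is required because the library's diameter is
   unspecified on unbounded sets. *)
definition k_volume :: "nat \<Rightarrow> 'a::euclidean_space set \<Rightarrow> ennreal" where
  "k_volume k S =
     (if k = 0 then emeasure (count_space UNIV) S
      else SUP \<delta>\<in>{0<..}.
             INF U\<in>{U :: nat \<Rightarrow> 'a set. S \<subseteq> (\<Union>i. U i) \<and> (\<forall>i. bounded (U i) \<and> diameter (U i) \<le> \<delta>)}.
               (\<Sum>i. ennreal (unit_ball_vol (real k) * (diameter (U i) / 2) ^ k)))"

definition inradius :: "'a::euclidean_space set \<Rightarrow> real" where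
  "inradius S =
     Sup {r. 0 \<le> r \<and> (\<exists>c \<in> affine hull S. cball c r \<inter> affine hull S \<subseteq> S)}"

definition simplex_dim :: "'a::euclidean_space set \<Rightarrow> nat" where
  "simplex_dim S = nat (aff_dim S)"

definition perimeter :: "'a::euclidean_space set \<Rightarrow> ennreal" where
  "perimeter S = k_volume (simplex_dim S - 1) (rel_frontier S)"

(* The volume of a ball of radius inradius S / 2 in R^l, where l = simplex_dim S;
   compare content_ball. *)
definition half_inball_volume :: "'a::euclidean_space set \<Rightarrow> real" where
  "half_inball_volume S =
     unit_ball_vol (real (simplex_dim S)) * (inradius S / 2) ^ simplex_dim S"

definition positive_simplices :: "'a::euclidean_space set set \<Rightarrow> 'a set set" where
  "positive_simplices K = {S \<in> K. 0 < aff_dim S}"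

(* Suprema are taken in [0, infinity]; a complex without simplices of positive dimension
   has regularity constant 0. *)
definition simplicial_regularity :: "'a::euclidean_space set set \<Rightarrow> ennreal" where
  "simplicial_regularity K =
     (SUP S\<in>positive_simplices K.
        ennreal (diameter S) * perimeter S / ennreal (half_inball_volume S))
     + 2 * (SUP S\<in>positive_simplices K. ennreal (diameter S) / ennreal (inradius S))"

(* The library's simplicial_complex is always finite, and its face relation counts the
   empty set as a (-1)-dimensional simplex. *)
definition p_dimensional_complex :: "nat \<Rightarrow> 'a::euclidean_space set set \<Rightarrow> bool" where
  "p_dimensional_complex p K \<longleftrightarrow>
     simplicial_complex K \<and> (\<forall>S\<in>K. aff_dim S \<le> int p) \<and> (\<exists>S\<in>K. aff_dim S = int p)"

definition subdivision_of :: "'a::euclidean_space set set \<Rightarrow> 'a set set \<Rightarrow> bool" where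
  "subdivision_of M K \<longleftrightarrow>
     simplicial_complex M \<and> \<Union>M = \<Union>K \<and> (\<forall>S\<in>M. \<exists>T\<in>K. S \<subseteq> T)"

definition subcomplex_of :: "'a::euclidean_space set set \<Rightarrow> 'a set set \<Rightarrow> bool" where
  "subcomplex_of L M \<longleftrightarrow> simplicial_complex L \<and> L \<subseteq> M"

definition skeleton :: "int \<Rightarrow> 'a::euclidean_space set set \<Rightarrow> 'a set set" where
  "skeleton k K = {S \<in> K. aff_dim S \<le> k}"

(* Reg(p,q), the ambient dimension q being that of the type 'a. *)
definition Reg :: "nat \<Rightarrow> 'a::euclidean_space itself \<Rightarrow> bool" where
  "Reg p (T :: 'a itself) \<longleftrightarrow>
     (\<exists>\<beta>::real. \<forall>K :: 'a set set. p_dimensional_complex p K \<longrightarrow>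
       (\<exists>\<alpha>::real. \<forall>\<epsilon>>0. \<exists>M M'.
          subdivision_of M K \<and> subcomplex_of M' M \<and>
          \<Union>M - \<Union>M' \<subseteq> {x. \<exists>y \<in> \<Union>(skeleton (int p - 1) K). norm (x - y) < \<epsilon>} \<and>
          simplicial_regularity M \<le> ennreal \<alpha> \<and>
          simplicial_regularity M' \<le> ennreal \<beta>))"

end

theory Submission
  imports Defs
begin

text \<open>
  In dimension one every segment has the same regularity, so a complex is its own subdivision.
  In dimension two, choose for each triangle \<open>T\<close> a lattice with a well-shaped basis that contains
  the edge vectors of \<open>T\<close>, and cut \<open>T\<close> along the two families of grid lines of the lattice scaled by
  \<open>1/N\<close>. All crossings of grid lines with the sides of \<open>T\<close> divide the sides in ratios with
  denominator \<open>N D\<close>, where \<open>D\<close> depends on \<open>K\<close> only; cutting every edge of \<open>K\<close> into \<open>N D\<close> equal pieces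
  therefore makes the grids of adjacent triangles compatible. Each cell is coned off from the
  centroid of three of its vertices. The vertices of the resulting triangles lie in the lattice
  scaled by \<open>1/(3 N D)\<close> while their diameters are of order \<open>1/N\<close>, so a non-degenerate one has area at
  least a fixed multiple of the square of its diameter: this bounds the regularity independently of
  \<open>N\<close>. In cells away from the sides of \<open>T\<close> only grid points occur, so there the bound does not
  involve \<open>D\<close>.
\<close>

section \<open>Regularity of segments and triangles\<close>

text \<open>The obstacle is the constant for the subcomplex. Triangles of \<open>K\<close> may be
  arbitrarily thin, so a constant independent of \<open>K\<close> must come from the lattice and not
  from the triangle. The lattice is only asked to contain the edge vectors; it may be finer, in two
  directions separately, until its basis cell is nearly square. What is retained of this is a bound
  on the product of \<kappa>, a Lipschitz constant of the coordinates, and \<eta>, one of their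
  inverse. Scaling by \<open>N\<close> leaves the product unchanged.

  The sides of \<open>T\<close> cut the cells into many shapes. Integrality replaces a
  classification of them: a non-degenerate triangle whose vertices have coordinates with common
  denominator \<open>q\<close> has a determinant of size at least 1/q^2, whatever its shape. This
  dictates the apex of a cone: an interior point of the cell with bounded denominator. A centroid of
  three vertices is one, at the cost of a factor 3.

  Neighbouring cells fit together because all of them are coned over simplices of one plane graph,
  which is built before any cone and shared by all triangles.\<close>

lemma inball_radius_le_diameter:
  fixes S :: "'a::euclidean_space set"
  assumes "bounded S" "0 < aff_dim S" "0 \<le> r" and c: "c \<in> affine hull S"
    and sub: "cball c r \<inter> affine hull S \<subseteq> S"
  shows "r \<le> diameter S"
proof -
  have "\<not> affine hull S \<subseteq> {c}"
    using \<open>0 < aff_dim S\<close> aff_dim_subset[of "affine hull S" "{c}"] by auto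
  then obtain w where w: "w \<in> affine hull S" "w \<noteq> c"
    by auto
  \<comment> \<open>\<open>?p\<close> lies in the affine hull at distance \<open>r\<close> from
    \<open>c\<close> in the direction of \<open>w\<close>, so it belongs to the ball.\<close>
  let ?t = "r / norm (w - c)"
  let ?p = "(1 - ?t) *\<^sub>R c + ?t *\<^sub>R w"
  have "?p \<in> affine hull S"
    using mem_affine[OF affine_affine_hull c w(1), of "1 - ?t" ?t] by simp
  moreover have pc: "?p - c = ?t *\<^sub>R (w - c)"
    by (simp add: algebra_simps)
  then have np: "norm (?p - c) = r"
    using w \<open>0 \<le> r\<close> by simp
  ultimately have "?p \<in> S"
    using sub by (auto simp: dist_norm norm_minus_commute)
  moreover have "c \<in> S"
    using sub c \<open>0 \<le> r\<close> by auto
  ultimately show ?thesis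
    using diameter_bounded_bound[OF \<open>bounded S\<close>, of ?p c] np by (simp add: dist_norm)
qed

text \<open>For a point every radius would qualify, so the \<open>Sup\<close> is informative only
  once the radii are bounded. Boundedness and positive dimension of \<open>S\<close> make the
  diameter an upper bound.\<close>

lemma inradius_ge:
  fixes S :: "'a::euclidean_space set"
  assumes "bounded S" "0 < aff_dim S" "0 \<le> r" "c \<in> affine hull S"
    and "cball c r \<inter> affine hull S \<subseteq> S"
  shows "r \<le> inradius S"
  unfolding inradius_def
proof (rule cSup_upper)
  show "bdd_above {r. 0 \<le> r \<and> (\<exists>c\<in>affine hull S. cball c r \<inter> affine hull S \<subseteq> S)}"
    using inball_radius_le_diameter[OF assms(1,2)] by (auto intro!: bdd_aboveI[of _ "diameter S"])
qed (use assms in auto)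

lemma diameter_closed_segment:
  fixes a b :: "'a::euclidean_space"
  shows "diameter (closed_segment a b) = norm (a - b)"
proof (rule antisym)
  show "diameter (closed_segment a b) \<le> norm (a - b)"
  proof (rule diameter_le)
    fix x y assume "x \<in> closed_segment a b" "y \<in> closed_segment a b"
    then obtain s t where st: "0 \<le> s" "s \<le> 1" "0 \<le> t" "t \<le> 1"
      and xy: "x = (1 - s) *\<^sub>R a + s *\<^sub>R b" "y = (1 - t) *\<^sub>R a + t *\<^sub>R b"
      by (auto simp: in_segment)
    have "x - y = (t - s) *\<^sub>R (a - b)"
      by (simp add: xy algebra_simps)
    then show "norm (x - y) \<le> norm (a - b)"
      using st by (simp add: mult_left_le_one_le)
  qed auto
  show "norm (a - b) \<le> diameter (closed_segment a b)"
    using diameter_bounded_bound[OF bounded_closed_segment, of a a b b] by (simp add: dist_norm)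
qed

text \<open>The perimeter stands in a numerator, so the Hausdorff measure is estimated from above,
  and one covering for each \<delta> does it: cutting every segment into \<open>n\<close> equal
  pieces makes the pieces small while the sum of their diameters stays at most \<open>m * d\<close>.
  The volume 2 of the unit ball cancels the division by 2.\<close>

lemma k_volume_1_segments_le:
  fixes a b :: "nat \<Rightarrow> 'a::euclidean_space"
  assumes "0 \<le> d" and len: "\<And>i. i < m \<Longrightarrow> norm (b i - a i) \<le> d"
  shows "k_volume 1 (\<Union>i<m. closed_segment (a i) (b i)) \<le> ennreal (m * d)"
proof -
  let ?S = "\<Union>i<m. closed_segment (a i) (b i)"
  have "(INF U\<in>{U :: nat \<Rightarrow> 'a set. ?S \<subseteq> (\<Union>i. U i) \<and> (\<forall>i. bounded (U i) \<and> diameter (U i) \<le> \<delta>)}.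
               (\<Sum>i. ennreal (unit_ball_vol (real 1) * (diameter (U i) / 2) ^ 1))) \<le> ennreal (m * d)"
    if "\<delta> > 0" for \<delta>
  proof -
    obtain n :: nat where n: "d / \<delta> < n"
      using reals_Archimedean2 by blast
    then have n0: "n > 0"
      using \<open>\<delta> > 0\<close> \<open>0 \<le> d\<close> by (cases n) (auto simp: divide_less_0_iff)
    have dn: "d / n \<le> \<delta>"
      using n n0 \<open>\<delta> > 0\<close> by (simp add: field_simps)
    define p where "p i j = a i + (real j / n) *\<^sub>R (b i - a i)" for i j
    \<comment> \<open>Coverings are sequences: index \<open>k\<close> stands for piece
      \<open>k mod n\<close> of segment \<open>k div n\<close>, and the tail of the sequence is
      empty.\<close>
    define U where "U k = (if k < m * n then closed_segment (p (k div n) (k mod n)) (p (k div n) (Suc (k mod n))) else {})" for k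
    have diam: "diameter (U k) \<le> (if k < m * n then d / n else 0)" for k
    proof (cases "k < m * n")
      case True
      then have "k div n < m"
        by (simp add: less_mult_imp_div_less)
      have "p (k div n) (Suc (k mod n)) - p (k div n) (k mod n) = (1 / n) *\<^sub>R (b (k div n) - a (k div n))"
        by (simp add: p_def add_divide_distrib algebra_simps)
      then have "dist (p (k div n) (k mod n)) (p (k div n) (Suc (k mod n))) \<le> d / n"
        using len[OF \<open>k div n < m\<close>] n0
        by (subst dist_commute) (simp add: dist_norm divide_right_mono)
      then show ?thesis
        using True by (simp add: U_def diameter_closed_segment dist_norm)
    qed (simp add: U_def)
    have cover: "?S \<subseteq> (\<Union>k. U k)"
    proof
      fix x assume "x \<in> ?S"
      then obtain i t where i: "i < m" and t: "0 \<le> t" "t \<le> 1" and x: "x = a i + t *\<^sub>R (b i - a i)"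
        by (auto simp: in_segment algebra_simps)
      \<comment> \<open>The minimum takes care of \<open>t = 1\<close>, where the floor is
        \<open>n\<close> but the last piece has index \<open>n - 1\<close>.\<close>
      define j where "j = min (nat \<lfloor>t * n\<rfloor>) (n - 1)"
      have jn: "j < n"
        using n0 by (auto simp: j_def)
      have jt: "real j \<le> t * n" "t * n \<le> Suc j"
      proof -
        have "real (nat \<lfloor>t * n\<rfloor>) \<le> t * n"
          using t by simp
        then show "real j \<le> t * n"
          by (simp add: j_def min_def split: if_splits)
        have "t * n \<le> n"
          using t by (simp add: mult_left_le_one_le)
        moreover have "t * n \<le> Suc (nat \<lfloor>t * n\<rfloor>)"
          using t by simp linarith
        ultimately show "t * n \<le> Suc j"
          using n0 by (simp add: j_def min_def)
      qed
      define s where "s = t * n - j"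
      have s: "0 \<le> s" "s \<le> 1" using jt by (auto simp: s_def)
      have "x = (1 - s) *\<^sub>R p i j + s *\<^sub>R p i (Suc j)"
      proof -
        have "t = j / n + s * (1 / n)"
          using n0 by (simp add: s_def field_simps)
        moreover have "real (Suc j) / n = j / n + 1 / n"
          by (simp add: add_divide_distrib)
        moreover have "a i + (\<alpha> + s * \<beta>) *\<^sub>R d = (1 - s) *\<^sub>R (a i + \<alpha> *\<^sub>R d) + s *\<^sub>R (a i + (\<alpha> + \<beta>) *\<^sub>R d)"
          for \<alpha> \<beta> d
          by (simp add: algebra_simps)
        ultimately show ?thesis
          by (simp only: x p_def)
      qed
      then have "x \<in> closed_segment (p i j) (p i (Suc j))"
        using s by (auto simp: in_segment)
      moreover have "(i * n + j) div n = i" "(i * n + j) mod n = j"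
        using jn by auto
      moreover have "i * n + j < m * n"
      proof -
        have "i * n + j < Suc i * n" using jn by simp
        also have "\<dots> \<le> m * n" using i by (intro mult_le_mono1) auto
        finally show ?thesis .
      qed
      ultimately have "x \<in> U (i * n + j)"
        by (simp add: U_def)
      then show "x \<in> (\<Union>k. U k)" by blast
    qed
    have "(\<Sum>k. ennreal (unit_ball_vol (real 1) * (diameter (U k) / 2) ^ 1)) = (\<Sum>k. ennreal (diameter (U k)))"
      by simp
    also have "\<dots> \<le> (\<Sum>k. ennreal (if k < m * n then d / n else 0))"
      by (intro suminf_le ennreal_leI diam) auto
    also have "\<dots> = (\<Sum>k<m * n. ennreal (d / n))"
      by (subst suminf_finite[of "{..<m*n}"]) auto
    also have "\<dots> = ennreal (m * n * (d / n))"
      using \<open>0 \<le> d\<close> by (subst sum_ennreal) auto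
    also have "\<dots> = ennreal (m * d)"
      using n0 by simp
    finally have sum: "(\<Sum>k. ennreal (unit_ball_vol (real 1) * (diameter (U k) / 2) ^ 1)) \<le> ennreal (m * d)" .
    have "diameter (U k) \<le> \<delta>" for k
      using diam[of k] dn \<open>\<delta> > 0\<close> by (auto split: if_splits)
    moreover have "bounded (U k)" for k
      by (simp add: U_def bounded_closed_segment)
    ultimately show ?thesis
      using cover sum by (intro INF_lower2[of U]) auto
  qed
  then show ?thesis
    unfolding k_volume_def by (auto intro: SUP_least)
qed

text \<open>The ball of radius L / 2 about the midpoint is the segment itself, the perimeter counts
  two end points, and a one-dimensional ball of radius r / 2 has length r. So the first quotient is
  at most 2 L / (L / 2) = 4.\<close>

lemma segment_regularity:
  fixes a b :: "'a::euclidean_space"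
  assumes "a \<noteq> b"
  shows "ennreal (diameter (closed_segment a b)) * perimeter (closed_segment a b)
           / ennreal (half_inball_volume (closed_segment a b)) \<le> 4"
    and "diameter (closed_segment a b) \<le> 2 * inradius (closed_segment a b)"
proof -
  let ?S = "closed_segment a b" and ?L = "norm (a - b)"
  have dim: "aff_dim ?S = 1"
    using one_simplex_segment[OF assms] aff_dim_simplex by blast
  have diam: "diameter ?S = ?L"
    by (rule diameter_closed_segment)
  have hull: "affine hull ?S = affine hull {a, b}"
    by (simp add: segment_convex_hull)
  have r: "?L / 2 \<le> inradius ?S"
  proof (rule inradius_ge)
    show "midpoint a b \<in> affine hull ?S"
      using hull_subset[of ?S affine] midpoints_in_convex_hull[of a "{a,b}" b]
      by (auto simp: segment_convex_hull hull_inc)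
    show "cball (midpoint a b) (?L / 2) \<inter> affine hull ?S \<subseteq> ?S"
    proof
      fix x assume x: "x \<in> cball (midpoint a b) (?L / 2) \<inter> affine hull ?S"
      then obtain u v where uv: "u + v = 1" "x = u *\<^sub>R a + v *\<^sub>R b"
        by (auto simp: hull affine_hull_2)
      have "midpoint a b - x = (1 / 2 - u) *\<^sub>R (a - b)"
      proof -
        have "v = 1 / 2 + (1 / 2 - u)" using uv by simp
        then have "v *\<^sub>R b = (1 / 2) *\<^sub>R b + (1 / 2 - u) *\<^sub>R b"
          by (simp only: scaleR_left_distrib)
        then show ?thesis
          by (simp add: uv midpoint_def algebra_simps)
      qed
      then have "norm (midpoint a b - x) = \<bar>1 / 2 - u\<bar> * ?L"
        by simp
      moreover have "norm (midpoint a b - x) \<le> ?L / 2"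
        using x by (auto simp: dist_norm)
      ultimately have "\<bar>1 / 2 - u\<bar> * ?L \<le> 1 / 2 * ?L"
        by simp
      then have "\<bar>1 / 2 - u\<bar> \<le> 1 / 2"
        using assms by (simp only: mult_le_cancel_right) auto
      then have "0 \<le> v" "v \<le> 1"
        unfolding abs_le_iff using uv(1) by linarith+
      moreover have "x = (1 - v) *\<^sub>R a + v *\<^sub>R b"
        using uv by (simp add: eq_diff_eq[symmetric])
      ultimately show "x \<in> ?S"
        by (auto simp: in_segment)
    qed
  qed (use dim in \<open>auto simp: bounded_closed_segment\<close>)
  show "diameter ?S \<le> 2 * inradius ?S"
    using r diam by simp
  have "rel_frontier ?S = {a, b}"
  proof -
    have "rel_frontier (convex hull {a, b}) = \<Union>{convex hull ({a, b} - {x}) |x. x \<in> {a, b}}"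
      by (rule rel_frontier_convex_hull_cases) simp
    also have "\<dots> = {a, b}"
      using assms by (auto simp: insert_Diff_if)
    finally show ?thesis
      by (simp add: segment_convex_hull)
  qed
  then have "perimeter ?S = 2"
    using assms by (simp add: perimeter_def simplex_dim_def dim k_volume_def)
  moreover have "half_inball_volume ?S = inradius ?S"
    by (simp add: half_inball_volume_def simplex_dim_def dim)
  moreover have "ennreal ?L * 2 / ennreal (inradius ?S) \<le> 4"
  proof -
    have "0 < inradius ?S"
      using r assms by (intro less_le_trans[OF _ r]) auto
    have "ennreal ?L * 2 / ennreal (inradius ?S) = ennreal (?L * 2) / ennreal (inradius ?S)"
      by (simp add: ennreal_mult)
    also have "\<dots> = ennreal (?L * 2 / inradius ?S)"
      using \<open>0 < inradius ?S\<close> by (intro divide_ennreal) auto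
    also have "\<dots> \<le> ennreal 4"
      using r \<open>0 < inradius ?S\<close> by (intro ennreal_leI) (simp add: divide_le_eq)
    finally show ?thesis by simp
  qed
  ultimately show "ennreal (diameter ?S) * perimeter ?S / ennreal (half_inball_volume ?S) \<le> 4"
    by (simp add: diam dist_norm)
qed

lemma triangle_perimeter_le:
  fixes a b c :: "'a::euclidean_space"
  assumes "\<not> affine_dependent {a, b, c}" "card {a, b, c} = 3"
  shows "perimeter (convex hull {a, b, c}) \<le> ennreal (3 * diameter (convex hull {a, b, c}))"
proof -
  let ?S = "convex hull {a, b, c}"
  have dim: "aff_dim ?S = 2"
    using assms using aff_dim_affine_independent[OF assms(1)] by (simp add: aff_dim_convex_hull)
  have "a \<noteq> b" "b \<noteq> c" "a \<noteq> c"
    using assms(2) by (auto simp: card_insert_if split: if_splits)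
  define p where "p i = [a, b, c] ! i" for i :: nat
  define q where "q i = [b, c, a] ! i" for i :: nat
  have "rel_frontier ?S = \<Union>{convex hull ({a, b, c} - {x}) |x. x \<in> {a, b, c}}"
    using assms(1) by (rule rel_frontier_convex_hull_cases)
  also have "{convex hull ({a, b, c} - {x}) |x. x \<in> {a, b, c}} = {convex hull {a, b}, convex hull {b, c}, convex hull {c, a}}"
  proof -
    have "{a, b, c} - {a} = {b, c}" "{a, b, c} - {b} = {c, a}" "{a, b, c} - {c} = {a, b}"
      using \<open>a \<noteq> b\<close> \<open>b \<noteq> c\<close> \<open>a \<noteq> c\<close> by auto
    moreover have "{f x |x. x \<in> {a, b, c}} = {f a, f b, f c}" for f :: "'a \<Rightarrow> 'a set"
      by auto
    ultimately show ?thesis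
      by (simp add: insert_commute)
  qed
  also have "\<Union>\<dots> = (\<Union>i<3. closed_segment (p i) (q i))"
    by (auto simp: lessThan_nat_numeral lessThan_Suc segment_convex_hull p_def q_def numeral_3_eq_3)
  finally have fr: "rel_frontier ?S = (\<Union>i<3. closed_segment (p i) (q i))" .
  have "bounded ?S"
    by (simp add: bounded_convex_hull)
  have "norm (q i - p i) \<le> diameter ?S" if "i < 3" for i
  proof -
    have "p i \<in> {a, b, c}" "q i \<in> {a, b, c}"
      using that by (auto simp: p_def q_def less_Suc_eq numeral_3_eq_3)
    then have "p i \<in> ?S" "q i \<in> ?S"
      by (auto intro: hull_inc)
    then show ?thesis
      using diameter_bounded_bound[OF \<open>bounded ?S\<close>, of "q i" "p i"] by (simp add: dist_norm)
  qed
  then have "k_volume 1 (rel_frontier ?S) \<le> ennreal (real 3 * diameter ?S)"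
    unfolding fr using diameter_ge_0[OF \<open>bounded ?S\<close>] by (intro k_volume_1_segments_le) auto
  then show ?thesis
    by (simp add: perimeter_def simplex_dim_def dim)
qed

text \<open>In dimension two the ratio of diameter \<open>d\<close> to inradius \<open>r\<close>
  controls both suprema: the perimeter is at most 3 d, so the first quotient is at most 3 d^2 / (pi
  r^2 / 4), which is below 4 c^2 because pi > 3. Segments contribute 4 and 2, which
  \<open>2 \<le> c\<close> absorbs.\<close>

lemma simplicial_regularity_le:
  fixes M :: "'a::euclidean_space set set"
  assumes simp: "\<And>S. S \<in> M \<Longrightarrow> \<exists>n. n simplex S" and dim: "\<And>S. S \<in> M \<Longrightarrow> aff_dim S \<le> 2"
    and fat: "\<And>S. S \<in> M \<Longrightarrow> aff_dim S = 2 \<Longrightarrow> 0 < inradius S \<and> diameter S \<le> c * inradius S"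
    and "2 \<le> c"
  shows "simplicial_regularity M \<le> ennreal (4 * c\<^sup>2 + 2 * c)"
proof -
  have *: "ennreal (diameter S) * perimeter S / ennreal (half_inball_volume S) \<le> ennreal (4 * c\<^sup>2) \<and>
      ennreal (diameter S) / ennreal (inradius S) \<le> ennreal c" if S: "S \<in> positive_simplices M" for S
  proof -
    have SM: "S \<in> M" and "0 < aff_dim S"
      using S by (auto simp: positive_simplices_def)
    obtain V where V: "\<not> affine_dependent V" "int (card V) = aff_dim S + 1" "S = convex hull V" "finite V"
      using simp[OF SM] aff_dim_simplex by (auto simp: simplex)
    have "1 \<le> c\<^sup>2"
      using \<open>2 \<le> c\<close> by (simp add: one_le_power)
    consider "aff_dim S = 1" | "aff_dim S = 2"
      using \<open>0 < aff_dim S\<close> dim[OF SM] by linarith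
    then show ?thesis
    proof cases
      case 1
      then have "card V = 2"
        using V by simp
      then obtain a b where ab: "a \<noteq> b" "V = {a, b}"
        by (meson card_2_iff)
      then have S_eq: "S = closed_segment a b"
        by (simp add: V segment_convex_hull)
      have "diameter S > 0"
        using ab by (simp add: S_eq diameter_closed_segment)
      then have r: "0 < inradius S" "diameter S \<le> 2 * inradius S"
        using segment_regularity(2)[OF ab(1)] by (auto simp: S_eq)
      have "diameter S \<le> c * inradius S"
        using r \<open>2 \<le> c\<close> mult_right_mono[of 2 c "inradius S"] by linarith
      then have "ennreal (diameter S) / ennreal (inradius S) \<le> ennreal c"
        using r \<open>diameter S > 0\<close> by (simp add: divide_ennreal ennreal_leI divide_le_eq)
      moreover have "4 \<le> ennreal (4 * c\<^sup>2)"
        using ennreal_leI[of 4 "4 * c\<^sup>2"] \<open>1 \<le> c\<^sup>2\<close> by simp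
      ultimately show ?thesis
        using segment_regularity(1)[OF ab(1)] order_trans unfolding S_eq by blast
    next
      case 2
      then have "card V = 3"
        using V by simp
      then obtain x y z where xyz: "V = {x, y, z}"
        by (auto simp: card_3_iff)
      let ?d = "diameter S" and ?r = "inradius S"
      have d: "0 \<le> ?d"
        using V finite_imp_compact_convex_hull compact_imp_bounded diameter_ge_0 by blast
      have r: "0 < ?r" "?d \<le> c * ?r"
        using fat[OF SM 2] by auto
      have half: "half_inball_volume S = pi * ?r\<^sup>2 / 4"
        by (simp add: half_inball_volume_def simplex_dim_def 2 power_divide eval_unit_ball_vol)
      have "perimeter S \<le> ennreal (3 * ?d)"
        using triangle_perimeter_le[of x y z] V xyz \<open>card V = 3\<close> by simp
      then have "ennreal ?d * perimeter S \<le> ennreal (3 * ?d\<^sup>2)"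
        using mult_left_mono[of "perimeter S" "ennreal (3 * ?d)" "ennreal ?d"] d
        by (simp add: power2_eq_square mult.left_commute flip: ennreal_mult)
      then have "ennreal ?d * perimeter S / ennreal (half_inball_volume S)
          \<le> ennreal (3 * ?d\<^sup>2) / ennreal (pi * ?r\<^sup>2 / 4)"
        unfolding half by (rule divide_right_mono_ennreal)
      also have "\<dots> = ennreal (3 * ?d\<^sup>2 / (pi * ?r\<^sup>2 / 4))"
        using r by (intro divide_ennreal) auto
      also have "\<dots> \<le> ennreal (4 * c\<^sup>2)"
      proof (rule ennreal_leI)
        have "3 * ?d\<^sup>2 \<le> 3 * (c * ?r)\<^sup>2"
          using r d by (simp add: power_mono)
        also have "\<dots> \<le> pi * (c * ?r)\<^sup>2"
          using pi_gt3 by (intro mult_right_mono) auto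
        also have "\<dots> = 4 * c\<^sup>2 * (pi * ?r\<^sup>2 / 4)"
          by (simp add: power_mult_distrib)
        finally show "3 * ?d\<^sup>2 / (pi * ?r\<^sup>2 / 4) \<le> 4 * c\<^sup>2"
          using r by (subst pos_divide_le_eq) auto
      qed
      finally show ?thesis
        using r d by (simp add: divide_ennreal ennreal_leI divide_le_eq)
    qed
  qed
  have "simplicial_regularity M \<le> ennreal (4 * c\<^sup>2) + 2 * ennreal c"
    unfolding simplicial_regularity_def
    using * by (intro add_mono mult_left_mono SUP_least) auto
  also have "\<dots> = ennreal (4 * c\<^sup>2 + 2 * c)"
    using \<open>2 \<le> c\<close> by (simp add: ennreal_plus ennreal_mult)
  finally show ?thesis .
qed

text \<open>With \<open>M = M' = K\<close> the uncovered set is empty. No simplex has dimension 2,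
  so the fatness hypothesis of \<open>simplicial_regularity_le\<close> is vacuous and
  \<open>c = 2\<close> is admissible.\<close>

lemma Reg_1: "Reg 1 TYPE('a::euclidean_space)"
proof -
  have "simplicial_regularity K \<le> ennreal (4 * 2\<^sup>2 + 2 * 2)"
    if "p_dimensional_complex 1 K" for K :: "'a set set"
    using that by (intro simplicial_regularity_le)
      (force simp: p_dimensional_complex_def simplicial_complex_def)+
  then show ?thesis
    unfolding Reg_def
    by (intro exI[of _ "4 * 2\<^sup>2 + 2 * 2"] allI impI exI[of _ K for K] conjI)
      (auto simp: p_dimensional_complex_def subdivision_of_def subcomplex_of_def)
qed

section \<open>Subdivided arrangements of segments\<close>

lemma segment_face_of:
  fixes u v :: "'a::euclidean_space"
  shows "F face_of closed_segment u v \<longleftrightarrow> F = {} \<or> F = {u} \<or> F = {v} \<or> F = closed_segment u v"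
proof -
  have "F face_of convex hull {u, v} \<longleftrightarrow> (\<exists>c\<subseteq>{u, v}. F = convex hull c)"
    by (rule face_of_convex_hull_affine_independent) simp
  moreover have "c \<subseteq> {u, v} \<longleftrightarrow> c = {} \<or> c = {u} \<or> c = {v} \<or> c = {u, v}" for c
    by auto
  ultimately show ?thesis
    by (metis convex_hull_empty convex_hull_singleton segment_convex_hull)
qed

lemma face_of_singleton_iff:
  fixes v :: "'a::euclidean_space"
  shows "F face_of {v} \<longleftrightarrow> F = {} \<or> F = {v}"
  using segment_face_of[of F v v] by auto

text \<open>An edge joins consecutive points of \<open>V\<close> on a common segment.
  Consecutiveness is expressed by an open segment free of \<open>V\<close>, without ordering the
  points.\<close>

definition graph_edges :: "'a::euclidean_space set set \<Rightarrow> 'a set \<Rightarrow> 'a set set" where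
  "graph_edges \<S> V = {closed_segment u v |u v. u \<in> V \<and> v \<in> V \<and> u \<noteq> v \<and>
     open_segment u v \<inter> V = {} \<and> (\<exists>S\<in>\<S>. closed_segment u v \<subseteq> S)}"

definition segment_graph :: "'a::euclidean_space set set \<Rightarrow> 'a set \<Rightarrow> 'a set set" where
  "segment_graph \<S> V = insert {} ((\<lambda>v. {v}) ` V \<union> graph_edges \<S> V)"

text \<open>On the line through \<open>a\<close> and \<open>b\<close> the set \<open>V\<close> is a
  finite set of parameters; \<open>u\<close> and \<open>v\<close> are the nearest ones below and
  above the parameter of \<open>x\<close>.\<close>

lemma graph_edge_through:
  fixes V :: "'a::euclidean_space set"
  assumes "finite V" and ab: "a \<in> V" "b \<in> V" and x: "x \<in> closed_segment a b" "x \<notin> V"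
  obtains u v where "u \<in> V" "v \<in> V" "u \<noteq> v" "open_segment u v \<inter> V = {}"
    "closed_segment u v \<subseteq> closed_segment a b" "x \<in> open_segment u v"
proof -
  define \<tau> where "\<tau> t = (1 - t) *\<^sub>R a + t *\<^sub>R b" for t :: real
  have "a \<noteq> b"
    using x ab by auto
  have inj: "\<tau> s = \<tau> t \<longleftrightarrow> s = t" for s t
  proof -
    have "\<tau> s - \<tau> t = (s - t) *\<^sub>R (b - a)"
      by (simp add: \<tau>_def algebra_simps)
    then show ?thesis
      using \<open>a \<noteq> b\<close> by (metis eq_iff_diff_eq_0 scaleR_eq_0_iff)
  qed
  have comb: "(1 - r) *\<^sub>R \<tau> s + r *\<^sub>R \<tau> t = \<tau> ((1 - r) * s + r * t)" for r s t
    by (simp add: \<tau>_def algebra_simps)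
  have seg: "closed_segment a b = \<tau> ` {0..1}"
    by (auto simp: \<tau>_def in_segment)
  obtain t where t: "0 \<le> t" "t \<le> 1" "x = \<tau> t"
    using x seg by auto
  define P where "P = {s \<in> {0..1}. \<tau> s \<in> V}"
  have "finite P"
  proof (rule finite_imageD)
    show "finite (\<tau> ` P)"
      by (rule finite_subset[OF _ \<open>finite V\<close>]) (auto simp: P_def)
  qed (auto simp: inj_on_def inj)
  have P01: "0 \<in> P" "1 \<in> P" "t \<notin> P"
    using ab x t by (auto simp: P_def \<tau>_def)
  define s s' where "s = Max {r \<in> P. r < t}" and "s' = Min {r \<in> P. t < r}"
  have "0 \<in> {r \<in> P. r < t}" "1 \<in> {r \<in> P. t < r}"
    using P01 t by (auto simp: order_less_le)
  then have s: "s \<in> {r \<in> P. r < t}" and s': "s' \<in> {r \<in> P. t < r}"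
    unfolding s_def s'_def using \<open>finite P\<close> by (intro Max_in Min_in; force)+
  have no: "r \<notin> P" if "s < r" "r < s'" for r
  proof
    assume "r \<in> P"
    then consider "r \<in> {r \<in> P. r < t}" | "r \<in> {r \<in> P. t < r}"
      using P01 by (metis (mono_tags, lifting) linorder_neqE_linordered_idom mem_Collect_eq)
    then show False
    proof cases
      case 1
      then have "r \<le> s"
        unfolding s_def using \<open>finite P\<close> by (intro Max_ge) auto
      then show False
        using that by simp
    next
      case 2
      then have "s' \<le> r"
        unfolding s'_def using \<open>finite P\<close> by (intro Min_le) auto
      then show False
        using that by simp
    qed
  qed
  have s01: "0 \<le> s" "s < t" "t < s'" "s' \<le> 1" "\<tau> s \<in> V" "\<tau> s' \<in> V"
    using s s' by (auto simp: P_def)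
  show ?thesis
  proof
    show "\<tau> s \<noteq> \<tau> s'"
      using inj s01 by auto
    show "open_segment (\<tau> s) (\<tau> s') \<inter> V = {}"
    proof -
      have False if "0 < r" "r < 1" "(1 - r) *\<^sub>R \<tau> s + r *\<^sub>R \<tau> s' \<in> V" for r
      proof -
        let ?q = "(1 - r) * s + r * s'"
        have "?q = s + r * (s' - s)" "?q = s' - (1 - r) * (s' - s)"
          by (auto simp: algebra_simps)
        moreover have "0 < r * (s' - s)" "0 < (1 - r) * (s' - s)"
          using that s01 by auto
        ultimately have q: "s < ?q" "?q < s'"
          by linarith+
        then have "?q \<in> P"
          using that s01 by (simp add: P_def comb)
        then show False
          using no q by blast
      qed
      then show ?thesis
        by (auto simp: in_segment)
    qed
    show "closed_segment (\<tau> s) (\<tau> s') \<subseteq> closed_segment a b"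
    proof (rule closed_segment_subset)
      show "\<tau> s \<in> closed_segment a b" "\<tau> s' \<in> closed_segment a b"
        using s01 by (auto simp: seg)
    qed simp
    show "x \<in> open_segment (\<tau> s) (\<tau> s')"
    proof -
      let ?r = "(t - s) / (s' - s)"
      have "(1 - r) * s + r * s' = s + r * (s' - s)" for r
        by (simp add: algebra_simps)
      then have "(1 - ?r) * s + ?r * s' = s + ?r * (s' - s)" .
      also have "\<dots> = t"
        using s01 by simp
      finally have "x = (1 - ?r) *\<^sub>R \<tau> s + ?r *\<^sub>R \<tau> s'"
        using t by (simp add: comb)
      moreover have "0 < ?r" "?r < 1"
        using s01 by auto
      moreover have "\<tau> s \<noteq> \<tau> s'"
        using inj s01 by auto
      ultimately show ?thesis
        unfolding in_segment by blast
    qed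
  qed (use s01 in auto)
qed

text \<open>In the parameter of the common line this concerns two open intervals that share a point
  while neither contains an end point of the other; then their end points agree.\<close>

lemma empty_segment_eq:
  fixes V :: "'a::euclidean_space set"
  assumes S: "closed_segment u v \<subseteq> closed_segment a b" "closed_segment u' v' \<subseteq> closed_segment a b"
    and V: "u \<in> V" "v \<in> V" "u' \<in> V" "v' \<in> V"
    and e: "open_segment u v \<inter> V = {}" "open_segment u' v' \<inter> V = {}"
    and x: "x \<in> open_segment u v" "x \<in> open_segment u' v'"
  shows "closed_segment u v = closed_segment u' v'"
proof -
  have "u \<noteq> v"
    using x by auto
  moreover have "u \<in> closed_segment a b" "v \<in> closed_segment a b"
    using S by auto
  ultimately have "a \<noteq> b"
    by auto
  define \<tau> where "\<tau> t = (1 - t) *\<^sub>R a + t *\<^sub>R b" for t :: real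
  have inj: "\<tau> s = \<tau> t \<longleftrightarrow> s = t" for s t
  proof -
    have "\<tau> s - \<tau> t = (s - t) *\<^sub>R (b - a)"
      by (simp add: \<tau>_def algebra_simps)
    then show ?thesis
      using \<open>a \<noteq> b\<close> by (metis eq_iff_diff_eq_0 scaleR_eq_0_iff)
  qed
  have comb: "(1 - r) *\<^sub>R \<tau> s + r *\<^sub>R \<tau> t = \<tau> ((1 - r) * s + r * t)" for r s t
    by (simp add: \<tau>_def algebra_simps)
  have op: "open_segment (\<tau> s) (\<tau> s') = \<tau> ` (open_segment s s')" for s s'
    unfolding set_eq_iff in_segment inj comb image_iff Bex_def by auto
  have "\<exists>s s'. s < s' \<and> {u, v} = {\<tau> s, \<tau> s'}" if uv: "closed_segment u v \<subseteq> closed_segment a b" "u \<noteq> v" for u v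
  proof -
    have "u \<in> closed_segment a b" "v \<in> closed_segment a b"
      using uv by auto
    then obtain s s' where "u = \<tau> s" "v = \<tau> s'"
      by (auto simp: in_segment \<tau>_def)
    moreover from this have "s \<noteq> s'"
      using uv by auto
    ultimately show ?thesis
      by (metis insert_commute linorder_neqE_linordered_idom)
  qed
  moreover have "u \<noteq> v" "u' \<noteq> v'"
    using x by auto
  ultimately obtain s s' r r' where *: "s < s'" "{u, v} = {\<tau> s, \<tau> s'}" "r < r'" "{u', v'} = {\<tau> r, \<tau> r'}"
    using S by meson
  have uv: "open_segment u v = \<tau> ` {s<..<s'}" "closed_segment u v = closed_segment (\<tau> s) (\<tau> s')"
    using *(1,2) op[of s s'] by (auto simp: doubleton_eq_iff open_segment_commute closed_segment_commute open_segment_eq_real_ivl)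
  have uv': "open_segment u' v' = \<tau> ` {r<..<r'}" "closed_segment u' v' = closed_segment (\<tau> r) (\<tau> r')"
    using *(3,4) op[of r r'] by (auto simp: doubleton_eq_iff open_segment_commute closed_segment_commute open_segment_eq_real_ivl)
  have inV: "\<tau> s \<in> V" "\<tau> s' \<in> V" "\<tau> r \<in> V" "\<tau> r' \<in> V"
    using V * by (auto simp: doubleton_eq_iff)
  obtain t where t: "s < t" "t < s'" "r < t" "t < r'"
    using x uv uv' inj by auto
  have nV: "q \<notin> {s<..<s'}" "q \<notin> {r<..<r'}" if "\<tau> q \<in> V" for q
    using e that unfolding uv uv' by blast+
  have "s = r" "s' = r'"
    using nV[OF inV(1)] nV[OF inV(2)] nV[OF inV(3)] nV[OF inV(4)] t by auto
  then show ?thesis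
    using uv uv' by simp
qed

text \<open>Distinct edges meet only in \<open>V\<close>: if they lie on different segments by
  \<open>cross\<close>, and if they lie on the same segment by
  \<open>empty_segment_eq\<close>.\<close>

lemma segment_graph:
  fixes \<S> :: "'a::euclidean_space set set"
  assumes "finite \<S>" "finite V"
    and seg: "\<And>S. S \<in> \<S> \<Longrightarrow> \<exists>a\<in>V. \<exists>b\<in>V. S = closed_segment a b"
    and cross: "\<And>S S'. S \<in> \<S> \<Longrightarrow> S' \<in> \<S> \<Longrightarrow> S \<noteq> S' \<Longrightarrow> S \<inter> S' \<subseteq> V"
  shows "simplicial_complex (segment_graph \<S> V)"
    and "\<Union>(segment_graph \<S> V) = V \<union> \<Union>\<S>"
proof -
  have through: "\<exists>u v. u \<in> V \<and> v \<in> V \<and> u \<noteq> v \<and> open_segment u v \<inter> V = {} \<and> closed_segment u v \<subseteq> S \<and> x \<in> open_segment u v"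
    if "x \<in> S" "S \<in> \<S>" "x \<notin> V" for x S
    using that seg[OF that(2)] graph_edge_through[OF \<open>finite V\<close>, of _ _ x] by metis
  have fin: "finite (graph_edges \<S> V)"
    by (rule finite_subset[of _ "(\<lambda>(u, v). closed_segment u v) ` (V \<times> V)"])
      (use \<open>finite V\<close> in \<open>auto simp: graph_edges_def\<close>)
  have edge_V: "closed_segment u v \<inter> V = {u, v}" if "u \<in> V" "v \<in> V" "open_segment u v \<inter> V = {}" for u v
    using that closed_segment_eq_open[of u v] by auto
  have edges: "F \<inter> F' \<subseteq> V" if F: "F \<in> graph_edges \<S> V" "F' \<in> graph_edges \<S> V" "F \<noteq> F'" for F F'
  proof (rule ccontr)
    assume "\<not> F \<inter> F' \<subseteq> V"
    then obtain x where x: "x \<in> F" "x \<in> F'" "x \<notin> V"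
      by auto
    obtain u v S where uv: "F = closed_segment u v" "u \<in> V" "v \<in> V" "open_segment u v \<inter> V = {}"
        "S \<in> \<S>" "F \<subseteq> S"
      using F(1) by (auto simp: graph_edges_def)
    obtain u' v' S' where uv': "F' = closed_segment u' v'" "u' \<in> V" "v' \<in> V" "open_segment u' v' \<inter> V = {}"
        "S' \<in> \<S>" "F' \<subseteq> S'"
      using F(2) by (auto simp: graph_edges_def)
    have "S = S'"
      using cross[OF uv(5) uv'(5)] x uv uv' by blast
    moreover obtain a b where "S = closed_segment a b"
      using seg[OF uv(5)] by auto
    moreover have "x \<in> open_segment u v" "x \<in> open_segment u' v'"
      using x uv uv' by (auto simp: open_segment_def)
    ultimately show False
      using empty_segment_eq[of u v a b u' v' V x] uv uv' \<open>F \<noteq> F'\<close> by auto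
  qed
  have meet: "(F \<inter> F') face_of F" if F: "F \<in> graph_edges \<S> V" "F' \<in> graph_edges \<S> V" "F \<noteq> F'" for F F'
  proof -
    obtain u v where uv: "F = closed_segment u v" "u \<in> V" "v \<in> V" "open_segment u v \<inter> V = {}" "u \<noteq> v"
      using F(1) by (auto simp: graph_edges_def)
    obtain u' v' where uv': "F' = closed_segment u' v'" "u' \<in> V" "v' \<in> V" "open_segment u' v' \<inter> V = {}"
      using F(2) by (auto simp: graph_edges_def)
    \<comment> \<open>An edge meets \<open>V\<close> in its end points only, and the two pairs of
      end points differ, so at most one point is common.\<close>
    have "F \<inter> F' = {u, v} \<inter> {u', v'}"
      using edges[OF F] edge_V[OF uv(2-4)] edge_V[OF uv'(2-4)] uv(1) uv'(1) by blast
    moreover have "{u, v} \<noteq> {u', v'}"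
      using F(3) uv(1) uv'(1) by (auto simp: doubleton_eq_iff closed_segment_commute)
    ultimately have "F \<inter> F' = {} \<or> F \<inter> F' = {u} \<or> F \<inter> F' = {v}"
      using uv by auto
    then show ?thesis
      using uv by (auto simp: segment_face_of)
  qed
  show "simplicial_complex (segment_graph \<S> V)"
    unfolding simplicial_complex_def
  proof (intro conjI ballI allI impI)
    show "finite (segment_graph \<S> V)"
      using fin \<open>finite V\<close> by (simp add: segment_graph_def)
  next
    fix S assume "S \<in> segment_graph \<S> V"
    then show "\<exists>n. n simplex S"
      by (auto simp: segment_graph_def graph_edges_def simplex_segment intro: exI[of _ "-1"])
  next
    fix F S assume "S \<in> segment_graph \<S> V \<and> F face_of S"
    then have SF: "S \<in> segment_graph \<S> V" "F face_of S"
      by auto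
    then consider "S = {}" | v where "v \<in> V" "S = {v}" | "S \<in> graph_edges \<S> V"
      by (auto simp: segment_graph_def)
    then show "F \<in> segment_graph \<S> V"
    proof cases
      case 3
      then obtain u v where "S = closed_segment u v" "u \<in> V" "v \<in> V"
        by (auto simp: graph_edges_def)
      then have "F = {} \<or> F = {u} \<or> F = {v} \<or> F = S"
        using SF by (simp add: segment_face_of)
      then show ?thesis
        using SF(1) \<open>u \<in> V\<close> \<open>v \<in> V\<close> by (auto simp: segment_graph_def)
    qed (use SF in \<open>auto simp: segment_graph_def face_of_singleton_iff\<close>)
  next
    fix S S' assume SS: "S \<in> segment_graph \<S> V \<and> S' \<in> segment_graph \<S> V"
    have vert: "(S \<inter> {v}) face_of S" if Sv: "S \<in> graph_edges \<S> V" "v \<in> V" for S v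
    proof -
      obtain u w where uw: "S = closed_segment u w" "u \<in> V" "w \<in> V" "open_segment u w \<inter> V = {}"
        using Sv by (auto simp: graph_edges_def)
      have "S \<inter> {v} = {} \<or> S \<inter> {v} = {u} \<or> S \<inter> {v} = {w}"
        using edge_V[OF uw(2-4)] Sv uw(1) by auto
      then show ?thesis
        using uw by (auto simp: segment_face_of)
    qed
    have conv: "convex S"
      using SS by (auto simp: segment_graph_def graph_edges_def)
    show "(S \<inter> S') face_of S"
    proof (cases "S = S'")
      case True
      then show ?thesis
        using conv by (simp add: face_of_refl)
    next
      case False
      consider "S = {}" | v where "S = {v}" | "S \<in> graph_edges \<S> V"
        using SS by (auto simp: segment_graph_def)
      then show ?thesis
      proof cases
        case 2
        then have "S \<inter> S' = {} \<or> S \<inter> S' = {v}"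
          by auto
        then show ?thesis
          by (auto simp: face_of_singleton_iff 2)
      next
        case 3
        then show ?thesis
          using SS vert meet[OF 3 _ False] by (auto simp: segment_graph_def)
      qed auto
    qed
  qed
  show "\<Union>(segment_graph \<S> V) = V \<union> \<Union>\<S>"
  proof
    show "\<Union>(segment_graph \<S> V) \<subseteq> V \<union> \<Union>\<S>"
      by (force simp: segment_graph_def graph_edges_def)
    show "V \<union> \<Union>\<S> \<subseteq> \<Union>(segment_graph \<S> V)"
    proof
      fix x assume x: "x \<in> V \<union> \<Union>\<S>"
      show "x \<in> \<Union>(segment_graph \<S> V)"
      proof (cases "x \<in> V")
        case False
        then obtain S where S: "x \<in> S" "S \<in> \<S>"
          using x by auto
        then obtain u v where "u \<in> V" "v \<in> V" "u \<noteq> v" "open_segment u v \<inter> V = {}" "closed_segment u v \<subseteq> S" "x \<in> open_segment u v"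
          using through[OF S False] by blast
        then have "closed_segment u v \<in> graph_edges \<S> V"
          unfolding graph_edges_def using S by blast
        then have "closed_segment u v \<in> segment_graph \<S> V"
          by (simp add: segment_graph_def)
        then show ?thesis
          using \<open>x \<in> open_segment u v\<close> segment_open_subset_closed by blast
      qed (auto simp: segment_graph_def)
    qed
  qed
qed

section \<open>Coning off convex cells\<close>

lemma simplicial_complexD:
  assumes "simplicial_complex K"
  shows "finite K" "S \<in> K \<Longrightarrow> \<exists>n. n simplex S" "S \<in> K \<Longrightarrow> F face_of S \<Longrightarrow> F \<in> K"
    "S \<in> K \<Longrightarrow> S' \<in> K \<Longrightarrow> (S \<inter> S') face_of S"
    "S \<in> K \<Longrightarrow> compact S" "S \<in> K \<Longrightarrow> convex S" "S \<in> K \<Longrightarrow> polytope S"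
  using assms unfolding simplicial_complex_def
  by (auto dest: compact_simplex convex_simplex simplex_imp_polytope)

lemma subset_simplicial_complex:
  assumes "simplicial_complex M" "L \<subseteq> M" and "\<And>F S. S \<in> L \<Longrightarrow> F face_of S \<Longrightarrow> F \<in> L"
  shows "simplicial_complex L"
  using assms finite_subset unfolding simplicial_complex_def by blast

text \<open>Everything rests on one fact: a segment from the interior point \<open>z\<close> to a
  point of \<open>C\<close> stays in the interior except perhaps at its far end, so a ray from
  \<open>z\<close> meets the frontier at most once. A point of a cone other than \<open>z\<close>
  therefore determines the base point above it, and cones intersect as their bases do.\<close>

lemma cone_over_frontier:
  fixes C :: "'a::euclidean_space set"
  assumes C: "convex C" "closed C" and z: "z \<in> interior C"
    and F: "convex F" "F \<subseteq> frontier C"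
  shows "z \<notin> affine hull F"
    and "convex hull (insert z F) \<subseteq> C"
    and "convex hull (insert z F) \<inter> frontier C = F"
    and "convex F' \<Longrightarrow> F' \<subseteq> frontier C \<Longrightarrow>
      convex hull (insert z F) \<inter> convex hull (insert z F') = convex hull (insert z (F \<inter> F'))"
proof -
  have open_seg: "open_segment z w \<subseteq> interior C" if "w \<in> C" for w
    using in_interior_closure_convex_segment[OF C(1) z, of w] that closure_closed[OF C(2)] by simp
  have fr: "frontier C \<subseteq> C" "frontier C \<inter> interior C = {}"
    using C frontier_subset_closed by (auto simp: frontier_def)
  show "z \<notin> affine hull F"
  proof
    assume zF: "z \<in> affine hull F"
    then have "F \<noteq> {}"
      by auto
    then obtain w where w: "w \<in> rel_interior F"
      using rel_interior_eq_empty[OF F(1)] by auto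
    then obtain e where e: "e > 0" "cball w e \<inter> affine hull F \<subseteq> F" and "w \<in> F"
      by (auto simp: mem_rel_interior_cball)
    have "w \<noteq> z"
      using \<open>w \<in> F\<close> F fr z by auto
    \<comment> \<open>\<open>?p\<close> prolongs the line from \<open>z\<close> through
      \<open>w\<close> by the length \<open>e\<close>, which keeps it in \<open>F\<close>. Then
      \<open>w\<close> is strictly between \<open>z\<close> and a point of \<open>C\<close>, hence
      interior to \<open>C\<close>, although \<open>F\<close> lies in the frontier.\<close>
    define \<delta> where "\<delta> = e / norm (w - z)"
    have "\<delta> > 0"
      using \<open>w \<noteq> z\<close> e by (simp add: \<delta>_def)
    let ?p = "(1 + \<delta>) *\<^sub>R w + (- \<delta>) *\<^sub>R z"
    have "?p \<in> affine hull F"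
      by (rule mem_affine[OF affine_affine_hull]) (use \<open>w \<in> F\<close> zF in \<open>auto intro: hull_inc\<close>)
    moreover have "?p - w = \<delta> *\<^sub>R (w - z)"
      by (simp add: algebra_simps)
    then have "dist w ?p = e"
      using \<open>w \<noteq> z\<close> e by (subst dist_commute) (simp add: dist_norm \<delta>_def)
    ultimately have "?p \<in> F"
      using e by auto
    then have "?p \<in> C"
      using F fr by auto
    have "w \<in> open_segment z ?p"
    proof -
      let ?s = "1 / (1 + \<delta>)"
      have "(1 - ?s) *\<^sub>R z + ?s *\<^sub>R ?p = (1 - ?s - ?s * \<delta>) *\<^sub>R z + (?s * (1 + \<delta>)) *\<^sub>R w"
        by (simp only: scaleR_add_right scaleR_scaleR scaleR_diff_left scaleR_minus_left mult_minus_right) simp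
      moreover have "1 - ?s - ?s * \<delta> = 0" "?s * (1 + \<delta>) = 1"
        using \<open>\<delta> > 0\<close> by (auto simp: field_simps)
      ultimately have "w = (1 - ?s) *\<^sub>R z + ?s *\<^sub>R ?p"
        by (simp only:) simp
      moreover have "0 < ?s" "?s < 1"
        using \<open>\<delta> > 0\<close> by auto
      moreover have "z \<noteq> ?p"
        using \<open>?p \<in> F\<close> F fr z by auto
      ultimately show ?thesis
        unfolding in_segment by blast
    qed
    then show False
      using open_seg[OF \<open>?p \<in> C\<close>] \<open>w \<in> F\<close> F fr by blast
  qed
  have zC: "z \<in> C"
    using z interior_subset by auto
  show sub: "convex hull (insert z F) \<subseteq> C"
    using zC F fr C by (intro hull_minimal) auto
  have cone: "\<exists>f\<in>F. p \<in> closed_segment z f" if p: "p \<in> convex hull (insert z F)" "p \<noteq> z" "convex F" for p F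
  proof -
    have "F \<noteq> {}"
      using p by auto
    then obtain u v b where "0 \<le> u" "0 \<le> v" "u + v = 1" "b \<in> F" "p = u *\<^sub>R z + v *\<^sub>R b"
      using p convex_hull_insert[of F z] by (auto simp: hull_same[of convex F, OF p(3)])
    moreover from this have "u = 1 - v" "v \<le> 1"
      by auto
    ultimately show ?thesis
      unfolding in_segment by blast
  qed
  show "convex hull (insert z F) \<inter> frontier C = F"
  proof
    show "F \<subseteq> convex hull (insert z F) \<inter> frontier C"
      using F by (auto intro: hull_inc)
    show "convex hull (insert z F) \<inter> frontier C \<subseteq> F"
    proof
      fix p assume p: "p \<in> convex hull (insert z F) \<inter> frontier C"
      then have "p \<noteq> z"
        using z fr by auto
      then obtain f where f: "f \<in> F" "p \<in> closed_segment z f"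
        using cone p F by blast
      then have "p \<in> open_segment z f \<or> p = f"
        using \<open>p \<noteq> z\<close> by (auto simp: open_segment_def)
      then show "p \<in> F"
        using open_seg[of f] f F fr p by blast
    qed
  qed
  assume F': "convex F'" "F' \<subseteq> frontier C"
  show "convex hull (insert z F) \<inter> convex hull (insert z F') = convex hull (insert z (F \<inter> F'))"
  proof
    show "convex hull (insert z (F \<inter> F')) \<subseteq> convex hull (insert z F) \<inter> convex hull (insert z F')"
      by (intro Int_greatest hull_mono) auto
    show "convex hull (insert z F) \<inter> convex hull (insert z F') \<subseteq> convex hull (insert z (F \<inter> F'))"
    proof
      fix p assume p: "p \<in> convex hull (insert z F) \<inter> convex hull (insert z F')"
      show "p \<in> convex hull (insert z (F \<inter> F'))"
      proof (cases "p = z")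
        case False
        obtain f f' where f: "f \<in> F" "p \<in> closed_segment z f" and f': "f' \<in> F'" "p \<in> closed_segment z f'"
          using cone[of p F] cone[of p F'] p False F F' by blast
        then obtain s s' where s: "0 \<le> s" "s \<le> 1" "p = (1 - s) *\<^sub>R z + s *\<^sub>R f"
          and s': "0 \<le> s'" "s' \<le> 1" "p = (1 - s') *\<^sub>R z + s' *\<^sub>R f'"
          by (auto simp: in_segment)
        have pos: "0 < s" "0 < s'"
          using s s' False by (auto simp: order_less_le)
        have eq: "s *\<^sub>R (f - z) = s' *\<^sub>R (f' - z)"
        proof -
          have "s *\<^sub>R (f - z) = p - z"
            unfolding s(3) by (simp add: algebra_simps)
          moreover have "s' *\<^sub>R (f' - z) = p - z"
            unfolding s'(3) by (simp add: algebra_simps)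
          ultimately show ?thesis by simp
        qed
        \<comment> \<open>If the scale factors differed, one of the two frontier points would lie
          strictly between \<open>z\<close> and the other and so be interior.\<close>
        have nless: "\<not> s < s'" if "0 < s'" "s *\<^sub>R (f - z) = s' *\<^sub>R (f' - z)" "0 < s"
          "f \<in> frontier C" "f' \<in> frontier C" for s s' f f'
        proof
          assume "s < s'"
          have "(s / s') *\<^sub>R (f - z) = (1 / s') *\<^sub>R (s *\<^sub>R (f - z))"
            by simp
          also have "\<dots> = f' - z"
            unfolding that(2) using that(1) by simp
          finally have "f' = z + (s / s') *\<^sub>R (f - z)"
            by simp
          then have "f' = (1 - s / s') *\<^sub>R z + (s / s') *\<^sub>R f"
            by (simp add: algebra_simps)
          moreover have "z \<noteq> f"
            using that z fr by auto
          ultimately have "f' \<in> open_segment z f"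
            using that \<open>s < s'\<close> unfolding in_segment by (auto intro!: exI[of _ "s / s'"])
          then show False
            using open_seg[of f] that fr by blast
        qed
        have "f \<in> frontier C" "f' \<in> frontier C"
          using f f' F F' by auto
        then have "s = s'"
          using nless[of s' s f f'] nless[of s s' f' f] eq pos by (auto simp: not_less)
        then have "f = f'"
          using eq pos by simp
        then have "f \<in> F \<inter> F'"
          using f f' by auto
        moreover have "closed_segment z f \<subseteq> convex hull (insert z (F \<inter> F'))"
          using \<open>f \<in> F \<inter> F'\<close> unfolding segment_convex_hull by (intro hull_mono) auto
        ultimately show ?thesis
          using f by blast
      qed (auto intro: hull_inc)
    qed
  qed
qed

text \<open>Only the simplices containing the apex. The base faces are shared with neighbouring
  cells and kept apart in \<open>boundary_simplices\<close>. If \<open>{} \<in> G\<close>, then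
  \<open>F = {}\<close> yields the apex itself.\<close>

definition cone_simplices :: "'a::euclidean_space set set \<Rightarrow> ('a set \<Rightarrow> 'a) \<Rightarrow> 'a set \<Rightarrow> 'a set set" where
  "cone_simplices G z C = {convex hull (insert (z C) F) |F. F \<in> G \<and> F \<subseteq> frontier C}"

definition boundary_simplices :: "'a::euclidean_space set set \<Rightarrow> 'a set \<Rightarrow> 'a set set" where
  "boundary_simplices G C = {F \<in> G. F \<subseteq> frontier C}"

text \<open>The apex is off the affine hull of the base, so a face of the cone is a face of the base
  or a cone over one.\<close>

lemma cone_faces:
  fixes C :: "'a::euclidean_space set"
  assumes G: "simplicial_complex G" and C: "convex C" "closed C" "z C \<in> interior C"
    and S: "S \<in> cone_simplices G z C" and F: "F face_of S"
  shows "F \<in> cone_simplices G z C \<union> boundary_simplices G C"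
proof -
  obtain E where E: "E \<in> G" "E \<subseteq> frontier C" "S = convex hull (insert (z C) E)"
    using S by (auto simp: cone_simplices_def)
  obtain V where V: "finite V" "E = convex hull V"
    using simplicial_complexD(7)[OF G E(1)] by (auto simp: polytope_def)
  have "convex E"
    using V by simp
  have "z C \<notin> affine hull V"
    using cone_over_frontier(1)[OF C \<open>convex E\<close> E(2)] V by (simp add: affine_hull_convex_hull)
  moreover have "S = convex hull (insert (z C) V)"
    unfolding E(3) V(2) by (simp flip: hull_insert)
  ultimately have "F face_of E \<or> (\<exists>F'. F' face_of E \<and> F = convex hull (insert (z C) F'))"
    using F face_of_convex_hull_insert_eq[OF V(1), of "z C" F] V(2) by simp
  moreover have "F' \<in> G \<and> F' \<subseteq> frontier C" if "F' face_of E" for F'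
    using simplicial_complexD(3)[OF G E(1) that] face_of_imp_subset[OF that] E by auto
  ultimately show ?thesis
    by (auto simp: cone_simplices_def boundary_simplices_def)
qed

text \<open>Two cones in one cell meet in the cone over the intersection of their bases. In all
  mixed cases the other simplex avoids the interior of the cell, which reduces the intersection to
  one of simplices of \<open>G\<close>.\<close>

lemma cone_complex:
  fixes G :: "'a::euclidean_space set set"
  assumes G: "simplicial_complex G" and "finite \<C>"
    and C: "\<And>C. C \<in> \<C> \<Longrightarrow> convex C \<and> closed C \<and> z C \<in> interior C \<and> interior C \<inter> \<Union>G = {}"
    and disj: "\<And>C C'. C \<in> \<C> \<Longrightarrow> C' \<in> \<C> \<Longrightarrow> C \<noteq> C' \<Longrightarrow> interior C \<inter> C' = {}"
  shows "simplicial_complex (G \<union> (\<Union>C\<in>\<C>. cone_simplices G z C))"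
proof -
  have conv: "convex F" if "F \<in> G" for F
    using simplicial_complexD(6)[OF G that] .
  \<comment> \<open>Outside the interior of its cell a cone consists of its base alone.\<close>
  have Int_G: "convex hull (insert (z C) F) \<inter> S = F \<inter> S"
    if "C \<in> \<C>" "F \<in> G" "F \<subseteq> frontier C" "S \<subseteq> - interior C" for C F S
  proof -
    have "convex hull (insert (z C) F) \<subseteq> C"
      by (rule cone_over_frontier(2)) (use C[OF that(1)] conv that in auto)
    moreover have "C = interior C \<union> frontier C"
      using C[OF that(1)] closure_closed interior_subset by (auto simp: frontier_def)
    moreover have "convex hull (insert (z C) F) \<inter> frontier C = F"
      by (rule cone_over_frontier(3)) (use C[OF that(1)] conv that in auto)
    ultimately show ?thesis
      using that by blast
  qed
  have G_int: "S \<subseteq> - interior C" if "S \<in> G" "C \<in> \<C>" for S C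
    using C[OF that(2)] that by blast
  have face_cone: "F' face_of convex hull (insert (z C) F) \<and> convex hull (insert (z C) F') face_of convex hull (insert (z C) F)"
    if "C \<in> \<C>" "F \<in> G" "F \<subseteq> frontier C" "F' face_of F" for C F F'
  proof -
    have "z C \<notin> affine hull F"
      by (rule cone_over_frontier(1)) (use C[OF that(1)] conv that in auto)
    then show ?thesis
      using face_of_polytope_insert face_of_polytope_insert2 simplicial_complexD(7)[OF G that(2)] that(4) by blast
  qed
  have fin: "finite (cone_simplices G z C)" for C
  proof -
    have "cone_simplices G z C \<subseteq> (\<lambda>F. convex hull (insert (z C) F)) ` G"
      by (auto simp: cone_simplices_def)
    then show ?thesis
      using simplicial_complexD(1)[OF G] finite_surj by blast
  qed
  show ?thesis
    unfolding simplicial_complex_def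
  proof (intro conjI ballI allI impI)
    show "finite (G \<union> (\<Union>C\<in>\<C>. cone_simplices G z C))"
      using fin \<open>finite \<C>\<close> simplicial_complexD(1)[OF G] by auto
  next
    fix S assume "S \<in> G \<union> (\<Union>C\<in>\<C>. cone_simplices G z C)"
    then consider "S \<in> G" | C F where "C \<in> \<C>" "F \<in> G" "F \<subseteq> frontier C" "S = convex hull (insert (z C) F)"
      by (auto simp: cone_simplices_def)
    then show "\<exists>n. n simplex S"
    proof cases
      case 2
      have "z C \<notin> affine hull F"
        by (rule cone_over_frontier(1)) (use C[OF 2(1)] conv 2 in auto)
      then show ?thesis
        using simplicial_complexD(2)[OF G 2(2)] simplex_insert_dimplus1 2(4) by blast
    qed (use simplicial_complexD(2)[OF G] in auto)
  next
    fix F S assume SF: "S \<in> G \<union> (\<Union>C\<in>\<C>. cone_simplices G z C) \<and> F face_of S"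
    then consider "S \<in> G" | C where "C \<in> \<C>" "S \<in> cone_simplices G z C"
      by auto
    then show "F \<in> G \<union> (\<Union>C\<in>\<C>. cone_simplices G z C)"
    proof cases
      case 2
      then show ?thesis
        using cone_faces[OF G, of C z S F] C[OF 2(1)] SF by (auto simp: boundary_simplices_def)
    qed (use SF simplicial_complexD(3)[OF G] in auto)
  next
    fix S S' assume SS: "S \<in> G \<union> (\<Union>C\<in>\<C>. cone_simplices G z C) \<and> S' \<in> G \<union> (\<Union>C\<in>\<C>. cone_simplices G z C)"
    define P where "P S C F \<longleftrightarrow> C \<in> \<C> \<and> F \<in> G \<and> F \<subseteq> frontier C \<and> S = convex hull (insert (z C) F)" for S C F
    have "S \<in> G \<or> (\<exists>C F. P S C F)" "S' \<in> G \<or> (\<exists>C F. P S' C F)"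
      using SS by (auto simp: cone_simplices_def P_def)
    then consider "S \<in> G" "S' \<in> G" | C F where "P S C F" "S' \<in> G" | C F where "P S' C F" "S \<in> G"
      | C F F' where "P S C F" "P S' C F'" | C F C' F' where "P S C F" "P S' C' F'" "C \<noteq> C'"
      by metis
    then consider "S \<in> G" "S' \<in> G"
      | C F where "C \<in> \<C>" "F \<in> G" "F \<subseteq> frontier C" "S = convex hull (insert (z C) F)" "S' \<in> G"
      | C' F' where "C' \<in> \<C>" "F' \<in> G" "F' \<subseteq> frontier C'" "S' = convex hull (insert (z C') F')" "S \<in> G"
      | C F F' where "C \<in> \<C>" "F \<in> G" "F \<subseteq> frontier C" "S = convex hull (insert (z C) F)"
         "F' \<in> G" "F' \<subseteq> frontier C" "S' = convex hull (insert (z C) F')"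
      | C F C' F' where "C \<in> \<C>" "F \<in> G" "F \<subseteq> frontier C" "S = convex hull (insert (z C) F)"
         "C' \<in> \<C>" "F' \<in> G" "F' \<subseteq> frontier C'" "S' = convex hull (insert (z C') F')" "C \<noteq> C'"
      unfolding P_def by cases blast+
    then show "(S \<inter> S') face_of S"
    proof cases
      case 1
      then show ?thesis
        using simplicial_complexD(4)[OF G] by blast
    next
      case 2
      have "S \<inter> S' = F \<inter> S'"
        using Int_G[OF 2(1-3) G_int[OF 2(5) 2(1)]] 2 by simp
      then show ?thesis
        using face_cone[OF 2(1-3) simplicial_complexD(4)[OF G 2(2) 2(5)]] 2 by simp
    next
      case 3
      have "S \<inter> S' = S \<inter> F'"
        using Int_G[OF 3(1-3) G_int[OF 3(5) 3(1)]] 3 by (simp add: Int_commute)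
      then show ?thesis
        using simplicial_complexD(4)[OF G 3(5) 3(2)] by simp
    next
      case 4
      have "S \<inter> S' = convex hull (insert (z C) (F \<inter> F'))"
        unfolding 4 by (rule cone_over_frontier(4)) (use C[OF 4(1)] conv 4 in auto)
      then show ?thesis
        using face_cone[OF 4(1-3) simplicial_complexD(4)[OF G 4(2) 4(5)]] 4 by simp
    next
      case 5
      have S'C': "S' \<subseteq> C'"
        unfolding 5 by (rule cone_over_frontier(2)) (use C[OF 5(5)] conv 5 in auto)
      then have "S' \<subseteq> - interior C"
        using disj[OF 5(1,5,9)] by blast
      then have "S \<inter> S' = F \<inter> S'"
        using Int_G[OF 5(1-3)] 5 by simp
      also have "\<dots> = F \<inter> F'"
        using Int_G[OF 5(5-7) G_int[OF 5(2) 5(5)]] 5 by (simp add: Int_commute)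
      finally show ?thesis
        using face_cone[OF 5(1-3) simplicial_complexD(4)[OF G 5(2) 5(6)]] 5 by simp
    qed
  qed
qed

text \<open>The ray from the apex through \<open>x\<close> leaves \<open>C\<close> at a frontier
  point \<open>?y\<close> with parameter \<open>d\<close>. Here \<open>1 \<le> d\<close>, since
  otherwise \<open>?y\<close> would lie strictly between the apex and \<open>x\<close> and be
  interior. So \<open>x\<close> is in the cone over the base simplex that contains
  \<open>?y\<close>.\<close>

lemma Union_cone_simplices:
  fixes C :: "'a::euclidean_space set"
  assumes C: "convex C" "compact C" and z: "z C \<in> interior C"
    and conv: "\<And>F. F \<in> G \<Longrightarrow> convex F"
    and cover: "frontier C \<subseteq> \<Union>(boundary_simplices G C)" and "{} \<in> G"
  shows "\<Union>(cone_simplices G z C) = C"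
proof
  show "\<Union>(cone_simplices G z C) \<subseteq> C"
    using cone_over_frontier(2)[OF C(1) compact_imp_closed[OF C(2)] z] conv
    by (auto simp: cone_simplices_def)
  show "C \<subseteq> \<Union>(cone_simplices G z C)"
  proof
    fix x assume "x \<in> C"
    show "x \<in> \<Union>(cone_simplices G z C)"
    proof (cases "x = z C")
      case True
      then have "x \<in> convex hull (insert (z C) {})"
        by simp
      then show ?thesis
        unfolding cone_simplices_def using \<open>{} \<in> G\<close> by blast
    next
      case False
      obtain d where d: "0 < d" "z C + d *\<^sub>R (x - z C) \<in> frontier C"
          "\<And>e. \<lbrakk>0 \<le> e; e < d\<rbrakk> \<Longrightarrow> z C + e *\<^sub>R (x - z C) \<in> interior C"
        using ray_to_frontier[OF compact_imp_bounded[OF C(2)] z, of "x - z C"] False by auto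
      have "1 \<le> d"
      proof (rule ccontr)
        assume "\<not> 1 \<le> d"
        then have "z C + d *\<^sub>R (x - z C) \<in> open_segment (z C) x"
          using d False by (auto simp: in_segment algebra_simps intro!: exI[of _ d])
        then have "z C + d *\<^sub>R (x - z C) \<in> interior C"
          using in_interior_closure_convex_segment[OF C(1) z, of x] \<open>x \<in> C\<close> closure_subset by blast
        then show False
          using d by (simp add: frontier_def)
      qed
      let ?y = "z C + d *\<^sub>R (x - z C)"
      have "x = (1 - 1 / d) *\<^sub>R z C + (1 / d) *\<^sub>R ?y"
        using d by (simp add: algebra_simps)
      then have "x \<in> closed_segment (z C) ?y"
        using \<open>1 \<le> d\<close> d unfolding in_segment by (intro conjI exI[of _ "1 / d"]) auto
      moreover obtain F where F: "F \<in> G" "F \<subseteq> frontier C" "?y \<in> F"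
        using cover d by (auto simp: boundary_simplices_def)
      moreover have "closed_segment (z C) ?y \<subseteq> convex hull (insert (z C) F)"
        unfolding segment_convex_hull using F by (intro hull_mono) auto
      ultimately show ?thesis
        unfolding cone_simplices_def by blast
    qed
  qed
qed

section \<open>Fat triangles and integral frames\<close>

text \<open>Together \<open>f\<close> and \<open>g\<close> are injective coordinates, so a vanishing
  determinant makes \<open>c - a\<close> a multiple of \<open>b - a\<close>, unless
  \<open>a = b\<close>.\<close>

lemma det_nonzero_if_not_collinear:
  fixes f g :: "'a::real_vector \<Rightarrow> real"
  assumes "linear f" "linear g" and inj: "\<And>w. f w = 0 \<Longrightarrow> g w = 0 \<Longrightarrow> w = 0"
    and ncol: "\<not> collinear {a, b, c}"
  shows "f (b - a) * g (c - a) - f (c - a) * g (b - a) \<noteq> 0"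
proof
  interpret f: linear f by fact
  interpret g: linear g by fact
  let ?u = "b - a" and ?v = "c - a"
  assume *: "f ?u * g ?v - f ?v * g ?u = 0"
  have "\<exists>r. ?v = r *\<^sub>R ?u" if "a \<noteq> b"
  proof (cases "f ?u = 0")
    case True
    then have gu: "g ?u \<noteq> 0"
      using inj[of ?u] that by auto
    then have "f ?v = 0"
      using * True by auto
    then have "?v - (g ?v / g ?u) *\<^sub>R ?u = 0"
      using gu True by (intro inj) (auto simp: f.diff f.scaleR g.diff g.scaleR)
    then show ?thesis
      by (metis eq_iff_diff_eq_0)
  next
    case False
    have "?v - (f ?v / f ?u) *\<^sub>R ?u = 0"
    proof (rule inj)
      show "f (?v - (f ?v / f ?u) *\<^sub>R ?u) = 0"
        unfolding f.diff[of ?v] f.scaleR using False by simp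
      show "g (?v - (f ?v / f ?u) *\<^sub>R ?u) = 0"
        unfolding g.diff[of ?v] g.scaleR using False * by (simp add: field_simps)
    qed
    then show ?thesis
      by (metis eq_iff_diff_eq_0)
  qed
  then have "collinear {a, b, c}"
  proof (cases "a = b")
    case False
    then obtain r where "c - a = r *\<^sub>R (b - a)"
      using \<open>a \<noteq> b \<Longrightarrow> \<exists>r. ?v = r *\<^sub>R ?u\<close> by blast
    then have "c = (1 - r) *\<^sub>R a + (1 - (1 - r)) *\<^sub>R b"
      by (simp add: algebra_simps)
    then have "collinear {a, c, b}"
      unfolding collinear_3_expand by blast
    then show ?thesis
      by (simp add: insert_commute)
  qed (simp add: collinear_2)
  then show False
    using ncol by contradiction
qed

text \<open>Cramer's rule: at the centroid plus \<open>w\<close> the barycentric coordinates differ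
  from 1/3 by the determinants of \<open>w\<close> with the edge vectors, divided by \<Delta>. Edge
  vectors have coordinates at most 1 and \<open>w\<close> has coordinates at most |\<Delta>| / 6, so
  each difference is at most 1/3. This is the origin of the 6.\<close>

lemma cball_subset_triangle:
  fixes f g :: "'a::real_normed_vector \<Rightarrow> real"
  assumes "linear f" "linear g" and inj: "\<And>w. f w = 0 \<Longrightarrow> g w = 0 \<Longrightarrow> w = 0"
    and \<kappa>: "0 < \<kappa>" "\<And>w. \<bar>f w\<bar> \<le> \<kappa> * norm w" "\<And>w. \<bar>g w\<bar> \<le> \<kappa> * norm w"
    and small: "\<And>x y. x \<in> {a, b, c} \<Longrightarrow> y \<in> {a, b, c} \<Longrightarrow> \<bar>f (x - y)\<bar> \<le> 1 \<and> \<bar>g (x - y)\<bar> \<le> 1"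
    and \<Delta>: "\<Delta> = f (b - a) * g (c - a) - f (c - a) * g (b - a)" "\<Delta> \<noteq> 0"
  shows "cball ((1 / 3) *\<^sub>R (a + b + c)) (\<bar>\<Delta>\<bar> / (6 * \<kappa>)) \<subseteq> convex hull {a, b, c}"
proof
  interpret f: linear f by fact
  interpret g: linear g by fact
  fix x assume x: "x \<in> cball ((1 / 3) *\<^sub>R (a + b + c)) (\<bar>\<Delta>\<bar> / (6 * \<kappa>))"
  define w where "w = x - (1 / 3) *\<^sub>R (a + b + c)"
  have "norm w \<le> \<bar>\<Delta>\<bar> / (6 * \<kappa>)"
    using x by (simp add: w_def dist_norm norm_minus_commute)
  then have "\<kappa> * norm w \<le> \<bar>\<Delta>\<bar> / 6"
    using \<open>0 < \<kappa>\<close> by (simp add: field_simps)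
  then have fw: "\<bar>f w\<bar> \<le> \<bar>\<Delta>\<bar> / 6" "\<bar>g w\<bar> \<le> \<bar>\<Delta>\<bar> / 6"
    using \<kappa>(2,3)[of w] by linarith+
  have small3: "\<bar>(f w * q - g w * p) / \<Delta>\<bar> \<le> 1 / 3" if "\<bar>p\<bar> \<le> 1" "\<bar>q\<bar> \<le> 1" for p q
  proof -
    have "\<bar>f w * q\<bar> \<le> \<bar>\<Delta>\<bar> / 6 * 1" "\<bar>g w * p\<bar> \<le> \<bar>\<Delta>\<bar> / 6 * 1"
      unfolding abs_mult using fw that by (intro mult_mono; simp)+
    then have "\<bar>f w * q - g w * p\<bar> \<le> \<bar>\<Delta>\<bar> / 3"
      by linarith
    then show ?thesis
      using \<Delta>(2) by (simp add: abs_divide divide_le_eq)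
  qed
  define \<beta> where "\<beta> = (f w * g (c - a) - g w * f (c - a)) / \<Delta>"
  define \<gamma> where "\<gamma> = (f w * g (a - b) - g w * f (a - b)) / \<Delta>"
  define \<alpha> where "\<alpha> = (f w * g (b - c) - g w * f (b - c)) / \<Delta>"
  have "\<bar>\<alpha>\<bar> \<le> 1 / 3" "\<bar>\<beta>\<bar> \<le> 1 / 3" "\<bar>\<gamma>\<bar> \<le> 1 / 3"
    unfolding \<alpha>_def \<beta>_def \<gamma>_def using small by (intro small3; simp)+
  then have nonneg: "0 \<le> 1 / 3 + \<alpha>" "0 \<le> 1 / 3 + \<beta>" "0 \<le> 1 / 3 + \<gamma>"
    by linarith+
  have sum0: "\<alpha> + \<beta> + \<gamma> = 0"
    unfolding \<alpha>_def \<beta>_def \<gamma>_def add_divide_distrib[symmetric]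
    by (simp add: f.diff g.diff algebra_simps)
  have \<Delta>\<beta>: "\<Delta> * \<beta> = f w * g (c - a) - g w * f (c - a)"
    and \<Delta>\<gamma>: "\<Delta> * \<gamma> = f w * g (a - b) - g w * f (a - b)"
    using \<Delta>(2) by (auto simp: \<beta>_def \<gamma>_def)
  have "w - (\<beta> *\<^sub>R (b - a) + \<gamma> *\<^sub>R (c - a)) = 0"
  proof (rule inj)
    have "\<Delta> * f w = (\<Delta> * \<beta>) * f (b - a) + (\<Delta> * \<gamma>) * f (c - a)"
      unfolding \<Delta>\<beta> \<Delta>\<gamma> by (simp add: \<Delta>(1) f.diff g.diff algebra_simps)
    then have "\<Delta> * f w = \<Delta> * (\<beta> * f (b - a) + \<gamma> * f (c - a))"
      by (simp add: algebra_simps)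
    then show "f (w - (\<beta> *\<^sub>R (b - a) + \<gamma> *\<^sub>R (c - a))) = 0"
      unfolding f.diff[of w] f.add[of "\<beta> *\<^sub>R (b - a)"] f.scaleR using \<Delta>(2) by simp
    have "\<Delta> * g w = (\<Delta> * \<beta>) * g (b - a) + (\<Delta> * \<gamma>) * g (c - a)"
      unfolding \<Delta>\<beta> \<Delta>\<gamma> by (simp add: \<Delta>(1) f.diff g.diff algebra_simps)
    then have "\<Delta> * g w = \<Delta> * (\<beta> * g (b - a) + \<gamma> * g (c - a))"
      by (simp add: algebra_simps)
    then show "g (w - (\<beta> *\<^sub>R (b - a) + \<gamma> *\<^sub>R (c - a))) = 0"
      unfolding g.diff[of w] g.add[of "\<beta> *\<^sub>R (b - a)"] g.scaleR using \<Delta>(2) by simp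
  qed
  then have w: "w = \<beta> *\<^sub>R (b - a) + \<gamma> *\<^sub>R (c - a)"
    by simp
  have \<alpha>: "\<alpha> = - \<beta> - \<gamma>"
    using sum0 by linarith
  have "x = (1 / 3 + \<alpha>) *\<^sub>R a + (1 / 3 + \<beta>) *\<^sub>R b + (1 / 3 + \<gamma>) *\<^sub>R c"
  proof -
    have "x = (1 / 3) *\<^sub>R (a + b + c) + w"
      by (simp add: w_def)
    then show ?thesis
      unfolding w \<alpha> by (simp add: algebra_simps)
  qed
  moreover have "(1 / 3 + \<alpha>) + (1 / 3 + \<beta>) + (1 / 3 + \<gamma>) = 1"
    using sum0 by simp
  ultimately show "x \<in> convex hull {a, b, c}"
    unfolding convex_hull_3 using nonneg by blast
qed

lemma nonzero_Ints_abs_ge_1: "x \<in> \<int> \<Longrightarrow> x \<noteq> 0 \<Longrightarrow> 1 \<le> \<bar>x::real\<bar>"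
  by (auto elim!: Ints_cases)

text \<open>
  With \<open>w\<close> the component of \<open>v\<close> orthogonal to \<open>u\<close>, the lattice basis dual to \<open>h\<close> is \<open>u / m\<close> and
  \<open>(v - (j / m) u) / n\<close>, where \<open>j / m\<close> is the multiple of \<open>1 / m\<close> closest to the \<open>u\<close>-coordinate of \<open>v\<close>
  and \<open>n\<close> is chosen such that \<open>\<bar>w\<bar> / n\<close> is comparable to \<open>\<bar>u\<bar> / m\<close>. The product \<open>\<kappa> * \<eta>\<close>
  measures the distortion of the frame; its bound does not depend on \<open>u\<close> and \<open>v\<close>.
\<close>
lemma exists_integral_frame:
  fixes u v :: "'a::euclidean_space"
  assumes DIM: "DIM('a) = 2" and ncol: "\<not> collinear {0, u, v}"
  obtains h :: "bool \<Rightarrow> 'a \<Rightarrow> real" and \<kappa> \<eta> :: real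
  where "\<And>i. linear (h i)" "0 < \<kappa>" "0 < \<eta>" "\<kappa> * \<eta> \<le> 6"
    "\<And>i x. \<bar>h i x\<bar> \<le> \<kappa> * norm x"
    "\<And>r x. (\<And>i. \<bar>h i x\<bar> \<le> r) \<Longrightarrow> norm x \<le> \<eta> * r"
    "\<And>s. \<exists>x. \<forall>i. h i x = s i"
    "\<And>i. h i u \<in> \<int>" "\<And>i. h i v \<in> \<int>"
proof -
  have "u \<noteq> 0"
    using ncol by auto
  define L where "L = norm u"
  define t where "t = (v \<bullet> u) / L\<^sup>2"
  define w where "w = v - t *\<^sub>R u"
  define H where "H = norm w"
  have L: "0 < L" "u \<bullet> u = L\<^sup>2"
    using \<open>u \<noteq> 0\<close> by (auto simp: L_def power2_norm_eq_inner)
  have "w \<noteq> 0"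
  proof
    assume "w = 0"
    then have "v = t *\<^sub>R u"
      by (simp add: w_def)
    then show False
      using ncol by (auto simp: collinear_lemma)
  qed
  then have H: "0 < H" "w \<bullet> w = H\<^sup>2"
    by (auto simp: H_def power2_norm_eq_inner)
  have uw: "w \<bullet> u = 0"
    using L by (simp add: w_def t_def inner_diff_left)
  then have wu: "u \<bullet> w = 0"
    by (simp add: inner_commute)
  \<comment> \<open>\<open>m\<close> is so large that \<open>l = L / m\<close> is at most
    \<open>H\<close>; then \<open>n\<close>, the integral part of \<open>H / l\<close>, is positive
    and \<open>l \<le> H / n \<le> 2 * l\<close>.\<close>
  define m :: nat where "m = nat \<lceil>L / H\<rceil>"
  have m: "L / H \<le> m" "0 < m"
    using L H by (auto simp: m_def)
  define n :: nat where "n = nat \<lfloor>m * H / L\<rfloor>"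
  have "1 \<le> m * H / L"
    using m L H by (simp add: field_simps)
  then have "1 \<le> \<lfloor>m * H / L\<rfloor>"
    by simp
  then have "real n = of_int \<lfloor>m * H / L\<rfloor>" "1 \<le> real n"
    by (auto simp: n_def)
  then have n: "1 \<le> real n" "n \<le> m * H / L" "m * H / L \<le> 2 * n"
    by linarith+
  define j where "j = round (t * m)"
  \<comment> \<open>Subtracting \<open>e * \<beta>\<close> from \<open>m * \<alpha>\<close> gives
    the coordinate the integral value \<open>j\<close> at \<open>v\<close>. Rounding to the nearest
    integer keeps this shear at most 1/2.\<close>
  define e where "e = t * m - j"
  have e: "\<bar>e\<bar> \<le> 1 / 2"
    using of_int_round_abs_le[of "t * m"] by (simp add: e_def j_def abs_minus_commute)
  define l where "l = L / m"
  have l: "0 < l"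
    using L m by (simp add: l_def)
  define \<alpha> \<beta> where "\<alpha> x = (x \<bullet> u) / L\<^sup>2" and "\<beta> x = (x \<bullet> w) / H\<^sup>2" for x
  have decomp: "x = \<alpha> x *\<^sub>R u + \<beta> x *\<^sub>R w" for x
  proof (rule ccontr)
    define y where "y = x - (\<alpha> x *\<^sub>R u + \<beta> x *\<^sub>R w)"
    assume "x \<noteq> \<alpha> x *\<^sub>R u + \<beta> x *\<^sub>R w"
    then have "y \<noteq> 0"
      by (simp add: y_def)
    have yu: "y \<bullet> u = 0" "y \<bullet> w = 0"
      using L H uw wu by (auto simp: y_def \<alpha>_def \<beta>_def inner_diff_left inner_add_left)
    have "pairwise orthogonal {u, w, y}"
      using uw wu yu by (auto simp: pairwise_def orthogonal_def inner_commute)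
    then have "independent {u, w, y}"
      using \<open>u \<noteq> 0\<close> \<open>w \<noteq> 0\<close> \<open>y \<noteq> 0\<close> by (intro pairwise_orthogonal_independent) auto
    then have "card {u, w, y} \<le> 2"
      using independent_bound DIM by metis
    moreover have "u \<noteq> w" "u \<noteq> y" "w \<noteq> y"
      using uw yu \<open>u \<noteq> 0\<close> \<open>w \<noteq> 0\<close> by auto
    ultimately show False
      by simp
  qed
  have lin: "linear \<alpha>" "linear \<beta>"
    by (auto intro!: linearI simp: \<alpha>_def \<beta>_def inner_add_left add_divide_distrib)
  have \<alpha>_bound: "\<bar>\<alpha> x\<bar> \<le> norm x / L" and \<beta>_bound: "\<bar>\<beta> x\<bar> \<le> norm x / H" for x
    using Cauchy_Schwarz_ineq2[of x u] Cauchy_Schwarz_ineq2[of x w] L H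
    by (auto simp: \<alpha>_def \<beta>_def L_def[symmetric] H_def[symmetric] power2_eq_square field_simps abs_mult)
  have lin_comb: "\<alpha> (a *\<^sub>R u + b *\<^sub>R w) = a" "\<beta> (a *\<^sub>R u + b *\<^sub>R w) = b" for a b
    using L H uw wu by (auto simp: \<alpha>_def \<beta>_def inner_add_left)
  define h where "h i x = (if i then m * \<alpha> x - e * \<beta> x else n * \<beta> x)" for i x
  show thesis
  \<comment> \<open>3/2 is 1 for \<open>m * \<alpha>\<close> plus 1/2 for the shear; 7/2 is 3/2 for
    the component along \<open>u\<close> plus 2 for the one along \<open>w\<close>. The product 21/4
    is below 6.\<close>
  proof (rule that[of h "3 / 2 / l" "7 / 2 * l"])
    show "linear (h i)" for i
      using lin by (cases i) (auto intro!: linearI simp: h_def linear_add linear_scale algebra_simps)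
    show "\<bar>h i x\<bar> \<le> 3 / 2 / l * norm x" for i x
    proof (cases i)
      case True
      have "1 / H \<le> m / L"
        using m L H by (simp add: field_simps)
      then have "norm x / H \<le> norm x / l"
        using mult_left_mono[of "1 / H" "m / L" "norm x"] by (simp add: l_def)
      then have "\<bar>\<beta> x\<bar> \<le> norm x / l"
        using \<beta>_bound[of x] by linarith
      then have "\<bar>e * \<beta> x\<bar> \<le> 1 / 2 * (norm x / l)"
        unfolding abs_mult using e by (intro mult_mono) auto
      moreover have "\<bar>m * \<alpha> x\<bar> \<le> norm x / l"
        using \<alpha>_bound[of x] m mult_left_mono[OF \<alpha>_bound[of x], of "real m"]
        by (simp add: abs_mult l_def mult.commute)
      ultimately have "\<bar>h i x\<bar> \<le> norm x / l + 1 / 2 * (norm x / l)"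
        using True by (simp add: h_def)
      then show ?thesis
        by simp
    next
      case False
      have "\<bar>n * \<beta> x\<bar> \<le> n * (norm x / H)"
        unfolding abs_mult abs_of_nat by (rule mult_left_mono[OF \<beta>_bound]) simp
      also have "\<dots> \<le> m * H / L * (norm x / H)"
        using n H by (intro mult_right_mono) auto
      also have "\<dots> = norm x / l"
        using H by (simp add: l_def)
      finally have "\<bar>n * \<beta> x\<bar> \<le> norm x / l" .
      moreover have "0 \<le> norm x / l"
        using l by simp
      ultimately have "\<bar>n * \<beta> x\<bar> \<le> 3 / 2 * (norm x / l)"
        by linarith
      then show ?thesis
        using False by (simp add: h_def)
    qed
    show "norm x \<le> 7 / 2 * l * r" if r: "\<And>i. \<bar>h i x\<bar> \<le> r" for r x
    proof -
      have r1: "\<bar>m * \<alpha> x - e * \<beta> x\<bar> \<le> r" and r2: "n * \<bar>\<beta> x\<bar> \<le> r"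
        using r[of True] r[of False] by (auto simp: h_def abs_mult)
      have "\<bar>\<beta> x\<bar> \<le> n * \<bar>\<beta> x\<bar>"
        using n mult_right_mono[of 1 "real n" "\<bar>\<beta> x\<bar>"] by simp
      then have "\<bar>\<beta> x\<bar> \<le> r"
        using r2 by simp
      then have "\<bar>e * \<beta> x\<bar> \<le> 1 / 2 * r"
        unfolding abs_mult using e by (intro mult_mono) auto
      then have "\<bar>m * \<alpha> x\<bar> \<le> 3 / 2 * r"
        using r1 by linarith
      then have "m * \<bar>\<alpha> x\<bar> \<le> 3 / 2 * r"
        by (simp add: abs_mult)
      then have "l * (m * \<bar>\<alpha> x\<bar>) \<le> l * (3 / 2 * r)"
        using l by (intro mult_left_mono) auto
      then have 1: "\<bar>\<alpha> x\<bar> * L \<le> 3 / 2 * l * r"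
        using m by (simp add: l_def field_simps)
      have "H \<le> 2 * l * n"
        using n m L by (simp add: l_def field_simps)
      then have "\<bar>\<beta> x\<bar> * H \<le> \<bar>\<beta> x\<bar> * (2 * l * n)"
        by (intro mult_left_mono) auto
      also have "\<dots> = 2 * l * (n * \<bar>\<beta> x\<bar>)"
        by simp
      also have "\<dots> \<le> 2 * l * r"
        using r2 l by (intro mult_left_mono) auto
      finally have 2: "\<bar>\<beta> x\<bar> * H \<le> 2 * l * r" .
      have "norm x \<le> norm (\<alpha> x *\<^sub>R u) + norm (\<beta> x *\<^sub>R w)"
        by (subst decomp[of x]) (rule norm_triangle_ineq)
      then show ?thesis
        using 1 2 by (simp add: L_def H_def)
    qed
    show "\<exists>x. \<forall>i. h i x = s i" for s
    proof (intro exI allI)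
      let ?b = "s False / n"
      show "h i (((s True + e * ?b) / m) *\<^sub>R u + ?b *\<^sub>R w) = s i" for i
        using n m by (cases i) (auto simp: h_def lin_comb)
    qed
    have "u = 1 *\<^sub>R u + 0 *\<^sub>R w" "v = t *\<^sub>R u + 1 *\<^sub>R w"
      by (auto simp: w_def)
    then have "\<alpha> u = 1" "\<beta> u = 0" "\<alpha> v = t" "\<beta> v = 1"
      using lin_comb by metis+
    then show "h i u \<in> \<int>" "h i v \<in> \<int>" for i
      by (auto simp: h_def e_def algebra_simps)
  qed (use l in auto)
qed

section \<open>The grid of a planar complex\<close>

text \<open>
  \<open>h T True\<close> and \<open>h T False\<close> are affine coordinates on the plane whose integral level lines are the
  grid lines of the triangle \<open>T\<close>. The last assumption includes \<open>d = 0\<close>, where \<open>real D / d = 0\<close>.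
\<close>
locale planar_grid =
  fixes K :: "'a::euclidean_space set set" and N D :: nat
    and h :: "'a set \<Rightarrow> bool \<Rightarrow> 'a \<Rightarrow> real" and \<kappa> \<eta> :: "'a set \<Rightarrow> real"
  assumes DIM: "DIM('a) = 2" and K: "simplicial_complex K" and pos: "0 < N" "0 < D"
    and lin: "\<And>T i. T \<in> K \<Longrightarrow> aff_dim T = 2 \<Longrightarrow> linear (\<lambda>x. h T i x - h T i 0)"
    and \<kappa>_pos: "\<And>T. T \<in> K \<Longrightarrow> aff_dim T = 2 \<Longrightarrow> 0 < \<kappa> T"
    and lip: "\<And>T i x y. T \<in> K \<Longrightarrow> aff_dim T = 2 \<Longrightarrow> \<bar>h T i x - h T i y\<bar> \<le> \<kappa> T * norm (x - y)"
    and inj: "\<And>T x y r. T \<in> K \<Longrightarrow> aff_dim T = 2 \<Longrightarrow> (\<And>i. \<bar>h T i x - h T i y\<bar> \<le> r) \<Longrightarrow> norm (x - y) \<le> \<eta> T * r"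
    and \<kappa>\<eta>: "\<And>T. T \<in> K \<Longrightarrow> aff_dim T = 2 \<Longrightarrow> \<kappa> T * \<eta> T \<le> 6"
    and surj: "\<And>T s. T \<in> K \<Longrightarrow> aff_dim T = 2 \<Longrightarrow> \<exists>x. \<forall>i. h T i x = s i"
    and vertex_Ints: "\<And>T a i. T \<in> K \<Longrightarrow> aff_dim T = 2 \<Longrightarrow> {a} \<in> K \<Longrightarrow> a \<in> T \<Longrightarrow> h T i a \<in> \<int>"
    and edge_Ints: "\<And>T a b i. T \<in> K \<Longrightarrow> aff_dim T = 2 \<Longrightarrow> {a} \<in> K \<Longrightarrow> {b} \<in> K \<Longrightarrow> a \<in> T \<Longrightarrow> b \<in> T \<Longrightarrow>
       \<exists>d\<in>\<int>. h T i b - h T i a = real N * d \<and> real D / d \<in> \<int>"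
begin

definition tris :: "'a set set" where
  "tris = {T \<in> K. aff_dim T = 2}"

lemma trisD: "T \<in> tris \<Longrightarrow> T \<in> K" "T \<in> tris \<Longrightarrow> aff_dim T = 2"
  by (auto simp: tris_def)

text \<open>These points depend on the edge alone, so triangles on both sides of it see the same
  ones. With \<open>a = b\<close> the vertices are included, also those that lie on no edge.\<close>

definition division :: "'a set" where
  "division = {a + (real j / real (N * D)) *\<^sub>R (b - a) |a b j.
     {a} \<in> K \<and> {b} \<in> K \<and> closed_segment a b \<in> K \<and> j \<le> N * D}"

text \<open>Restricted to interiors, so that the vertices on an edge are those of
  \<open>division\<close> and independent of the adjacent triangle.\<close>

definition lattice :: "'a set" where
  "lattice = (\<Union>T\<in>tris. {x \<in> interior T. \<forall>i. h T i x \<in> \<int>})"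

definition V :: "'a set" where
  "V = division \<union> lattice"

definition chord :: "'a set \<Rightarrow> bool \<Rightarrow> int \<Rightarrow> 'a set" where
  "chord T i m = T \<inter> {x. h T i x = of_int m}"

text \<open>Meeting the interior excludes grid lines that run along a side of \<open>T\<close>,
  which would overlap an edge of \<open>K\<close>, and lines that only touch a corner.\<close>

definition chords :: "'a set set" where
  "chords = {chord T i m |T i m. T \<in> tris \<and> chord T i m \<inter> interior T \<noteq> {}}"

definition segs :: "'a set set" where
  "segs = {e \<in> K. aff_dim e = 1} \<union> chords"

definition G :: "'a set set" where
  "G = segment_graph segs V"

section \<open>Coordinates on a triangle, its frontier and its grid lines\<close>

lemma h_comb:
  assumes "T \<in> tris"
  shows "h T i ((1 - t) *\<^sub>R x + t *\<^sub>R y) = (1 - t) * h T i x + t * h T i y"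
proof -
  interpret l: linear "\<lambda>x. h T i x - h T i 0"
    using lin trisD assms by blast
  have "h T i ((1 - t) *\<^sub>R x + t *\<^sub>R y) - h T i 0 = (1 - t) * (h T i x - h T i 0) + t * (h T i y - h T i 0)"
    unfolding l.add l.scaleR by simp
  then show ?thesis
    by (simp add: algebra_simps)
qed

lemma h_line:
  assumes "T \<in> tris"
  shows "h T i (x + t *\<^sub>R (y - x)) = h T i x + t * (h T i y - h T i x)"
  using h_comb[OF assms, of i t x y] by (simp add: algebra_simps)

lemma h_inj:
  assumes "T \<in> tris" "\<And>i. h T i x = h T i y"
  shows "x = y"
  using inj[of T x y 0] trisD assms by simp

lemma h_continuous: "T \<in> tris \<Longrightarrow> continuous_on A (h T i)"
proof -
  assume T: "T \<in> tris"
  have "linear (\<lambda>x. h T i x - h T i 0)"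
    using lin trisD T by blast
  then have "continuous_on A (\<lambda>x. (h T i x - h T i 0) + h T i 0)"
    by (intro continuous_intros linear_continuous_on) (simp add: linear_conv_bounded_linear)
  then show ?thesis
    by simp
qed

lemma tri_geometry:
  assumes "T \<in> tris"
  shows "compact T" "convex T" "polytope T" "interior T \<noteq> {}" "rel_frontier T = frontier T"
    "rel_interior T = interior T" "frontier T \<subseteq> T"
proof -
  show T: "compact T" "convex T" "polytope T"
    using simplicial_complexD(5-7)[OF K] trisD(1)[OF assms] by auto
  have aff: "affine hull T = UNIV"
    using aff_dim_eq_full[of T] trisD(2)[OF assms] DIM by simp
  then show "rel_frontier T = frontier T" "rel_interior T = interior T"
    by (simp_all add: rel_frontier_frontier rel_interior_interior)
  have "T \<noteq> {}"
    using aff by auto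
  then show "interior T \<noteq> {}"
    using rel_interior_eq_empty[OF T(2)] rel_interior_interior[OF aff] by simp
  show "frontier T \<subseteq> T"
    using T compact_imp_closed frontier_subset_closed by blast
qed

text \<open>In the plane \<open>T\<close> has top dimension and cannot be a proper face of
  \<open>S\<close>, so the common face is a proper face of \<open>T\<close>.\<close>

lemma proper_simplex_Int:
  assumes "T \<in> tris" "S \<in> K" "S \<noteq> T"
  shows "S \<inter> T \<subseteq> frontier T"
proof -
  have "(T \<inter> S) face_of T" "(S \<inter> T) face_of S"
    using simplicial_complexD(4)[OF K] trisD assms by auto
  moreover have "S \<inter> T \<noteq> T"
  proof
    assume "S \<inter> T = T"
    then have "T face_of S"
      using calculation by simp
    then have "aff_dim T < aff_dim S"
      using face_of_aff_dim_lt[of S T] simplicial_complexD(6)[OF K] assms by auto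
    then show False
      using aff_dim_le_DIM[of S] DIM trisD(2)[OF assms(1)] by simp
  qed
  ultimately show ?thesis
    using face_of_subset_rel_frontier[of "T \<inter> S" T] tri_geometry(5)[OF assms(1)] by (simp add: Int_commute)
qed

lemma edge_cases:
  assumes "e \<in> K" "aff_dim e = 1"
  obtains a b where "a \<noteq> b" "e = closed_segment a b" "{a} \<in> K" "{b} \<in> K"
proof -
  obtain n where n: "n simplex e"
    using simplicial_complexD(2)[OF K assms(1)] by blast
  then have "n = 1"
    using aff_dim_simplex assms(2) by metis
  then obtain W where W: "\<not> affine_dependent W" "int (card W) = 2" "e = convex hull W"
    using n by (auto simp: simplex_def)
  then obtain a b where ab: "a \<noteq> b" "W = {a, b}"
    by (metis card_2_iff of_nat_eq_iff of_nat_numeral)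
  then have "e = closed_segment a b"
    using W by (simp add: segment_convex_hull)
  moreover from this have "{a} face_of e" "{b} face_of e"
    by (auto simp: segment_face_of)
  ultimately show ?thesis
    using that ab simplicial_complexD(3)[OF K assms(1)] by blast
qed

lemma frontier_edge:
  assumes "T \<in> tris" "x \<in> frontier T"
  obtains e where "e \<in> K" "aff_dim e = 1" "x \<in> e" "e face_of T" "e \<subseteq> frontier T"
proof -
  have "x \<in> \<Union>{F. F facet_of T}"
    using rel_frontier_of_polyhedron[OF polytope_imp_polyhedron[OF tri_geometry(3)[OF assms(1)]]] tri_geometry(5)[OF assms(1)] assms(2)
    by simp
  then obtain e where e: "x \<in> e" "e face_of T" "aff_dim e = 1"
    using trisD(2)[OF assms(1)] by (auto simp: facet_of_def)
  moreover have "e \<noteq> T"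
    using e trisD(2)[OF assms(1)] by auto
  ultimately show ?thesis
    using that simplicial_complexD(3)[OF K trisD(1)[OF assms(1)]]
      face_of_subset_rel_frontier[of e T] tri_geometry(5)[OF assms(1)] by blast
qed

lemma division_subset: "x \<in> division \<Longrightarrow> \<exists>a b. {a} \<in> K \<and> {b} \<in> K \<and> closed_segment a b \<in> K \<and> x \<in> closed_segment a b"
proof -
  assume "x \<in> division"
  then obtain a b j where *: "{a} \<in> K" "{b} \<in> K" "closed_segment a b \<in> K" "j \<le> N * D"
      "x = a + (real j / real (N * D)) *\<^sub>R (b - a)"
    by (auto simp: division_def)
  let ?t = "real j / real (N * D)"
  have "x = (1 - ?t) *\<^sub>R a + ?t *\<^sub>R b"
    by (simp add: *(5) algebra_simps)
  moreover have "0 \<le> ?t" "?t \<le> 1"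
    using * pos by (auto simp: divide_le_eq simp flip: of_nat_mult)
  ultimately have "x \<in> closed_segment a b"
    unfolding in_segment by blast
  then show ?thesis
    using * by blast
qed

lemma vertex_division: "{a} \<in> K \<Longrightarrow> a \<in> division"
  unfolding division_def by (intro CollectI exI[of _ a] exI[of _ a] exI[of _ 0]) auto

text \<open>At parameter \<open>t\<close> the coordinate has grown by t N d, an integer. Multiplying
  by the integer D / d shows that t N D is an integer.\<close>

lemma crossing_in_division:
  assumes T: "T \<in> tris" and ab: "{a} \<in> K" "{b} \<in> K" "closed_segment a b \<in> K" "a \<in> T" "b \<in> T"
    and x: "x \<in> closed_segment a b" "h T i x \<in> \<int>" and ne: "h T i a \<noteq> h T i b"
  shows "x \<in> division"
proof -
  obtain t where t: "0 \<le> t" "t \<le> 1" "x = (1 - t) *\<^sub>R a + t *\<^sub>R b"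
    using x by (auto simp: in_segment)
  then have x_eq: "x = a + t *\<^sub>R (b - a)"
    by (simp add: algebra_simps)
  obtain d where d: "d \<in> \<int>" "h T i b - h T i a = real N * d" "real D / d \<in> \<int>"
    using edge_Ints[of T a b i] trisD[OF T] ab by auto
  have "d \<noteq> 0"
    using d ne by auto
  have "h T i x = h T i a + t * (real N * d)"
    unfolding x_eq using h_line[OF T] d by simp
  then have "(h T i x - h T i a) * (real D / d) = t * real (N * D)"
    using \<open>d \<noteq> 0\<close> by (simp add: field_simps)
  moreover have "(h T i x - h T i a) * (real D / d) \<in> \<int>"
    using x d vertex_Ints[of T a i] trisD[OF T] ab by (intro Ints_mult Ints_diff) auto
  ultimately have "t * real (N * D) \<in> \<int>"
    by simp
  then obtain z where z: "t * real (N * D) = of_int z"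
    by (auto elim: Ints_cases)
  have "0 \<le> t * real (N * D)" "t * real (N * D) \<le> real (N * D)"
    using t by (auto simp: mult_left_le_one_le)
  then have "0 \<le> z" "z \<le> int (N * D)"
    unfolding z by linarith+
  then have "nat z \<le> N * D"
    by (simp add: nat_le_iff)
  moreover have "real (nat z) = t * real (N * D)"
    using z \<open>0 \<le> z\<close> by auto
  ultimately have "x = a + (real (nat z) / real (N * D)) *\<^sub>R (b - a)" "nat z \<le> N * D"
    using pos x_eq by auto
  then show ?thesis
    using ab unfolding division_def by blast
qed

text \<open>The other coordinate, with index \<open>\<not> i\<close>, parametrizes the level line;
  it separates \<open>p\<close> and \<open>q\<close> because the pair of coordinates is
  injective.\<close>

lemma level_line:
  assumes T: "T \<in> tris" and "p \<noteq> q" and hp: "h T i p = m" "h T i q = m" "h T i y = m"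
  shows "\<exists>c. y = p + c *\<^sub>R (q - p)"
proof -
  have "h T (\<not> i) p \<noteq> h T (\<not> i) q"
  proof
    assume *: "h T (\<not> i) p = h T (\<not> i) q"
    have "h T j p = h T j q" for j
      using * hp by (cases "j = i") auto
    then show False
      using h_inj[OF T] \<open>p \<noteq> q\<close> by blast
  qed
  define c where "c = (h T (\<not> i) y - h T (\<not> i) p) / (h T (\<not> i) q - h T (\<not> i) p)"
  have "h T j y = h T j (p + c *\<^sub>R (q - p))" for j
    unfolding h_line[OF T]
    using hp \<open>h T (\<not> i) p \<noteq> h T (\<not> i) q\<close> by (cases "j = i") (auto simp: c_def)
  then show ?thesis
    using h_inj[OF T] by blast
qed

text \<open>The grid line crosses the side \<open>e\<close> through \<open>x\<close> transversally:
  if the coordinate were constant on \<open>e\<close>, the grid line would be the line of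
  \<open>e\<close>, which meets \<open>T\<close> in \<open>e\<close> only, and the chord would miss
  the interior.\<close>

lemma chord_frontier:
  assumes T: "T \<in> tris" and c: "chord T i m \<inter> interior T \<noteq> {}" and x: "x \<in> chord T i m" "x \<in> frontier T"
  shows "x \<in> division"
proof -
  obtain y where y: "y \<in> interior T" "h T i y = of_int m"
    using c by (auto simp: chord_def)
  obtain e where e: "e \<in> K" "aff_dim e = 1" "x \<in> e" "e face_of T" "e \<subseteq> frontier T"
    using frontier_edge[OF T x(2)] .
  obtain a b where ab: "a \<noteq> b" "e = closed_segment a b" "{a} \<in> K" "{b} \<in> K"
    using edge_cases[OF e(1,2)] .
  have abT: "a \<in> T" "b \<in> T"
    using e(5) tri_geometry(7)[OF T] ab(2) by auto
  have xm: "h T i x = of_int m"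
    using x by (simp add: chord_def)
  have "h T i a \<noteq> h T i b"
  proof
    assume eq: "h T i a = h T i b"
    obtain t where t: "x = (1 - t) *\<^sub>R a + t *\<^sub>R b"
      using e ab by (auto simp: in_segment)
    have "h T i x = h T i a"
      unfolding t h_comb[OF T] eq by (simp add: left_diff_distrib)
    then have "h T i a = of_int m"
      using xm by simp
    then obtain c where "y = a + c *\<^sub>R (b - a)"
      using level_line[OF T ab(1), of i "of_int m" y] eq y by auto
    then have "y = (1 - c) *\<^sub>R a + c *\<^sub>R b"
      by (simp add: algebra_simps)
    then have "y \<in> affine hull e"
      using mem_affine[OF affine_affine_hull, of a e b "1 - c" c] ab by (auto intro: hull_inc)
    moreover have "y \<in> T"
      using y interior_subset by auto
    ultimately have "y \<in> e"
      using face_of_imp_eq_affine_Int[OF tri_geometry(2)[OF T] e(4)] by blast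
    then show False
      using e y by (auto simp: frontier_def)
  qed
  moreover have "h T i x \<in> \<int>"
    using xm by simp
  ultimately show ?thesis
    using crossing_in_division[OF T ab(3,4) _ abT, of x i] e ab(2) by blast
qed

text \<open>A compact convex collinear set is a segment, and its ends are its extreme points. An
  extreme point cannot be interior to \<open>T\<close>, so it is on the frontier and
  \<open>chord_frontier\<close> applies.\<close>

lemma chord_segment:
  assumes T: "T \<in> tris" and c: "chord T i m \<inter> interior T \<noteq> {}"
  shows "\<exists>a\<in>V. \<exists>b\<in>V. chord T i m = closed_segment a b"
proof -
  let ?C = "chord T i m"
  have "closed {x. h T i x = of_int m}"
    using h_continuous[OF T, of UNIV i] by (intro closed_Collect_eq) auto
  then have "compact ?C"
    unfolding chord_def using tri_geometry(1)[OF T] by (intro compact_Int_closed)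
  have "convex ?C"
    unfolding chord_def
  proof (rule convex_Int[OF tri_geometry(2)[OF T]])
    show "convex {x. h T i x = of_int m}"
      unfolding convex_alt by (auto simp: h_comb[OF T] left_diff_distrib)
  qed
  \<comment> \<open>Two points that span the grid line; they need not belong to
    \<open>T\<close>.\<close>
  obtain p q where pq: "h T i p = of_int m" "h T (\<not> i) p = 0" "h T i q = of_int m" "h T (\<not> i) q = 1"
    using surj[of T "\<lambda>j. if j = i then of_int m else 0"] surj[of T "\<lambda>j. if j = i then of_int m else 1"] trisD[OF T]
    by (metis (full_types))
  then have "p \<noteq> q"
    by auto
  have line: "\<exists>c. y = p + c *\<^sub>R (q - p)" if "h T i y = of_int m" for y
    using level_line[OF T \<open>p \<noteq> q\<close> pq(1,3) that] .
  have "collinear ?C"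
    unfolding collinear_def
  proof (rule exI[of _ "q - p"], intro ballI)
    fix x y assume "x \<in> ?C" "y \<in> ?C"
    then obtain c d where "x = p + c *\<^sub>R (q - p)" "y = p + d *\<^sub>R (q - p)"
      using line[of x] line[of y] by (auto simp: chord_def)
    then have "x - y = (c - d) *\<^sub>R (q - p)"
      by (simp add: scaleR_left_diff_distrib)
    then show "\<exists>c. x - y = c *\<^sub>R (q - p)"
      by blast
  qed
  moreover have "?C \<noteq> {}"
    using c by auto
  ultimately obtain a b where ab: "?C = closed_segment a b"
    using compact_convex_collinear_segment \<open>compact ?C\<close> \<open>convex ?C\<close> by metis
  have "v \<in> V" if v: "v extreme_point_of ?C" for v
  proof (cases "v \<in> interior T")
    case False
    have "v \<in> ?C"
      using v by (simp add: extreme_point_of_def)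
    moreover from this have "v \<in> frontier T"
      using False tri_geometry(1)[OF T] compact_imp_closed closure_closed by (fastforce simp: frontier_def chord_def)
    ultimately show ?thesis
      using chord_frontier[OF T c] by (simp add: V_def)
  next
    case True
    then obtain e where e: "0 < e" "ball v e \<subseteq> T"
      using mem_interior by blast
    \<comment> \<open>A step of length \<open>e / 2\<close> along the grid line: both
      \<open>v + w\<close> and \<open>v - w\<close> remain in the chord, with \<open>v\<close> as
      their midpoint.\<close>
    define w where "w = (e / (2 * norm (q - p))) *\<^sub>R (q - p)"
    have nw: "norm w = e / 2"
      using \<open>p \<noteq> q\<close> e by (simp add: w_def)
    have vC: "v \<in> ?C"
      using v by (simp add: extreme_point_of_def)
    have hw: "h T i (v + s *\<^sub>R (q - p)) = of_int m" for s
    proof -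
      interpret l: linear "\<lambda>x. h T i x - h T i 0"
        using lin trisD T by blast
      have "h T i (v + s *\<^sub>R (q - p)) - h T i 0 = (h T i v - h T i 0) + s * ((h T i q - h T i 0) - (h T i p - h T i 0))"
        unfolding l.add l.scaleR l.diff by simp
      then show ?thesis
        using vC pq by (simp add: chord_def)
    qed
    have "h T i (v + w) = of_int m"
      unfolding w_def by (rule hw)
    moreover have "h T i (v - w) = of_int m"
      using hw[of "- (e / (2 * norm (q - p)))"] by (simp add: w_def)
    moreover have "v + w \<in> T" "v - w \<in> T"
      using e nw by (auto simp: subset_iff dist_norm)
    ultimately have "v + w \<in> ?C" "v - w \<in> ?C"
      by (auto simp: chord_def)
    moreover have "v \<in> open_segment (v + w) (v - w)"
    proof -
      have "v = (1 - 1 / 2) *\<^sub>R (v + w) + (1 / 2) *\<^sub>R (v - w)"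
        by (simp add: scaleR_right_distrib scaleR_right_diff_distrib flip: scaleR_left_distrib)
      moreover have "v + w \<noteq> v - w"
      proof
        assume "v + w = v - w"
        moreover have "2 *\<^sub>R w = (v + w) - (v - w)"
          by (simp add: scaleR_2)
        ultimately have "w = 0"
          by simp
        then show False
          using nw e by auto
      qed
      ultimately show ?thesis
        unfolding in_segment by (intro conjI exI[of _ "1 / 2"]) auto
    qed
    ultimately show ?thesis
      using v by (auto simp: extreme_point_of_def)
  qed
  moreover have "a extreme_point_of ?C" "b extreme_point_of ?C"
    unfolding ab by (simp_all add: extreme_point_of_segment)
  ultimately show ?thesis
    using ab by blast
qed

lemma segs_segment: "S \<in> segs \<Longrightarrow> \<exists>a\<in>V. \<exists>b\<in>V. S = closed_segment a b"
proof -
  assume "S \<in> segs"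
  then consider "S \<in> K" "aff_dim S = 1" | T i m where "T \<in> tris" "chord T i m \<inter> interior T \<noteq> {}" "S = chord T i m"
    by (auto simp: segs_def chords_def)
  then show ?thesis
  proof cases
    case 1
    then obtain a b where "S = closed_segment a b" "{a} \<in> K" "{b} \<in> K"
      by (rule edge_cases)
    then show ?thesis
      using vertex_division by (auto simp: V_def)
  qed (use chord_segment in auto)
qed

lemma simplex_Int_chord:
  assumes "S \<in> K" "T \<in> tris" "chord T i m \<inter> interior T \<noteq> {}" "S \<noteq> T"
  shows "S \<inter> chord T i m \<subseteq> V"
proof
  fix x assume x: "x \<in> S \<inter> chord T i m"
  then have "x \<in> frontier T"
    using proper_simplex_Int[OF assms(2,1,4)] by (auto simp: chord_def)
  then show "x \<in> V"
    using chord_frontier[OF assms(2,3)] x by (auto simp: V_def)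
qed

text \<open>Edges of \<open>K\<close> meet in vertices. A chord meets an edge, or a chord of another
  triangle, on the frontier of its own triangle, hence in \<open>division\<close>. Chords of one
  triangle meet in grid points.\<close>

lemma segs_cross:
  assumes "S \<in> segs" "S' \<in> segs" "S \<noteq> S'"
  shows "S \<inter> S' \<subseteq> V"
proof -
  define Q where "Q S T i m \<longleftrightarrow> T \<in> tris \<and> chord T i m \<inter> interior T \<noteq> {} \<and> S = chord T i m" for S T i m
  have edge_chord: "S \<inter> S' \<subseteq> V" if "S \<in> K" "aff_dim S = 1" "Q S' T i m" for S S' T i m
  proof -
    have "S \<noteq> T"
      using that trisD(2)[of T] by (auto simp: Q_def)
    then show ?thesis
      using simplex_Int_chord[of S T i m] that by (simp add: Q_def)
  qed
  have "(S \<in> K \<and> aff_dim S = 1) \<or> (\<exists>T i m. Q S T i m)" "(S' \<in> K \<and> aff_dim S' = 1) \<or> (\<exists>T i m. Q S' T i m)"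
    using assms unfolding segs_def chords_def Q_def by blast+
  then consider "S \<in> K" "aff_dim S = 1" "S' \<in> K" "aff_dim S' = 1"
    | T i m where "S \<in> K" "aff_dim S = 1" "Q S' T i m" | T i m where "S' \<in> K" "aff_dim S' = 1" "Q S T i m"
    | T i m T' i' m' where "Q S T i m" "Q S' T' i' m'"
    by metis
  then show ?thesis
  proof cases
    case 1
    have f: "(S \<inter> S') face_of S" "(S' \<inter> S) face_of S'"
      using simplicial_complexD(4)[OF K] 1 by auto
    obtain a b where ab: "S = closed_segment a b" "{a} \<in> K" "{b} \<in> K"
      using edge_cases[OF 1(1,2)] by metis
    have "S \<inter> S' \<noteq> S"
    proof
      assume "S \<inter> S' = S"
      then have "S face_of S'"
        using f by (simp add: Int_commute)
      then show False
        using face_of_aff_dim_lt[of S' S] simplicial_complexD(6)[OF K 1(3)] 1 assms(3) by auto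
    qed
    then have "S \<inter> S' \<subseteq> {a, b}"
      using f(1) ab(1) by (auto simp: segment_face_of)
    then show ?thesis
      using ab vertex_division by (auto simp: V_def)
  next
    case 2
    then show ?thesis using edge_chord by blast
  next
    case 3
    then show ?thesis using edge_chord by blast
  next
    case 4
    show ?thesis
    proof (cases "T = T'")
      case False
      have "S \<inter> S' \<subseteq> T \<inter> chord T' i' m'"
        using 4 by (auto simp: Q_def chord_def)
      then show ?thesis
        using simplex_Int_chord[of T T' i' m'] 4 False trisD by (auto simp: Q_def)
    next
      case True
      show ?thesis
      proof
        fix x assume x: "x \<in> S \<inter> S'"
        then have hx: "x \<in> T" "h T i x = of_int m" "h T i' x = of_int m'"
          using 4 True by (auto simp: Q_def chord_def)
        \<comment> \<open>Chords of the same family with a common point have the same level and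
          coincide, so the families differ.\<close>
        have "i' = (\<not> i)"
          using hx 4 True assms(3) by (cases i; cases i') (auto simp: Q_def)
        then have "h T j x \<in> \<int>" for j
          using hx by (cases "j = i") auto
        then show "x \<in> V"
        proof (cases "x \<in> interior T")
          case True
          then show ?thesis
            using \<open>\<And>j. h T j x \<in> \<int>\<close> 4 by (auto simp: V_def lattice_def Q_def)
        next
          case False
          then have "x \<in> frontier T"
            using hx closure_subset by (auto simp: frontier_def)
          then show ?thesis
            using chord_frontier[of T i m x] 4 x by (auto simp: V_def Q_def)
        qed
      qed
    qed
  qed
qed

section \<open>Finiteness of the grid and its graph\<close>

lemma finite_tris: "finite tris"
  using simplicial_complexD(1)[OF K] by (simp add: tris_def)

lemma h_bounded:
  assumes "T \<in> tris"
  obtains B :: int where "\<And>i x. x \<in> T \<Longrightarrow> \<bar>h T i x\<bar> \<le> of_int B"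
proof -
  have "\<exists>B. \<forall>x\<in>T. \<bar>h T i x\<bar> \<le> B" for i
    using compact_imp_bounded[OF compact_continuous_image[OF h_continuous[OF assms] tri_geometry(1)[OF assms]], of i]
    by (auto simp: bounded_iff)
  then obtain B where B: "\<And>i x. x \<in> T \<Longrightarrow> \<bar>h T i x\<bar> \<le> B i"
    by metis
  have "\<bar>h T i x\<bar> \<le> of_int \<lceil>max (B True) (B False)\<rceil>" if "x \<in> T" for i x
  proof -
    have "B i \<le> max (B True) (B False)"
      by (cases i) auto
    also have "\<dots> \<le> of_int \<lceil>max (B True) (B False)\<rceil>"
      by (rule le_of_int_ceiling)
    finally show ?thesis
      using B[OF that, of i] by linarith
  qed
  then show ?thesis
    using that by blast
qed

lemma finite_chords: "finite chords"
proof -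
  have "finite {chord T i m |i m. chord T i m \<inter> interior T \<noteq> {}}" if T: "T \<in> tris" for T
  proof -
    obtain B where B: "\<And>i x. x \<in> T \<Longrightarrow> \<bar>h T i x\<bar> \<le> of_int B"
      using h_bounded[OF T] by blast
    have "{chord T i m |i m. chord T i m \<inter> interior T \<noteq> {}} \<subseteq> (\<lambda>(i, m). chord T i m) ` (UNIV \<times> {- B..B})"
    proof
      fix S assume "S \<in> {chord T i m |i m. chord T i m \<inter> interior T \<noteq> {}}"
      then obtain i m x where S: "S = chord T i m" "x \<in> T" "h T i x = of_int m"
        by (auto simp: chord_def)
      then have "\<bar>real_of_int m\<bar> \<le> of_int B"
        using B[of x i] by simp
      then have "m \<in> {- B..B}"
        by auto
      then show "S \<in> (\<lambda>(i, m). chord T i m) ` (UNIV \<times> {- B..B})"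
        using S by auto
    qed
    then show ?thesis
      by (rule finite_subset) simp
  qed
  then have "finite (\<Union>T\<in>tris. {chord T i m |i m. chord T i m \<inter> interior T \<noteq> {}})"
    using finite_tris by blast
  moreover have "chords \<subseteq> (\<Union>T\<in>tris. {chord T i m |i m. chord T i m \<inter> interior T \<noteq> {}})"
    by (auto simp: chords_def)
  ultimately show ?thesis
    using finite_subset by blast
qed

lemma finite_V: "finite V"
proof -
  have "finite {a. {a} \<in> K}"
    using finite_vimageI[OF simplicial_complexD(1)[OF K], of "\<lambda>a. {a}"] by (simp add: vimage_def inj_on_def)
  moreover have "division \<subseteq> (\<lambda>(a, b, j). a + (real j / real (N * D)) *\<^sub>R (b - a)) ` ({a. {a} \<in> K} \<times> {a. {a} \<in> K} \<times> {..N * D})"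
    unfolding division_def by force
  ultimately have "finite division"
    using finite_subset by blast
  moreover have "finite lattice"
  proof -
    have "finite {x \<in> interior T. \<forall>i. h T i x \<in> \<int>}" if T: "T \<in> tris" for T
    proof -
      obtain B where B: "\<And>i x. x \<in> T \<Longrightarrow> \<bar>h T i x\<bar> \<le> of_int B"
        using h_bounded[OF T] by blast
      let ?X = "{x \<in> interior T. \<forall>i. h T i x \<in> \<int>}"
      let ?f = "\<lambda>x. (\<lfloor>h T True x\<rfloor>, \<lfloor>h T False x\<rfloor>)"
      have "?f ` ?X \<subseteq> {- B..B} \<times> {- B..B}"
      proof clarsimp
        fix x assume x: "x \<in> interior T" "\<forall>i. h T i x \<in> \<int>"
        then have "x \<in> T"
          using interior_subset by blast
        then show "- B \<le> \<lfloor>h T True x\<rfloor> \<and> \<lfloor>h T True x\<rfloor> \<le> B \<and> - B \<le> \<lfloor>h T False x\<rfloor> \<and> \<lfloor>h T False x\<rfloor> \<le> B"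
          using B[of x True] B[of x False] by (auto simp: le_floor_iff floor_le_iff)
      qed
      then have "finite (?f ` ?X)"
        by (rule finite_subset) simp
      moreover have "inj_on ?f ?X"
      proof
        fix x y assume xy: "x \<in> ?X" "y \<in> ?X" "?f x = ?f y"
        have "h T i x = h T i y" for i
        proof -
          have "\<lfloor>h T i x\<rfloor> = \<lfloor>h T i y\<rfloor>"
            using xy by (cases i) auto
          moreover have "of_int \<lfloor>h T i x\<rfloor> = h T i x" "of_int \<lfloor>h T i y\<rfloor> = h T i y"
            using xy by (auto simp: of_int_floor)
          ultimately show ?thesis
            by metis
        qed
        then show "x = y"
          using h_inj[OF T] by blast
      qed
      ultimately show ?thesis
        by (rule finite_imageD)
    qed
    then show ?thesis
      unfolding lattice_def using finite_tris by blast
  qed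
  ultimately show ?thesis
    by (simp add: V_def)
qed

lemma finite_segs: "finite segs"
  using finite_chords simplicial_complexD(1)[OF K] by (simp add: segs_def)

lemma G_graph:
  shows "simplicial_complex G" "\<Union>G = V \<union> \<Union>segs"
    and "x \<in> S \<Longrightarrow> S \<in> segs \<Longrightarrow> x \<notin> V \<Longrightarrow>
      \<exists>u v. u \<in> V \<and> v \<in> V \<and> u \<noteq> v \<and> open_segment u v \<inter> V = {} \<and> closed_segment u v \<subseteq> S \<and> x \<in> open_segment u v"
proof -
  show "simplicial_complex G" "\<Union>G = V \<union> \<Union>segs"
    unfolding G_def by (rule segment_graph[OF finite_segs finite_V]; use segs_segment segs_cross in blast)+
  show "\<exists>u v. u \<in> V \<and> v \<in> V \<and> u \<noteq> v \<and> open_segment u v \<inter> V = {} \<and> closed_segment u v \<subseteq> S \<and> x \<in> open_segment u v"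
    if "x \<in> S" "S \<in> segs" "x \<notin> V"
    using that segs_segment[of S] graph_edge_through[OF finite_V, of _ _ x] by metis
qed

section \<open>Cells and their frontiers\<close>

definition cell :: "'a set \<Rightarrow> (bool \<Rightarrow> int) \<Rightarrow> 'a set" where
  "cell T k = {x \<in> T. \<forall>i. of_int (k i) \<le> h T i x \<and> h T i x \<le> of_int (k i) + 1}"

text \<open>Squares that meet \<open>T\<close> in a point or a segment only are discarded, as an
  apex must be interior.\<close>

definition cells :: "'a set set" where
  "cells = {cell T k |T k. T \<in> tris \<and> interior (cell T k) \<noteq> {}}"

lemma cell_subset: "cell T k \<subseteq> T"
  by (auto simp: cell_def)

lemma interior_cell_subset: "interior (cell T k) \<subseteq> interior T"
  by (rule interior_mono) (rule cell_subset)

lemma cell_convex_compact: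
  assumes T: "T \<in> tris"
  shows "convex (cell T k)" "compact (cell T k)"
proof -
  have eq: "cell T k = T \<inter> (\<Inter>i. {x. of_int (k i) \<le> h T i x} \<inter> {x. h T i x \<le> of_int (k i) + 1})"
    by (auto simp: cell_def)
  show "convex (cell T k)"
    unfolding convex_alt
  proof (intro ballI allI impI)
    fix x y u assume x: "x \<in> cell T k" and y: "y \<in> cell T k" and u: "0 \<le> u \<and> u \<le> (1::real)"
    have "of_int (k i) \<le> (1 - u) * h T i x + u * h T i y \<and> (1 - u) * h T i x + u * h T i y \<le> of_int (k i) + 1" for i
      using x y u convex_bound_le[of "h T i x" "of_int (k i) + 1" "h T i y" "1 - u" u]
        convex_bound_le[of "- h T i x" "- of_int (k i)" "- h T i y" "1 - u" u]
      by (auto simp: cell_def)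
    moreover have "(1 - u) *\<^sub>R x + u *\<^sub>R y \<in> T"
      using tri_geometry(2)[OF T] x y u unfolding convex_alt cell_def by auto
    ultimately show "(1 - u) *\<^sub>R x + u *\<^sub>R y \<in> cell T k"
      by (simp add: cell_def h_comb[OF T])
  qed
  show "compact (cell T k)"
    unfolding eq using h_continuous[OF T, of UNIV]
    by (intro compact_Int_closed[OF tri_geometry(1)[OF T]] closed_INT ballI closed_Int closed_Collect_le continuous_on_const) auto
qed

text \<open>Near an interior point the coordinate, being affine and not constant, takes larger and
  smaller values inside the cell.\<close>

lemma interior_cell_strict:
  assumes T: "T \<in> tris" and x: "x \<in> interior (cell T k)"
  shows "of_int (k i) < h T i x" "h T i x < of_int (k i) + 1"
proof -
  obtain e where e: "0 < e" "ball x e \<subseteq> cell T k"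
    using x mem_interior by blast
  obtain p q where pq: "h T i p = 0" "h T i q = 1"
    using surj[of T "\<lambda>_. 0"] surj[of T "\<lambda>_. 1"] trisD[OF T] by metis
  then have "p \<noteq> q"
    by auto
  interpret l: linear "\<lambda>x. h T i x - h T i 0"
    using lin trisD T by blast
  have shift: "h T i (x + s *\<^sub>R (q - p)) = h T i x + s" for s
  proof -
    have "h T i (x + s *\<^sub>R (q - p)) - h T i 0 = (h T i x - h T i 0) + s * ((h T i q - h T i 0) - (h T i p - h T i 0))"
      unfolding l.add l.scaleR l.diff by simp
    then show ?thesis
      using pq by simp
  qed
  define s where "s = e / (2 * norm (q - p))"
  have s: "0 < s" "norm (s *\<^sub>R (q - p)) = e / 2"
    using e \<open>p \<noteq> q\<close> by (auto simp: s_def)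
  have "x + s *\<^sub>R (q - p) \<in> ball x e" "x + (- s) *\<^sub>R (q - p) \<in> ball x e"
    using s e by (auto simp: dist_norm)
  then have "x + s *\<^sub>R (q - p) \<in> cell T k" "x + (- s) *\<^sub>R (q - p) \<in> cell T k"
    using e by blast+
  then have "h T i (x + s *\<^sub>R (q - p)) \<le> of_int (k i) + 1" "of_int (k i) \<le> h T i (x + (- s) *\<^sub>R (q - p))"
    unfolding cell_def by blast+
  then have "h T i x + s \<le> of_int (k i) + 1" "of_int (k i) \<le> h T i x + (- s)"
    unfolding shift .
  then show "of_int (k i) < h T i x" "h T i x < of_int (k i) + 1"
    using s by auto
qed

lemma open_strict_cell:
  assumes T: "T \<in> tris"
  shows "open {x. \<forall>i. of_int (k i) < h T i x \<and> h T i x < of_int (k i) + 1}"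
proof -
  have "{x. \<forall>i. of_int (k i) < h T i x \<and> h T i x < of_int (k i) + 1} =
      (\<Inter>i. {x. of_int (k i) < h T i x} \<inter> {x. h T i x < of_int (k i) + 1})"
    by auto
  moreover have "open (\<Inter>i. {x. of_int (k i) < h T i x} \<inter> {x. h T i x < of_int (k i) + 1})"
    using h_continuous[OF T, of UNIV]
    by (intro open_INT ballI open_Int open_Collect_less continuous_on_const) auto
  ultimately show ?thesis
    by simp
qed

lemma interior_cellI:
  assumes T: "T \<in> tris" and x: "x \<in> interior T" "\<And>i. of_int (k i) < h T i x" "\<And>i. h T i x < of_int (k i) + 1"
  shows "x \<in> interior (cell T k)"
proof (rule interiorI)
  let ?O = "{x. \<forall>i. of_int (k i) < h T i x \<and> h T i x < of_int (k i) + 1}"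
  show "open (interior T \<inter> ?O)"
    using open_strict_cell[OF T] by auto
  show "x \<in> interior T \<inter> ?O"
    using x by auto
  show "interior T \<inter> ?O \<subseteq> cell T k"
    using interior_subset[of T] by (auto simp: cell_def less_imp_le)
qed

lemma interior_in_cell:
  assumes T: "T \<in> tris" and x: "x \<in> interior T"
  obtains k where "x \<in> cell T k" "interior (cell T k) \<noteq> {}"
proof -
  define k where "k i = \<lfloor>h T i x\<rfloor>" for i
  have k: "of_int (k i) \<le> h T i x" "h T i x < of_int (k i) + 1" for i
    by (simp_all add: k_def)
  \<comment> \<open>\<open>x\<close> may lie on a grid line. A small move towards the centre
    \<open>m\<close> of its unit square, which may be outside \<open>T\<close>, makes all
    inequalities strict without leaving the interior of \<open>T\<close>.\<close>
  obtain m where m: "\<And>i. h T i m = of_int (k i) + 1 / 2"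
    using surj[of T "\<lambda>i. of_int (k i) + 1 / 2"] trisD[OF T] by auto
  obtain e where e: "0 < e" "ball x e \<subseteq> T"
    using x mem_interior by blast
  have "((\<lambda>t. (1 - t) *\<^sub>R x + t *\<^sub>R m) \<longlongrightarrow> (1 - 0) *\<^sub>R x + 0 *\<^sub>R m) (at_right 0)"
    by (intro tendsto_intros)
  moreover have "(1 - 0) *\<^sub>R x + 0 *\<^sub>R m \<in> interior T"
    using x by simp
  ultimately have "eventually (\<lambda>t. (1 - t) *\<^sub>R x + t *\<^sub>R m \<in> interior T) (at_right 0)"
    using topological_tendstoD open_interior by blast
  moreover have "eventually (\<lambda>t. t \<in> {0<..<1}) (at_right (0::real))"
    by (rule eventually_at_right_real) simp
  ultimately have "eventually (\<lambda>t. (1 - t) *\<^sub>R x + t *\<^sub>R m \<in> interior T \<and> t \<in> {0<..<1}) (at_right 0)"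
    by (rule eventually_conj)
  then obtain t where t: "(1 - t) *\<^sub>R x + t *\<^sub>R m \<in> interior T" "0 < t" "t < 1"
    using eventually_happens' trivial_limit_at_right_real by (metis (no_types, lifting) greaterThanLessThan_iff)
  have "(1 - t) *\<^sub>R x + t *\<^sub>R m \<in> interior (cell T k)"
  proof (rule interior_cellI[OF T t(1)])
    fix i
    define a where "a = h T i x - of_int (k i)"
    have a: "0 \<le> a" "a < 1"
      using k[of i] by (auto simp: a_def)
    have eq: "h T i ((1 - t) *\<^sub>R x + t *\<^sub>R m) = of_int (k i) + ((1 - t) * a + t * (1 / 2))"
      unfolding h_comb[OF T] m by (simp add: a_def algebra_simps)
    have "0 \<le> (1 - t) * a" "(1 - t) * a \<le> 1 - t"
      using a t by (auto intro!: mult_left_le)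
    then have "0 < (1 - t) * a + t * (1 / 2)" "(1 - t) * a + t * (1 / 2) < 1"
      using t by linarith+
    then show "of_int (k i) < h T i ((1 - t) *\<^sub>R x + t *\<^sub>R m)"
      "h T i ((1 - t) *\<^sub>R x + t *\<^sub>R m) < of_int (k i) + 1"
      unfolding eq by auto
  qed
  moreover have "x \<in> cell T k"
    using k x interior_subset by (auto simp: cell_def less_imp_le)
  ultimately show ?thesis
    using that by blast
qed

lemma finite_cells: "finite cells"
proof -
  have "finite {cell T k |k. interior (cell T k) \<noteq> {}}" if T: "T \<in> tris" for T
  proof -
    obtain B where B: "\<And>i x. x \<in> T \<Longrightarrow> \<bar>h T i x\<bar> \<le> of_int B"
      using h_bounded[OF T] by blast
    have "{cell T k |k. interior (cell T k) \<noteq> {}} \<subseteq>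
        (\<lambda>(a, b). cell T (\<lambda>i. if i then a else b)) ` ({- B - 1..B} \<times> {- B - 1..B})"
    proof
      fix C assume "C \<in> {cell T k |k. interior (cell T k) \<noteq> {}}"
      then obtain k x where k: "C = cell T k" "x \<in> cell T k"
        using interior_subset by fastforce
      \<comment> \<open>From \<open>h T i x \<le> k i + 1\<close> only \<open>- B - 1\<close>
        follows as a lower bound.\<close>
      have "k i \<in> {- B - 1..B}" for i
      proof -
        have "\<bar>h T i x\<bar> \<le> of_int B" "of_int (k i) \<le> h T i x" "h T i x \<le> of_int (k i) + 1"
          using k B[of x i] by (auto simp: cell_def)
        then have "real_of_int (k i) \<le> of_int B" "real_of_int (- B - 1) \<le> of_int (k i)"
          by (auto simp: abs_le_iff)
        then show ?thesis
          by (auto simp only: of_int_le_iff atLeastAtMost_iff)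
      qed
      moreover have "k = (\<lambda>i. if i then k True else k False)"
        by (auto simp: fun_eq_iff)
      then have "C = cell T (\<lambda>i. if i then k True else k False)"
        using k by metis
      ultimately show "C \<in> (\<lambda>(a, b). cell T (\<lambda>i. if i then a else b)) ` ({- B - 1..B} \<times> {- B - 1..B})"
        by blast
    qed
    then show ?thesis
      by (rule finite_subset) simp
  qed
  then have "finite (\<Union>T\<in>tris. {cell T k |k. interior (cell T k) \<noteq> {}})"
    using finite_tris by blast
  moreover have "cells \<subseteq> (\<Union>T\<in>tris. {cell T k |k. interior (cell T k) \<noteq> {}})"
    by (auto simp: cells_def)
  ultimately show ?thesis
    using finite_subset by blast
qed

lemma simplex_Int_interior:
  assumes "T \<in> tris" "S \<in> K" "S \<noteq> T"
  shows "S \<inter> interior T = {}"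
  using proper_simplex_Int[OF assms] interior_subset[of T] by (fastforce simp: frontier_def)

lemma cells_disjoint:
  assumes "C \<in> cells" "C' \<in> cells" "C \<noteq> C'"
  shows "interior C \<inter> C' = {}"
proof -
  obtain T k where C: "C = cell T k" "T \<in> tris"
    using assms by (auto simp: cells_def)
  obtain T' k' where C': "C' = cell T' k'" "T' \<in> tris"
    using assms by (auto simp: cells_def)
  show ?thesis
  proof (cases "T = T'")
    case False
    then have "T' \<inter> interior T = {}"
      using simplex_Int_interior[of T T'] C C' trisD by auto
    then show ?thesis
      using interior_cell_subset[of T k] cell_subset[of T' k'] C C' by blast
  next
    case True
    then have "k \<noteq> k'"
      using C C' assms by auto
    then obtain i where i: "k i \<noteq> k' i"
      by blast
    have False if "x \<in> interior C" "x \<in> C'" for x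
    proof -
      have "of_int (k i) < h T i x" "h T i x < of_int (k i) + 1"
        using interior_cell_strict[OF C(2), of x k i] that C by auto
      moreover have "of_int (k' i) \<le> h T i x" "h T i x \<le> of_int (k' i) + 1"
        using that C' True by (auto simp: cell_def)
      ultimately have "real_of_int (k i) < of_int (k' i + 1)" "real_of_int (k' i) < of_int (k i + 1)"
        by auto
      then show False
        using i unfolding of_int_less_iff by linarith
    qed
    then show ?thesis
      by blast
  qed
qed

lemma division_Int_interior:
  assumes "T \<in> tris" "x \<in> division"
  shows "x \<notin> interior T"
proof -
  obtain a b where ab: "closed_segment a b \<in> K" "x \<in> closed_segment a b"
    using division_subset[OF assms(2)] by auto
  have "aff_dim (closed_segment a b) \<le> 1"
    using collinear_aff_dim[of "closed_segment a b"] by simp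
  then have "closed_segment a b \<noteq> T"
    using trisD(2)[OF assms(1)] by auto
  then show ?thesis
    using simplex_Int_interior[OF assms(1) ab(1)] ab(2) by blast
qed

text \<open>Division points lie on edges, so a vertex interior to \<open>T\<close> is a grid point
  of \<open>T\<close> itself. This is what keeps \<open>D\<close> out of the bound for inner
  cells.\<close>

lemma V_interior:
  assumes T: "T \<in> tris" and x: "x \<in> V" "x \<in> interior T"
  shows "h T i x \<in> \<int>"
proof -
  have "x \<in> lattice"
    using division_Int_interior[OF T] x by (auto simp: V_def)
  then obtain T' where T': "T' \<in> tris" "x \<in> interior T'" "\<forall>i. h T' i x \<in> \<int>"
    by (auto simp: lattice_def)
  have "T' = T"
    using simplex_Int_interior[of T' T] trisD(1)[OF T] T' x interior_subset by blast
  then show ?thesis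
    using T' by auto
qed

text \<open>On a side from \<open>a\<close> to \<open>b\<close> the coordinate of the j-th division
  point is that of \<open>a\<close> plus j d / D, because the increment N d cancels the
  \<open>N\<close> in the denominator.\<close>

lemma V_denominator:
  assumes T: "T \<in> tris" and x: "x \<in> V" "x \<in> T"
  shows "real D * h T i x \<in> \<int>"
proof (cases "x \<in> interior T")
  case True
  then show ?thesis
    using V_interior[OF T x(1)] by (auto intro: Ints_mult)
next
  case False
  then have fr: "x \<in> frontier T"
    using x(2) closure_subset by (auto simp: frontier_def)
  have "x \<in> division"
  proof (rule ccontr)
    assume "x \<notin> division"
    then obtain T' where T': "T' \<in> tris" "x \<in> interior T'"
      using x by (auto simp: V_def lattice_def)
    then have "T = T'"
      using simplex_Int_interior[of T' T] trisD(1)[OF T] x by blast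
    then show False
      using T' False by simp
  qed
  then obtain a b j where ab: "{a} \<in> K" "{b} \<in> K" "closed_segment a b \<in> K" "j \<le> N * D"
      "x = a + (real j / real (N * D)) *\<^sub>R (b - a)"
    by (auto simp: division_def)
  have hV: "real D * h T i a \<in> \<int>" if "{a} \<in> K" "a \<in> T" for a
    using vertex_Ints[of T a i] trisD[OF T] that by (auto intro: Ints_mult)
  obtain a' b' where ab': "closed_segment a' b' \<in> K" "x \<in> closed_segment a' b'"
    using division_subset[OF \<open>x \<in> division\<close>] by auto
  have "x \<in> closed_segment a b"
  proof -
    let ?t = "real j / real (N * D)"
    have "x = (1 - ?t) *\<^sub>R a + ?t *\<^sub>R b"
      by (simp add: ab(5) algebra_simps)
    moreover have "0 \<le> ?t" "?t \<le> 1"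
      using ab pos by (auto simp: divide_le_eq simp flip: of_nat_mult)
    ultimately show ?thesis
      unfolding in_segment by blast
  qed
  moreover have "(closed_segment a b \<inter> T) face_of closed_segment a b"
    using simplicial_complexD(4)[OF K] ab trisD[OF T] by blast
  \<comment> \<open>The edge that produced \<open>x\<close> may belong to another triangle; its
    intersection with \<open>T\<close> is a face, so either \<open>x\<close> is an end point or the
    whole edge is in \<open>T\<close>.\<close>
  ultimately consider "x = a" | "x = b" | "closed_segment a b \<subseteq> T"
    using x(2) unfolding segment_face_of by blast
  then show ?thesis
  proof cases
    case 3
    then have abT: "a \<in> T" "b \<in> T"
      by auto
    obtain d where d: "d \<in> \<int>" "h T i b - h T i a = real N * d" "real D / d \<in> \<int>"
      using edge_Ints[of T a b i] trisD[OF T] ab abT by auto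
    have "real D * h T i x = real D * h T i a + real j * d"
      unfolding ab(5) h_line[OF T] d(2) using pos by (simp add: field_simps)
    then show ?thesis
      using hV[OF ab(1) abT(1)] d by (auto intro!: Ints_add Ints_mult)
  qed (use hV ab x in auto)
qed

text \<open>A point of the graph interior to \<open>T\<close> has an integral coordinate, and points
  interior to a cell have none.\<close>

lemma graph_Int_interior_cell:
  assumes "C \<in> cells"
  shows "interior C \<inter> \<Union>G = {}"
proof -
  obtain T k where C: "C = cell T k" "T \<in> tris"
    using assms by (auto simp: cells_def)
  have nonint: False if x: "x \<in> interior C" "h T i x \<in> \<int>" for x i
  proof -
    obtain z where "h T i x = of_int z"
      using x by (auto elim: Ints_cases)
    then have "of_int (k i) < real_of_int z" "real_of_int z < of_int (k i + 1)"
      using interior_cell_strict[OF C(2), of x k i] x C by auto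
    then show False
      unfolding of_int_less_iff by linarith
  qed
  have False if x: "x \<in> interior C" "x \<in> \<Union>G" for x
  proof -
    have xT: "x \<in> interior T"
      using x C interior_cell_subset by blast
    consider "x \<in> V" | e where "e \<in> K" "aff_dim e = 1" "x \<in> e"
      | T' i m where "T' \<in> tris" "x \<in> chord T' i m"
      using x(2) unfolding G_graph(2) segs_def chords_def by blast
    then show False
    proof cases
      case 1
      then show False
        using V_interior[OF C(2) _ xT] nonint[OF x(1)] by blast
    next
      case 2
      then have "e \<noteq> T"
        using trisD(2)[OF C(2)] by auto
      then show False
        using simplex_Int_interior[OF C(2) 2(1)] 2 xT by blast
    next
      case 3
      have "T' = T"
        using simplex_Int_interior[OF C(2), of T'] 3 xT trisD by (auto simp: chord_def)
      then show False
        using 3 nonint[OF x(1), of i] by (auto simp: chord_def)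
    qed
  qed
  then show ?thesis
    by blast
qed

text \<open>A coordinate that is not constant along an edge cannot pass an integer there: the point
  where it does would be a point of \<open>V\<close> in the open edge. So the edge stays in each
  unit strip that contains one of its inner points.\<close>

lemma edge_in_strip:
  assumes T: "T \<in> tris" and S: "(\<forall>w\<in>closed_segment u v. h T i w = m) \<or> (\<forall>w\<in>closed_segment u v. h T i w \<in> \<int> \<longrightarrow> w \<in> V)"
    and no: "open_segment u v \<inter> V = {}" and x: "x \<in> open_segment u v" "of_int k \<le> h T i x" "h T i x \<le> of_int k + 1"
    and y: "y \<in> closed_segment u v"
  shows "of_int k \<le> h T i y" "h T i y \<le> of_int k + 1"
proof -
  have xc: "x \<in> closed_segment u v"
    using x open_closed_segment by blast
  have main: False if bad: "of_int l \<le> h T i x \<and> h T i y < of_int l \<or> h T i x \<le> of_int l \<and> of_int l < h T i y" for l :: int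
  proof -
    have "h T i x \<noteq> h T i y"
      using bad by auto
    then have *: "\<forall>w\<in>closed_segment u v. h T i w \<in> \<int> \<longrightarrow> w \<in> V"
      using S xc y by auto
    \<comment> \<open>Between \<open>x\<close> and \<open>y\<close> the coordinate equals
      \<open>l\<close> at parameter \<open>t\<close>. Strictness at \<open>y\<close> gives
      \<open>t < 1\<close>, so \<open>?w\<close> is in the open edge even if \<open>y\<close> is an
      end point.\<close>
    define t where "t = (of_int l - h T i x) / (h T i y - h T i x)"
    have t: "0 \<le> t" "t < 1"
      using bad by (auto simp: t_def divide_simps)
    let ?w = "(1 - t) *\<^sub>R x + t *\<^sub>R y"
    have "h T i ?w = h T i x + t * (h T i y - h T i x)"
      unfolding h_comb[OF T] by (simp add: algebra_simps)
    also have "\<dots> = of_int l"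
      using bad by (auto simp: t_def)
    finally have hw: "h T i ?w = of_int l" .
    have "?w \<in> open_segment u v"
    proof (cases "t = 0")
      case False
      have "rel_interior (closed_segment u v) = open_segment u v"
        using x(1) by (metis empty_iff open_segment_idem rel_interior_closed_segment)
      then have "x \<in> rel_interior (closed_segment u v)"
        using x by simp
      moreover have "y \<in> closure (closed_segment u v)"
        using y by simp
      ultimately have "y - (1 - t) *\<^sub>R (y - x) \<in> rel_interior (closed_segment u v)"
        using t by (intro rel_interior_closure_convex_shrink) auto
      moreover have "y - (1 - t) *\<^sub>R (y - x) = ?w"
        by (simp add: algebra_simps)
      ultimately show ?thesis
        using \<open>rel_interior _ = _\<close> by simp
    qed (use x in auto)
    moreover from this have "?w \<in> V"
      using * hw open_closed_segment by fastforce
    ultimately show False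
      using no by blast
  qed
  show "of_int k \<le> h T i y"
    using main[of k] x(2) by (meson not_le)
  show "h T i y \<le> of_int k + 1"
    using main[of "k + 1"] x(3) by (simp add: not_less) (meson not_le)
qed

lemma cells_convex_compact:
  assumes "C \<in> cells"
  shows "convex C" "compact C" "closed C"
proof -
  obtain T k where "T \<in> tris" "C = cell T k"
    using assms by (auto simp: cells_def)
  then show "convex C" "compact C"
    using cell_convex_compact by auto
  then show "closed C"
    by (simp add: compact_imp_closed)
qed

text \<open>Such a point is on a side of \<open>T\<close>, or one of its coordinates is at an end of
  the unit interval and it is on a chord. The last conclusion is the alternative that
  \<open>edge_in_strip\<close> asks for.\<close>

lemma grid_line_through:
  assumes T: "T \<in> tris" and x: "x \<in> frontier (cell T k)"
  obtains S where "S \<in> segs" "x \<in> S" "S \<subseteq> T" "S \<inter> interior (cell T k) = {}"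
    "\<And>i. (\<exists>m. \<forall>w\<in>S. h T i w = m) \<or> (\<forall>w\<in>S. h T i w \<in> \<int> \<longrightarrow> w \<in> V)"
proof (cases "x \<in> frontier T")
  case True
  obtain e where e: "e \<in> K" "aff_dim e = 1" "x \<in> e" "e face_of T" "e \<subseteq> frontier T"
    using frontier_edge[OF T True] .
  obtain a b where ab: "a \<noteq> b" "e = closed_segment a b" "{a} \<in> K" "{b} \<in> K"
    using edge_cases[OF e(1,2)] .
  have abT: "a \<in> T" "b \<in> T"
    using e(5) tri_geometry(7)[OF T] ab(2) by auto
  have "(\<exists>m. \<forall>w\<in>e. h T i w = m) \<or> (\<forall>w\<in>e. h T i w \<in> \<int> \<longrightarrow> w \<in> V)" for i
  proof (cases "h T i a = h T i b")
    case True
    have "h T i w = h T i a" if "w \<in> e" for w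
    proof -
      obtain t where t: "w = (1 - t) *\<^sub>R a + t *\<^sub>R b"
        using \<open>w \<in> e\<close> ab by (auto simp: in_segment)
      show ?thesis
        unfolding t h_comb[OF T] True by (simp add: left_diff_distrib)
    qed
    then show ?thesis
      by blast
  next
    case False
    then show ?thesis
      using crossing_in_division[OF T ab(3,4) _ abT] e(1) ab(2) by (auto simp: V_def)
  qed
  moreover have "e \<inter> interior (cell T k) = {}"
    using e(5) interior_cell_subset[of T k] by (fastforce simp: frontier_def)
  ultimately show ?thesis
    using that[of e] e tri_geometry(7)[OF T] by (auto simp: segs_def)
next
  case False
  have xc: "x \<in> cell T k" "x \<notin> interior (cell T k)"
    using x frontier_subset_closed compact_imp_closed[OF cell_convex_compact(2)[OF T]] by (auto simp: frontier_def)
  then have "x \<in> interior T"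
    using False cell_subset[of T k] closure_subset[of T] by (auto simp: frontier_def)
  obtain i where i: "\<not> (of_int (k i) < h T i x \<and> h T i x < of_int (k i) + 1)"
    using interior_cellI[OF T \<open>x \<in> interior T\<close>] xc by blast
  moreover have "of_int (k i) \<le> h T i x" "h T i x \<le> of_int (k i) + 1"
    using xc by (auto simp: cell_def)
  ultimately have "h T i x = of_int (k i) \<or> h T i x = of_int (k i + 1)"
    unfolding of_int_add of_int_1 by linarith
  then obtain m where m: "h T i x = of_int m" "m = k i \<or> m = k i + 1"
    by blast
  let ?S = "chord T i m"
  have xS: "x \<in> ?S"
    using m xc cell_subset by (auto simp: chord_def)
  have ne: "?S \<inter> interior T \<noteq> {}"
    using xS \<open>x \<in> interior T\<close> by blast
  have "?S \<inter> interior (cell T k) = {}"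
    using interior_cell_strict[OF T, of _ k i] m(2) by (fastforce simp: chord_def)
  moreover have "(\<exists>m. \<forall>w\<in>?S. h T j w = m) \<or> (\<forall>w\<in>?S. h T j w \<in> \<int> \<longrightarrow> w \<in> V)" for j
  proof (cases "j = i")
    case False
    have "w \<in> V" if w: "w \<in> ?S" "h T j w \<in> \<int>" for w
    proof (cases "w \<in> interior T")
      case True
      have "h T l w \<in> \<int>" for l
        using w False by (cases "l = i"; cases "l = j") (auto simp: chord_def)
      then show ?thesis
        using True T by (auto simp: V_def lattice_def)
    next
      case False
      then have "w \<in> frontier T"
        using w closure_subset[of T] by (auto simp: frontier_def chord_def)
      then show ?thesis
        using chord_frontier[OF T ne w(1)] by (simp add: V_def)
    qed
    then show ?thesis
      by blast
  qed (auto simp: chord_def)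
  moreover have "?S \<in> segs"
    using T ne by (auto simp: segs_def chords_def)
  ultimately show ?thesis
    using that[of ?S] xS by (auto simp: chord_def)
qed

text \<open>The graph edge through \<open>x\<close> on the segment \<open>S\<close> remains in the
  cell by \<open>edge_in_strip\<close> and avoids its interior because \<open>S\<close>
  does.\<close>

lemma frontier_cell_edge:
  assumes T: "T \<in> tris" and x: "x \<in> frontier (cell T k)" "x \<notin> V"
  obtains F where "F \<in> G" "x \<in> F" "F \<subseteq> frontier (cell T k)"
proof -
  obtain S where S: "S \<in> segs" "x \<in> S" "S \<subseteq> T" "S \<inter> interior (cell T k) = {}"
    "\<And>i. (\<exists>m. \<forall>w\<in>S. h T i w = m) \<or> (\<forall>w\<in>S. h T i w \<in> \<int> \<longrightarrow> w \<in> V)"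
    using grid_line_through[OF T x(1)] by metis
  obtain u v where uv: "u \<in> V" "v \<in> V" "u \<noteq> v" "open_segment u v \<inter> V = {}" "closed_segment u v \<subseteq> S" "x \<in> open_segment u v"
    using G_graph(3)[OF S(2,1) x(2)] by metis
  let ?F = "closed_segment u v"
  have "?F \<in> graph_edges segs V"
    unfolding graph_edges_def using uv S(1) by blast
  then have "?F \<in> G"
    by (simp add: G_def segment_graph_def)
  moreover have "x \<in> ?F"
    using uv(6) open_closed_segment by blast
  moreover have "?F \<subseteq> frontier (cell T k)"
  proof
    fix y assume y: "y \<in> ?F"
    have xc: "x \<in> cell T k"
      using x frontier_subset_closed compact_imp_closed[OF cell_convex_compact(2)[OF T]] by auto
    have "of_int (k i) \<le> h T i y \<and> h T i y \<le> of_int (k i) + 1" for i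
    proof -
      obtain m where "(\<forall>w\<in>?F. h T i w = m) \<or> (\<forall>w\<in>?F. h T i w \<in> \<int> \<longrightarrow> w \<in> V)"
        using S(5)[of i] uv(5) by blast
      then show ?thesis
        using edge_in_strip[OF T _ uv(4,6) _ _ y, of i m "k i"] xc by (auto simp: cell_def)
    qed
    then have "y \<in> cell T k"
      using y uv S by (auto simp: cell_def)
    moreover have "y \<notin> interior (cell T k)"
      using y uv S by blast
    ultimately show "y \<in> frontier (cell T k)"
      using closure_subset by (auto simp: frontier_def)
  qed
  ultimately show ?thesis
    using that by blast
qed

text \<open>
  A corner of a cell may be an isolated point of the intersection of the cell with a side of \<open>T\<close>, so
  that not every edge through it belongs to the cell. Since the frontier is connected and \<open>V\<close> is
  finite, it is enough to cover the points outside \<open>V\<close> by closed edges.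
\<close>
lemma frontier_cell_cover:
  assumes C: "C \<in> cells"
  shows "frontier C \<subseteq> \<Union>(boundary_simplices G C)"
proof -
  obtain T k where Tk: "T \<in> tris" "C = cell T k" "interior C \<noteq> {}"
    using C by (auto simp: cells_def)
  note conv = cells_convex_compact[OF C]
  let ?U = "\<Union>(boundary_simplices G C)"
  have "closed ?U"
    using simplicial_complexD(1,5)[OF G_graph(1)] compact_imp_closed
    by (intro closed_Union) (auto simp: boundary_simplices_def)
  have "frontier C - V \<subseteq> ?U"
    using frontier_cell_edge[OF Tk(1)] unfolding Tk(2) boundary_simplices_def by blast
  have "aff_dim C = 2"
    using aff_dim_nonempty_interior[OF Tk(3)] DIM by simp
  then have "connected (rel_frontier C)"
    using connected_sphere_gen[OF conv(1) compact_imp_bounded[OF conv(2)]] by simp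
  then have conn: "connected (frontier C)"
    using rel_frontier_nonempty_interior[OF Tk(3)] by simp
  have nsing: "frontier C \<noteq> {x}" for x
  proof
    assume "frontier C = {x}"
    then have "C = {x}"
      using Krein_Milman_frontier[OF conv(1,2)] by simp
    then show False
      using \<open>aff_dim C = 2\<close> by simp
  qed
  show ?thesis
  proof
    fix x assume "x \<in> frontier C"
    then have "x islimpt frontier C"
      using connected_imp_perfect[OF conn] nsing by blast
    then have "x islimpt ((frontier C - V) \<union> V)"
      by (rule islimpt_subset) auto
    then have "x islimpt (frontier C - V)"
      using islimpt_Un islimpt_finite[OF finite_V] by blast
    then have "x islimpt ?U"
      using islimpt_subset \<open>frontier C - V \<subseteq> ?U\<close> by blast
    then show "x \<in> ?U"
      using \<open>closed ?U\<close> closed_limpt by blast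
  qed
qed

lemma cell_h_diff:
  assumes "x \<in> cell T k" "y \<in> cell T k"
  shows "\<bar>h T i x - h T i y\<bar> \<le> 1"
proof -
  have "of_int (k i) \<le> h T i x" "h T i x \<le> of_int (k i) + 1" "of_int (k i) \<le> h T i y" "h T i y \<le> of_int (k i) + 1"
    using assms by (auto simp: cell_def)
  then show ?thesis
    by linarith
qed

lemma cell_triangle_ball:
  assumes T: "T \<in> tris" and abc: "a \<in> cell T k" "b \<in> cell T k" "c \<in> cell T k" and ncol: "\<not> collinear {a, b, c}"
  defines "\<Delta> \<equiv> (h T True b - h T True a) * (h T False c - h T False a) - (h T True c - h T True a) * (h T False b - h T False a)"
  shows "\<Delta> \<noteq> 0" "cball ((1 / 3) *\<^sub>R (a + b + c)) (\<bar>\<Delta>\<bar> / (6 * \<kappa> T)) \<subseteq> convex hull {a, b, c}"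
proof -
  define f where "f i x = h T i x - h T i 0" for i x
  have linf: "linear (f i)" for i
    unfolding f_def using lin trisD[OF T] by blast
  have fdiff: "f i (x - y) = h T i x - h T i y" for i x y
    using linear_diff[OF linf, of i x y] by (simp add: f_def)
  have injf: "w = 0" if "f True w = 0" "f False w = 0" for w
  proof (rule h_inj[OF T])
    show "h T i w = h T i 0" for i
      using that by (cases i) (auto simp: f_def)
  qed
  have lipf: "\<bar>f i w\<bar> \<le> \<kappa> T * norm w" for i w
    using lip[of T i w 0] trisD[OF T] by (simp add: f_def)
  have \<Delta>: "\<Delta> = f True (b - a) * f False (c - a) - f True (c - a) * f False (b - a)"
    by (simp add: \<Delta>_def fdiff)
  show "\<Delta> \<noteq> 0"
    unfolding \<Delta> by (rule det_nonzero_if_not_collinear[OF linf linf injf ncol])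
  show "cball ((1 / 3) *\<^sub>R (a + b + c)) (\<bar>\<Delta>\<bar> / (6 * \<kappa> T)) \<subseteq> convex hull {a, b, c}"
  proof (rule cball_subset_triangle[OF linf linf injf _ lipf lipf _ \<Delta> \<open>\<Delta> \<noteq> 0\<close>])
    show "0 < \<kappa> T"
      using \<kappa>_pos trisD[OF T] by blast
    show "\<bar>f True (x - y)\<bar> \<le> 1 \<and> \<bar>f False (x - y)\<bar> \<le> 1" if "x \<in> {a, b, c}" "y \<in> {a, b, c}" for x y
      using that abc cell_h_diff[of x T k y] unfolding fdiff by blast
  qed
qed

text \<open>The frontier is covered by edges with ends in \<open>V\<close>, so the cell is the
  convex hull of its points of \<open>V\<close>. Three of these are affinely independent, and their
  centroid is interior to their triangle.\<close>

lemma cell_center: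
  assumes C: "C \<in> cells"
  shows "\<exists>z p q r. z \<in> interior C \<and> {p, q, r} \<subseteq> V \<inter> C \<and> z = (1 / 3) *\<^sub>R (p + q + r)"
proof -
  obtain T k where Tk: "T \<in> tris" "C = cell T k" "interior C \<noteq> {}"
    using C by (auto simp: cells_def)
  note conv = cells_convex_compact[OF C]
  have "frontier C \<subseteq> convex hull (V \<inter> C)"
  proof
    fix x assume "x \<in> frontier C"
    then obtain F where F: "F \<in> G" "F \<subseteq> frontier C" "x \<in> F"
      using frontier_cell_cover[OF C] by (auto simp: boundary_simplices_def)
    have FC: "F \<subseteq> C"
      using F conv(3) frontier_subset_closed by blast
    from F(1,3) consider "F = {x}" "x \<in> V" | u v where "F = closed_segment u v" "u \<in> V" "v \<in> V"
      by (auto simp: G_def segment_graph_def graph_edges_def)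
    then show "x \<in> convex hull (V \<inter> C)"
    proof cases
      case 1
      then show ?thesis
        using FC by (auto intro: hull_inc)
    next
      case 2
      then have "{u, v} \<subseteq> V \<inter> C"
        using FC by auto
      then have "convex hull {u, v} \<subseteq> convex hull (V \<inter> C)"
        by (rule hull_mono)
      then show ?thesis
        using F 2 by (auto simp: segment_convex_hull)
    qed
  qed
  then have "convex hull (frontier C) \<subseteq> convex hull (V \<inter> C)"
    by (simp add: hull_minimal)
  then have "C \<subseteq> convex hull (V \<inter> C)"
    using Krein_Milman_frontier[OF conv(1,2)] by simp
  then have "aff_dim C \<le> aff_dim (V \<inter> C)"
    using aff_dim_subset[of C "convex hull (V \<inter> C)"] by (simp add: aff_dim_convex_hull)
  then have "2 \<le> aff_dim (V \<inter> C)"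
    using aff_dim_nonempty_interior[OF Tk(3)] DIM by simp
  moreover obtain B where B: "B \<subseteq> V \<inter> C" "\<not> affine_dependent B" "affine hull (V \<inter> C) = affine hull B"
    using affine_basis_exists[of "V \<inter> C"] by auto
  moreover have "aff_dim (V \<inter> C) = aff_dim B"
    using B(3) aff_dim_affine_hull by metis
  moreover have "aff_dim B \<le> 2"
    using aff_dim_le_DIM[of B] DIM by simp
  ultimately have "aff_dim B = 2"
    by simp
  then have "card B = 3"
    using aff_dim_affine_independent[OF B(2)] by simp
  then obtain p q r where pqr: "B = {p, q, r}"
    by (auto simp: card_3_iff)
  have ncol: "\<not> collinear {p, q, r}"
    using \<open>aff_dim B = 2\<close> pqr collinear_aff_dim[of B] by simp
  have inC: "p \<in> cell T k" "q \<in> cell T k" "r \<in> cell T k"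
    using B pqr Tk by auto
  let ?z = "(1 / 3) *\<^sub>R (p + q + r)"
  obtain e where e: "0 < e" "cball ?z e \<subseteq> convex hull {p, q, r}"
    using cell_triangle_ball[OF Tk(1) inC ncol] \<kappa>_pos[of T] trisD[OF Tk(1)]
    by (metis divide_pos_pos mult_pos_pos zero_less_abs_iff zero_less_numeral)
  moreover have "convex hull {p, q, r} \<subseteq> C"
    using inC conv Tk by (intro hull_minimal) auto
  ultimately have "?z \<in> interior C"
    using mem_interior_cball by blast
  then show ?thesis
    using B pqr by blast
qed

definition center :: "'a set \<Rightarrow> 'a" where
  "center C = (SOME z. z \<in> interior C \<and> (\<exists>p q r. {p, q, r} \<subseteq> V \<inter> C \<and> z = (1 / 3) *\<^sub>R (p + q + r)))"

lemma center_cell: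
  assumes "C \<in> cells"
  shows "center C \<in> interior C" "\<exists>p q r. {p, q, r} \<subseteq> V \<inter> C \<and> center C = (1 / 3) *\<^sub>R (p + q + r)"
proof -
  have "\<exists>z. z \<in> interior C \<and> (\<exists>p q r. {p, q, r} \<subseteq> V \<inter> C \<and> z = (1 / 3) *\<^sub>R (p + q + r))"
    using cell_center[OF assms] by blast
  from someI_ex[OF this]
  show "center C \<in> interior C" "\<exists>p q r. {p, q, r} \<subseteq> V \<inter> C \<and> center C = (1 / 3) *\<^sub>R (p + q + r)"
    unfolding center_def by blast+
qed

section \<open>The mesh, its inner part and their regularity\<close>

definition mesh :: "'a set set" where
  "mesh = G \<union> (\<Union>C\<in>cells. cone_simplices G center C)"

definition inner_cells :: "'a set set" where
  "inner_cells = {C \<in> cells. \<exists>T\<in>tris. C \<subseteq> interior T}"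

text \<open>The base faces are added to make the family closed under faces.\<close>

definition inner_mesh :: "'a set set" where
  "inner_mesh = (\<Union>C\<in>inner_cells. cone_simplices G center C \<union> boundary_simplices G C)"

lemma mesh_complex: "simplicial_complex mesh"
  unfolding mesh_def
  using cells_convex_compact center_cell graph_Int_interior_cell
  by (intro cone_complex G_graph(1) finite_cells cells_disjoint) auto

lemma Union_cones:
  assumes "C \<in> cells"
  shows "\<Union>(cone_simplices G center C) = C"
  using cells_convex_compact[OF assms] center_cell(1)[OF assms] frontier_cell_cover[OF assms]
    simplicial_complexD(6)[OF G_graph(1)]
  by (intro Union_cone_simplices) (auto simp: G_def segment_graph_def)

lemma mesh_refines:
  assumes "K \<noteq> {}" "S \<in> mesh"
  shows "\<exists>T\<in>K. S \<subseteq> T"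
proof -
  have V: "\<exists>T\<in>K. v \<in> T" if "v \<in> V" for v
  proof (cases "v \<in> division")
    case True
    then show ?thesis
      using division_subset by blast
  next
    case False
    then obtain T where "T \<in> tris" "v \<in> interior T"
      using \<open>v \<in> V\<close> by (auto simp: V_def lattice_def)
    then show ?thesis
      using trisD interior_subset by blast
  qed
  have seg: "\<exists>T\<in>K. e \<subseteq> T" if "e \<in> segs" for e
    using that trisD by (auto simp: segs_def chords_def chord_def)
  consider "S = {}" | v where "v \<in> V" "S = {v}" | e where "e \<in> segs" "S \<subseteq> e" | C where "C \<in> cells" "S \<in> cone_simplices G center C"
    using assms(2) unfolding mesh_def G_def segment_graph_def graph_edges_def by blast
  then show ?thesis
  proof cases
    case 4
    then have "S \<subseteq> C"
      using Union_cones by blast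
    then show ?thesis
      using 4 cell_subset trisD by (fastforce simp: cells_def)
  next
    case 3
    then show ?thesis
      using seg by (meson subset_trans)
  qed (use assms(1) V in auto)
qed

lemma low_dim_subset_mesh:
  assumes "S \<in> K" "aff_dim S \<le> 1"
  shows "S \<subseteq> \<Union>G"
proof -
  have "aff_dim S = -1 \<or> aff_dim S = 0 \<or> aff_dim S = 1"
    using aff_dim_geq[of S] assms(2) by linarith
  then consider "S = {}" | a where "S = {a}" | "aff_dim S = 1"
    using aff_dim_empty[of S] aff_dim_eq_0[of S] by blast
  then show ?thesis
  proof cases
    case 2
    then show ?thesis
      using assms vertex_division G_graph(2) by (auto simp: V_def)
  next
    case 3
    then show ?thesis
      using assms G_graph(2) by (auto simp: segs_def)
  qed simp
qed

text \<open>\<open>K\<close> need not be pure: points in no triangle lie in simplices of dimension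
  at most 1, which the graph covers.\<close>

lemma point_cases:
  assumes "x \<in> \<Union>K"
  obtains S where "S \<in> K" "aff_dim S \<le> 1" "x \<in> S"
    | T k where "T \<in> tris" "x \<in> cell T k" "cell T k \<in> cells"
proof -
  obtain S where S: "S \<in> K" "x \<in> S"
    using assms by auto
  have "aff_dim S \<le> 2"
    using aff_dim_le_DIM[of S] DIM by simp
  then consider "aff_dim S \<le> 1" | "S \<in> tris"
    using S by (force simp: tris_def)
  then show ?thesis
  proof cases
    case 1
    then show ?thesis
      using that(1) S by blast
  next
    case 2
    show ?thesis
    proof (cases "x \<in> interior S")
      case True
      obtain k where "x \<in> cell S k" "interior (cell S k) \<noteq> {}"
        using interior_in_cell[OF 2 True] .
      then show ?thesis
        using that(2)[OF 2] 2 unfolding cells_def by blast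
    next
      case False
      then have "x \<in> frontier S"
        using S closure_subset by (auto simp: frontier_def)
      then obtain e where "e \<in> K" "aff_dim e = 1" "x \<in> e"
        using frontier_edge[OF 2] by metis
      then show ?thesis
        using that(1) by simp
    qed
  qed
qed

lemma mesh_subdivision:
  assumes "K \<noteq> {}"
  shows "subdivision_of mesh K"
proof -
  have "\<Union>K \<subseteq> \<Union>mesh"
  proof
    fix x assume "x \<in> \<Union>K"
    then show "x \<in> \<Union>mesh"
    proof (cases rule: point_cases)
      case (1 S)
      then show ?thesis
        using low_dim_subset_mesh[of S] by (auto simp: mesh_def)
    next
      case (2 T k)
      then have "x \<in> \<Union>(cone_simplices G center (cell T k))"
        using Union_cones by blast
      then show ?thesis
        using 2 unfolding mesh_def by blast
    qed
  qed
  moreover have "\<Union>mesh \<subseteq> \<Union>K"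
    using mesh_refines[OF assms] by blast
  ultimately show ?thesis
    unfolding subdivision_of_def using mesh_complex mesh_refines[OF assms] by blast
qed

lemma inner_mesh_subcomplex: "subcomplex_of inner_mesh mesh"
proof -
  have sub: "inner_mesh \<subseteq> mesh"
    by (auto simp: inner_mesh_def mesh_def inner_cells_def boundary_simplices_def)
  moreover have "simplicial_complex inner_mesh"
  proof (rule subset_simplicial_complex[OF mesh_complex sub])
    fix F S assume S: "S \<in> inner_mesh" "F face_of S"
    then obtain C where C: "C \<in> inner_cells" "S \<in> cone_simplices G center C \<or> S \<in> boundary_simplices G C"
      by (auto simp: inner_mesh_def)
    have "C \<in> cells"
      using C by (simp add: inner_cells_def)
    have "F \<in> cone_simplices G center C \<union> boundary_simplices G C"
    proof (cases "S \<in> cone_simplices G center C")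
      case True
      then show ?thesis
        using cone_faces[where z = center, OF G_graph(1) _ _ _ True S(2)] cells_convex_compact[OF \<open>C \<in> cells\<close>] center_cell(1)[OF \<open>C \<in> cells\<close>]
        by blast
    next
      case False
      then have "S \<in> G" "S \<subseteq> frontier C"
        using C by (auto simp: boundary_simplices_def)
      then show ?thesis
        using simplicial_complexD(3)[OF G_graph(1) _ S(2)] face_of_imp_subset[OF S(2)]
        by (auto simp: boundary_simplices_def)
    qed
    then show "F \<in> inner_mesh"
      using C by (auto simp: inner_mesh_def)
  qed
  ultimately show ?thesis
    by (simp add: subcomplex_of_def)
qed

text \<open>An uncovered point off the skeleton lies in a cell that reaches the frontier of its
  triangle. Coordinates vary by at most 1 within a cell, so its points are at most \<eta>
  apart.\<close>

lemma uncovered_near_skeleton: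
  assumes "x \<in> \<Union>mesh - \<Union>inner_mesh" "K \<noteq> {}"
  shows "\<exists>y\<in>\<Union>(skeleton 1 K). x = y \<or> (\<exists>T\<in>tris. norm (x - y) \<le> \<eta> T)"
proof -
  have "x \<in> \<Union>K"
    using mesh_refines[OF assms(2)] assms(1) by blast
  then show ?thesis
  proof (cases rule: point_cases)
    case (1 S)
    then show ?thesis
      by (auto simp: skeleton_def)
  next
    case (2 T k)
    have "\<not> cell T k \<subseteq> interior T"
    proof
      assume "cell T k \<subseteq> interior T"
      then have "cell T k \<in> inner_cells"
        using 2 by (auto simp: inner_cells_def)
      moreover have "x \<in> \<Union>(cone_simplices G center (cell T k))"
        using 2 Union_cones by blast
      ultimately show False
        using assms(1) unfolding inner_mesh_def by blast
    qed
    then obtain y where y: "y \<in> cell T k" "y \<in> frontier T"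
      using cell_subset[of T k] closure_subset[of T] by (auto simp: frontier_def)
    obtain e where "e \<in> K" "aff_dim e = 1" "y \<in> e"
      using frontier_edge[OF 2(1) y(2)] by metis
    then have "y \<in> \<Union>(skeleton 1 K)"
      by (auto simp: skeleton_def)
    moreover have "norm (x - y) \<le> \<eta> T"
      using inj[of T x y 1] trisD[OF 2(1)] cell_h_diff[OF 2(2) y(1)] by simp
    ultimately show ?thesis
      using 2(1) by blast
  qed
qed

text \<open>As q^2 \<Delta> is a nonzero integer, 1 \<le> q^2 |\<Delta>|. The inradius is at least
  |\<Delta>| / (6 \<kappa>) and the diameter at most \<eta>, which is at most 6 / \<kappa>; the
  quotient is bounded by 36 q^2.\<close>

lemma lattice_triangle_fat:
  fixes q :: nat
  assumes T: "T \<in> tris" and abc: "a \<in> cell T k" "b \<in> cell T k" "c \<in> cell T k" and ncol: "\<not> collinear {a, b, c}"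
    and "0 < q" and ints: "\<And>x i. x \<in> {a, b, c} \<Longrightarrow> real q * h T i x \<in> \<int>"
  shows "0 < inradius (convex hull {a, b, c}) \<and>
    diameter (convex hull {a, b, c}) \<le> 36 * (real q)\<^sup>2 * inradius (convex hull {a, b, c})"
proof -
  let ?S = "convex hull {a, b, c}"
  have KT: "T \<in> K" "aff_dim T = 2"
    using trisD[OF T] by auto
  have \<kappa>: "0 < \<kappa> T"
    using \<kappa>_pos KT by blast
  define \<Delta> where "\<Delta> = (h T True b - h T True a) * (h T False c - h T False a) - (h T True c - h T True a) * (h T False b - h T False a)"
  define r where "r = \<bar>\<Delta>\<bar> / (6 * \<kappa> T)"
  have \<Delta>: "\<Delta> \<noteq> 0" and ball: "cball ((1 / 3) *\<^sub>R (a + b + c)) r \<subseteq> ?S"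
    using cell_triangle_ball[OF T abc ncol] by (auto simp: \<Delta>_def r_def)
  have "(real q)\<^sup>2 * \<Delta> = (real q * h T True b - real q * h T True a) * (real q * h T False c - real q * h T False a)
      - (real q * h T True c - real q * h T True a) * (real q * h T False b - real q * h T False a)"
    by (simp add: \<Delta>_def power2_eq_square algebra_simps)
  also have "\<dots> \<in> \<int>"
    using ints by (intro Ints_diff[OF Ints_mult Ints_mult] Ints_diff[of "real q * _" "real q * _"]) auto
  finally have "1 \<le> \<bar>(real q)\<^sup>2 * \<Delta>\<bar>"
    using \<Delta> \<open>0 < q\<close> by (intro nonzero_Ints_abs_ge_1) auto
  then have q\<Delta>: "1 \<le> (real q)\<^sup>2 * \<bar>\<Delta>\<bar>"
    by (simp add: abs_mult)
  have dim: "aff_dim ?S = 2"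
    using ncol aff_dim_le_DIM[of "{a, b, c}"] DIM by (simp add: collinear_aff_dim aff_dim_convex_hull)
  have r: "0 < r" "r \<le> inradius ?S"
  proof -
    show "0 < r"
      using \<Delta> \<kappa> by (simp add: r_def)
    then have "(1 / 3) *\<^sub>R (a + b + c) \<in> ?S"
      using ball by (auto simp: subset_iff)
    then have "(1 / 3) *\<^sub>R (a + b + c) \<in> affine hull ?S"
      by (rule hull_inc)
    then show "r \<le> inradius ?S"
      using dim ball \<open>0 < r\<close> by (intro inradius_ge) (auto simp: bounded_convex_hull)
  qed
  have "0 \<le> \<eta> T"
    using inj[OF KT, of a a 1] by simp
  have sub: "?S \<subseteq> cell T k"
    using abc cell_convex_compact[OF T] by (intro hull_minimal) auto
  have "diameter ?S \<le> \<eta> T"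
  proof (rule diameter_le)
    fix x y assume "x \<in> ?S" "y \<in> ?S"
    then show "norm (x - y) \<le> \<eta> T"
      using inj[OF KT, of x y 1] cell_h_diff[of x T k y] sub by auto
  qed (use \<open>0 \<le> \<eta> T\<close> in auto)
  also have "\<eta> T \<le> 6 / \<kappa> T"
    using \<kappa>\<eta>[OF KT] \<kappa> by (simp add: pos_le_divide_eq mult.commute)
  also have "\<dots> \<le> 6 / \<kappa> T * ((real q)\<^sup>2 * \<bar>\<Delta>\<bar>)"
  proof -
    have "0 \<le> 6 / \<kappa> T"
      using \<kappa> by simp
    from mult_left_mono[OF q\<Delta> this] show ?thesis
      by (simp only: mult_1_right)
  qed
  also have "\<dots> = 36 * (real q)\<^sup>2 * r"
    by (simp add: r_def)
  also have "\<dots> \<le> 36 * (real q)\<^sup>2 * inradius ?S"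
    using r by (intro mult_left_mono) auto
  finally show ?thesis
    using r by auto
qed

lemma cone_triangle:
  assumes C: "C \<in> cells" and S: "S \<in> cone_simplices G center C" "aff_dim S = 2"
  obtains u v where "S = convex hull {center C, u, v}" "u \<in> V \<inter> C" "v \<in> V \<inter> C" "\<not> collinear {center C, u, v}"
proof -
  obtain F where F: "F \<in> G" "F \<subseteq> frontier C" "S = convex hull (insert (center C) F)"
    using S by (auto simp: cone_simplices_def)
  have "F \<subseteq> C"
    using F cells_convex_compact[OF C] frontier_subset_closed by blast
  have "\<not> aff_dim (insert (center C) F) \<le> 1"
    using S F by (simp add: aff_dim_convex_hull)
  then have *: "\<not> collinear (insert (center C) F)"
    by (simp add: collinear_aff_dim)
  then have "F \<noteq> {}" "F \<noteq> {v}" for v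
    by auto
  then obtain u v where uv: "F = closed_segment u v" "u \<in> V" "v \<in> V"
    using F(1) by (auto simp: G_def segment_graph_def graph_edges_def)
  have "convex hull (insert (center C) (convex hull {u, v})) = convex hull {center C, u, v}"
    by (metis hull_insert)
  then have S_eq: "S = convex hull {center C, u, v}"
    using F(3) uv(1) by (simp add: segment_convex_hull)
  moreover have "\<not> collinear {center C, u, v}"
    using S(2) unfolding S_eq by (simp add: collinear_aff_dim aff_dim_convex_hull)
  ultimately show ?thesis
    using that uv \<open>F \<subseteq> C\<close> by auto
qed

lemma h_centroid:
  assumes "T \<in> tris"
  shows "h T i ((1 / 3) *\<^sub>R (p + q + r)) = (h T i p + h T i q + h T i r) / 3"
proof -
  interpret l: linear "\<lambda>x. h T i x - h T i 0"
    using lin trisD assms by blast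
  have "h T i ((1 / 3) *\<^sub>R (p + q + r)) - h T i 0 =
      (1 / 3) * ((h T i p - h T i 0) + (h T i q - h T i 0) + (h T i r - h T i 0))"
    unfolding l.add l.scaleR by simp
  then show ?thesis
    by (simp add: field_simps)
qed

text \<open>The centroid has denominator 3 q if the vertices have denominator \<open>q\<close>, and
  324 is 36 times 9. All cells admit \<open>q = D\<close>; inner cells admit
  \<open>q = 1\<close>.\<close>

lemma cone_fat:
  fixes q :: nat
  assumes T: "T \<in> tris" "cell T k \<in> cells" and "0 < q"
    and S: "S \<in> cone_simplices G center (cell T k)" "aff_dim S = 2"
    and ints: "\<And>v i. v \<in> V \<inter> cell T k \<Longrightarrow> real q * h T i v \<in> \<int>"
  shows "0 < inradius S \<and> diameter S \<le> 324 * (real q)\<^sup>2 * inradius S"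
proof -
  let ?C = "cell T k"
  obtain u v where uv: "S = convex hull {center ?C, u, v}" "u \<in> V \<inter> ?C" "v \<in> V \<inter> ?C" "\<not> collinear {center ?C, u, v}"
    using cone_triangle[OF T(2) S] .
  have zC: "center ?C \<in> ?C"
    using center_cell(1)[OF T(2)] interior_subset by blast
  obtain p1 p2 p3 where p: "{p1, p2, p3} \<subseteq> V \<inter> ?C" "center ?C = (1 / 3) *\<^sub>R (p1 + p2 + p3)"
    using center_cell(2)[OF T(2)] by metis
  have "real (3 * q) * h T i (center ?C) = real q * h T i p1 + real q * h T i p2 + real q * h T i p3" for i
    unfolding p(2) h_centroid[OF T(1)] by (simp add: field_simps)
  then have "real (3 * q) * h T i (center ?C) \<in> \<int>" for i
    using p(1) ints by (auto intro!: Ints_add)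
  moreover have "real (3 * q) * h T i x \<in> \<int>" if "x \<in> V \<inter> ?C" for i x
    using Ints_mult[OF Ints_of_nat[of 3] ints[OF that, of i]] by (simp add: mult.assoc)
  ultimately have "0 < inradius S \<and> diameter S \<le> 36 * (real (3 * q))\<^sup>2 * inradius S"
    unfolding uv(1) using uv zC \<open>0 < q\<close> by (intro lattice_triangle_fat[OF T(1)]) auto
  then show ?thesis
    by (simp add: power_mult_distrib)
qed

lemma graph_dim: "S \<in> G \<Longrightarrow> aff_dim S \<le> 1"
  using collinear_aff_dim[of S] by (auto simp: G_def segment_graph_def graph_edges_def)

lemma mesh_regularity: "simplicial_regularity mesh \<le> ennreal (4 * (324 * (real D)\<^sup>2)\<^sup>2 + 2 * (324 * (real D)\<^sup>2))"
proof (rule simplicial_regularity_le)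
  show "\<exists>n. n simplex S" if "S \<in> mesh" for S
    using simplicial_complexD(2)[OF mesh_complex that] .
  show "aff_dim S \<le> 2" for S :: "'a set"
    using aff_dim_le_DIM[of S] DIM by simp
  show "0 < inradius S \<and> diameter S \<le> 324 * (real D)\<^sup>2 * inradius S" if S: "S \<in> mesh" "aff_dim S = 2" for S
  proof -
    obtain C where C: "C \<in> cells" "S \<in> cone_simplices G center C"
      using S graph_dim[of S] by (auto simp: mesh_def)
    then obtain T k where "T \<in> tris" "C = cell T k"
      by (auto simp: cells_def)
    then show ?thesis
      using cone_fat[of T k D S] C S(2) pos V_denominator[of T] cell_subset[of T k] by blast
  qed
  have "1 \<le> (real D)\<^sup>2"
    using pos by (simp add: one_le_power)
  then show "2 \<le> 324 * (real D)\<^sup>2"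
    by linarith
qed

lemma inner_mesh_regularity: "simplicial_regularity inner_mesh \<le> ennreal (4 * 324\<^sup>2 + 2 * 324)"
proof (rule simplicial_regularity_le)
  have sub: "inner_mesh \<subseteq> mesh"
    using inner_mesh_subcomplex by (simp add: subcomplex_of_def)
  then show "\<exists>n. n simplex S" if "S \<in> inner_mesh" for S
    using simplicial_complexD(2)[OF mesh_complex] that by blast
  show "aff_dim S \<le> 2" for S :: "'a set"
    using aff_dim_le_DIM[of S] DIM by simp
  show "0 < inradius S \<and> diameter S \<le> 324 * inradius S" if S: "S \<in> inner_mesh" "aff_dim S = 2" for S
  proof -
    obtain C where C: "C \<in> inner_cells" "S \<in> cone_simplices G center C"
      using S graph_dim[of S] by (auto simp: inner_mesh_def boundary_simplices_def)
    then obtain T' where T': "C \<in> cells" "T' \<in> tris" "C \<subseteq> interior T'"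
      by (auto simp: inner_cells_def)
    then obtain T k where "T \<in> tris" "C = cell T k" and ne: "interior C \<noteq> {}"
      by (auto simp: cells_def)
    note T = this(1,2) T'
    have "C \<noteq> {}"
      using ne by auto
    \<comment> \<open>The triangle whose grid defines the cell is the one whose interior contains
      it, so \<open>V_interior\<close> speaks of the right coordinates.\<close>
    then have "T = T'"
      using simplex_Int_interior[of T' T] T cell_subset[of T k] trisD by blast
    then have "real 1 * h T i v \<in> \<int>" if "v \<in> V \<inter> C" for v i
      using V_interior[OF T(1)] T that by auto
    then show ?thesis
      using cone_fat[of T k 1 S] C T S(2) by simp
  qed
qed simp

end

section \<open>Regular subdivisions\<close>

text \<open>Taking the vertex \<open>a\<close> as origin makes the coordinates of all three corners
  integral. Vertices of \<open>K\<close> in \<open>T\<close> are extreme points of \<open>T\<close>,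
  hence corners.\<close>

lemma triangle_frame:
  fixes T :: "'a::euclidean_space set"
  assumes DIM: "DIM('a) = 2" and K: "simplicial_complex K" "T \<in> K" "aff_dim T = 2"
  obtains g :: "bool \<Rightarrow> 'a \<Rightarrow> real" and \<kappa> \<eta> :: real
  where "\<And>i. linear (\<lambda>x. g i x - g i 0)" "0 < \<kappa>" "0 < \<eta>" "\<kappa> * \<eta> \<le> 6"
    "\<And>i x y. \<bar>g i x - g i y\<bar> \<le> \<kappa> * norm (x - y)"
    "\<And>r x y. (\<And>i. \<bar>g i x - g i y\<bar> \<le> r) \<Longrightarrow> norm (x - y) \<le> \<eta> * r"
    "\<And>s. \<exists>x. \<forall>i. g i x = s i"
    "\<And>a i. {a} \<in> K \<Longrightarrow> a \<in> T \<Longrightarrow> g i a \<in> \<int>"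
proof -
  obtain n where n: "n simplex T"
    using simplicial_complexD(2)[OF K(1,2)] by blast
  then have "n = 2"
    using aff_dim_simplex K(3) by metis
  then obtain W where W: "\<not> affine_dependent W" "int (card W) = 3" "T = convex hull W"
    using n by (auto simp: simplex_def)
  then have "card W = 3"
    by simp
  then obtain a b c where abc: "W = {a, b, c}"
    by (auto simp: card_3_iff)
  have "aff_dim {b, a, c} = 2"
    using K(3) W abc by (simp add: aff_dim_convex_hull insert_commute)
  then have "\<not> collinear {b, a, c}"
    by (simp add: collinear_aff_dim)
  then have ncol: "\<not> collinear {0, b - a, c - a}"
    using collinear_3[of b a c] by simp
  obtain h :: "bool \<Rightarrow> 'a \<Rightarrow> real" and \<kappa> \<eta> where h: "\<And>i. linear (h i)" "0 < \<kappa>" "0 < \<eta>" "\<kappa> * \<eta> \<le> 6"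
    "\<And>i x. \<bar>h i x\<bar> \<le> \<kappa> * norm x"
    "\<And>r x. (\<And>i. \<bar>h i x\<bar> \<le> r) \<Longrightarrow> norm x \<le> \<eta> * r"
    "\<And>s. \<exists>x. \<forall>i. h i x = s i"
    "\<And>i. h i (b - a) \<in> \<int>" "\<And>i. h i (c - a) \<in> \<int>"
  proof (rule exists_integral_frame[OF DIM ncol], goal_cases)
    case (1 h \<kappa> \<eta>)
    show ?case
      by (rule 1(1)[of h \<kappa> \<eta>, OF 1(2-10)])
  qed
  have hd: "h i (x - a) - h i (y - a) = h i (x - y)" for i x y
    using linear_diff[OF h(1), of i "x - a" "y - a"] by simp
  show thesis
  proof (rule that[of "\<lambda>i x. h i (x - a)" \<kappa> \<eta>])
    show "linear (\<lambda>x. h i (x - a) - h i (0 - a))" for i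
      unfolding hd using h(1)[of i] by simp
    show "\<bar>h i (x - a) - h i (y - a)\<bar> \<le> \<kappa> * norm (x - y)" for i x y
      by (simp add: hd h(5))
    show "norm (x - y) \<le> \<eta> * r" if "\<And>i. \<bar>h i (x - a) - h i (y - a)\<bar> \<le> r" for r x y
      using that by (intro h(6)) (simp add: hd)
    show "\<exists>x. \<forall>i. h i (x - a) = s i" for s
    proof -
      obtain x where "\<forall>i. h i x = s i"
        using h(7) by blast
      then show ?thesis
        by (intro exI[of _ "x + a"]) simp
    qed
    show "h i (v - a) \<in> \<int>" if "{v} \<in> K" "v \<in> T" for v i
    proof -
      have "(T \<inter> {v}) face_of T"
        using simplicial_complexD(4)[OF K(1)] K(2) that by blast
      moreover have "T \<inter> {v} = {v}"
        using that by blast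
      ultimately have "v extreme_point_of T"
        by (simp add: face_of_singleton)
      then have "v \<in> {a, b, c}"
        using extreme_point_of_convex_hull[of v W] W abc by simp
      then show ?thesis
        using h(8,9) linear_0[OF h(1)] by auto
    qed
  qed (use h in auto)
qed

text \<open>\<open>D\<close> collects the absolute values of the nonzero members as factors; a zero
  member is harmless because \<open>real D / 0 = 0\<close>.\<close>

lemma common_multiple:
  fixes X :: "real set"
  assumes "finite X" "X \<subseteq> \<int>"
  shows "\<exists>D::nat. 0 < D \<and> (\<forall>d\<in>X. real D / d \<in> \<int>)"
  using assms
proof (induction X)
  case empty
  then show ?case
    by (intro exI[of _ 1]) simp
next
  case (insert d X)
  then obtain D :: nat where D: "0 < D" "\<And>e. e \<in> X \<Longrightarrow> real D / e \<in> \<int>"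
    by auto
  obtain z where z: "d = of_int z"
    using insert.prems by (auto elim: Ints_cases)
  show ?case
  proof (cases "z = 0")
    case True
    then show ?thesis
      using D z by (intro exI[of _ D]) auto
  next
    case False
    have "real (D * nat \<bar>z\<bar>) / e = real (nat \<bar>z\<bar>) * (real D / e)" for e
      by simp
    then have "real (D * nat \<bar>z\<bar>) / e \<in> \<int>" if "e \<in> X" for e
      using D(2)[OF that] by (metis Ints_mult Ints_of_nat)
    moreover have "real (D * nat \<bar>z\<bar>) / d = real D * sgn (of_int z)"
      using False z by (cases "0 < z") (auto simp: sgn_if)
    then have "real (D * nat \<bar>z\<bar>) / d \<in> \<int>"
      by (auto simp: sgn_if)
    ultimately show ?thesis
      using D(1) False by (intro exI[of _ "D * nat \<bar>z\<bar>"]) auto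
  qed
qed

text \<open>The order of choices matters: frames and \<open>D\<close> are fixed from
  \<open>K\<close> alone, and only then \<open>N\<close> from \<epsilon>. So the bound for the mesh
  does not involve \<epsilon>.\<close>

lemma Reg_2:
  assumes DIM: "DIM('a::euclidean_space) = 2"
  shows "Reg 2 TYPE('a)"
proof -
  have "\<exists>\<alpha>::real. \<forall>\<epsilon>>0. \<exists>M M'. subdivision_of M K \<and> subcomplex_of M' M \<and>
          \<Union>M - \<Union>M' \<subseteq> {x. \<exists>y \<in> \<Union>(skeleton (int 2 - 1) K). norm (x - y) < \<epsilon>} \<and>
          simplicial_regularity M \<le> ennreal \<alpha> \<and> simplicial_regularity M' \<le> ennreal (4 * 324\<^sup>2 + 2 * 324)"
    if "p_dimensional_complex 2 K" for K :: "'a set set"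
  proof -
    have K: "simplicial_complex K" and "K \<noteq> {}"
      using that by (auto simp: p_dimensional_complex_def)
    define tr where "tr = {T \<in> K. aff_dim T = 2}"
    have "finite tr"
      using simplicial_complexD(1)[OF K] by (simp add: tr_def)
    \<comment> \<open>Packed as a predicate on triples, so that a single choice function yields
      coordinates and constants for every triangle.\<close>
    define P where "P T = (\<lambda>(g :: bool \<Rightarrow> 'a \<Rightarrow> real, \<kappa> :: real, \<eta> :: real).
      (\<forall>i. linear (\<lambda>x. g i x - g i 0)) \<and> 0 < \<kappa> \<and> 0 < \<eta> \<and> \<kappa> * \<eta> \<le> 6 \<and>
      (\<forall>i x y. \<bar>g i x - g i y\<bar> \<le> \<kappa> * norm (x - y)) \<and>
      (\<forall>r x y. (\<forall>i. \<bar>g i x - g i y\<bar> \<le> r) \<longrightarrow> norm (x - y) \<le> \<eta> * r) \<and>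
      (\<forall>s. \<exists>x. \<forall>i. g i x = s i) \<and>
      (\<forall>a i. {a} \<in> K \<longrightarrow> a \<in> T \<longrightarrow> g i a \<in> \<int>))" for T
    have "\<exists>f. P T f" if "T \<in> tr" for T
    proof -
      have T: "T \<in> K" "aff_dim T = 2"
        using that by (auto simp: tr_def)
      show ?thesis
      proof (rule triangle_frame[OF DIM K T], goal_cases)
        case (1 g \<kappa> \<eta>)
        then have "P T (g, \<kappa>, \<eta>)"
          unfolding P_def prod.case by (intro conjI allI impI; blast)
        then show ?case
          by blast
      qed
    qed
    then obtain F where F: "\<And>T. T \<in> tr \<Longrightarrow> P T (F T)"
      by metis
    define g \<kappa> \<eta> where "g T = fst (F T)" and "\<kappa> T = fst (snd (F T))" and "\<eta> T = snd (snd (F T))" for T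
    have "P T (g T, \<kappa> T, \<eta> T)" if "T \<in> tr" for T
      using F[OF that] by (simp add: g_def \<kappa>_def \<eta>_def)
    then have g: "linear (\<lambda>x. g T i x - g T i 0)" "0 < \<kappa> T" "0 < \<eta> T" "\<kappa> T * \<eta> T \<le> 6"
      "\<bar>g T i x - g T i y\<bar> \<le> \<kappa> T * norm (x - y)"
      "(\<And>i. \<bar>g T i x - g T i y\<bar> \<le> r) \<Longrightarrow> norm (x - y) \<le> \<eta> T * r"
      "\<exists>x. \<forall>i. g T i x = s i"
      "{a} \<in> K \<Longrightarrow> a \<in> T \<Longrightarrow> g T i a \<in> \<int>" if "T \<in> tr" for T i x y r s a
      using that unfolding P_def prod.case by blast+
    \<comment> \<open>The coordinate increments between corners before scaling by \<open>N\<close>;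
      they are finitely many integers.\<close>
    define X where "X = (\<lambda>(T, i, a, b). g T i b - g T i a) ` {(T, i, a, b). T \<in> tr \<and> {a} \<in> K \<and> {b} \<in> K \<and> a \<in> T \<and> b \<in> T}"
    have "finite {a. {a} \<in> K}"
      using finite_vimageI[OF simplicial_complexD(1)[OF K], of "\<lambda>a. {a}"] by (simp add: vimage_def inj_on_def)
    then have "finite {(T, i :: bool, a, b). T \<in> tr \<and> {a} \<in> K \<and> {b} \<in> K \<and> a \<in> T \<and> b \<in> T}"
      using \<open>finite tr\<close>
      by (intro finite_subset[OF _ finite_cartesian_product[OF \<open>finite tr\<close> finite_cartesian_product[of "UNIV :: bool set" "{a. {a} \<in> K} \<times> {a. {a} \<in> K}"]]]) auto
    then have "finite X"
      unfolding X_def by (rule finite_imageI)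
    have X_Ints: "X \<subseteq> \<int>"
      using g(8) by (auto simp: X_def intro!: Ints_diff)
    obtain D :: nat where D: "0 < D" "\<And>d. d \<in> X \<Longrightarrow> real D / d \<in> \<int>"
      using common_multiple[OF \<open>finite X\<close> X_Ints] by auto
    show ?thesis
    proof (rule exI[of _ "4 * (324 * (real D)\<^sup>2)\<^sup>2 + 2 * (324 * (real D)\<^sup>2)"], intro allI impI)
      fix \<epsilon> :: real assume "0 < \<epsilon>"
      define B where "B = Max ((\<lambda>T. \<eta> T / \<epsilon>) ` tr)"
      have B: "\<eta> T / \<epsilon> \<le> B" if "T \<in> tr" for T
        unfolding B_def using \<open>finite tr\<close> that by (intro Max_ge) auto
      obtain N :: nat where N: "max 0 B < N"
        using reals_Archimedean2 by blast
      then have "0 < N"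
        by simp
      have small: "\<eta> T / N < \<epsilon>" if "T \<in> tr" for T
      proof -
        have "\<eta> T / \<epsilon> < N"
          using B[OF that] N by simp
        then show ?thesis
          using \<open>0 < \<epsilon>\<close> \<open>0 < N\<close> by (simp add: field_simps)
      qed
      \<comment> \<open>Scaling the coordinates by \<open>N\<close> multiplies \<kappa> by
        \<open>N\<close> and divides \<eta> by \<open>N\<close>. The increment along a side becomes
        \<open>N\<close> times a member of \<open>X\<close>, as \<open>edge_Ints\<close>
        requires.\<close>
      interpret planar_grid K N D "\<lambda>T i x. real N * g T i x" "\<lambda>T. real N * \<kappa> T" "\<lambda>T. \<eta> T / real N"
      proof (rule planar_grid.intro)
        fix T assume "T \<in> K" "aff_dim T = 2"
        then have T: "T \<in> tr"
          by (simp add: tr_def)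
        show "linear (\<lambda>x. real N * g T i x - real N * g T i 0)" for i
          using linear_compose_scale_right[OF g(1)[OF T, of i], of "real N"] by (simp add: right_diff_distrib)
        show "0 < real N * \<kappa> T"
          using g(2)[OF T] \<open>0 < N\<close> by simp
        have scale: "\<bar>real N * g T i x - real N * g T i y\<bar> = real N * \<bar>g T i x - g T i y\<bar>" for i x y
          by (simp add: abs_mult flip: right_diff_distrib)
        show "\<bar>real N * g T i x - real N * g T i y\<bar> \<le> real N * \<kappa> T * norm (x - y)" for i x y
          unfolding scale using mult_left_mono[OF g(5)[OF T, of i x y], of "real N"] by (simp add: mult.assoc)
        show "norm (x - y) \<le> \<eta> T / real N * r" if "\<And>i. \<bar>real N * g T i x - real N * g T i y\<bar> \<le> r" for x y r
        proof -
          have "\<bar>g T i x - g T i y\<bar> \<le> r / N" for i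
            using that[of i] \<open>0 < N\<close> unfolding scale by (simp add: field_simps)
          then show ?thesis
            using g(6)[OF T, of x y "r / N"] by simp
        qed
        show "real N * \<kappa> T * (\<eta> T / real N) \<le> 6"
          using g(4)[OF T] \<open>0 < N\<close> by simp
        show "\<exists>x. \<forall>i. real N * g T i x = s i" for s
          using g(7)[OF T, of "\<lambda>i. s i / N"] \<open>0 < N\<close> by (simp add: field_simps)
        show "real N * g T i a \<in> \<int>" if "{a} \<in> K" "a \<in> T" for a i
          using g(8)[OF T that] by (auto intro: Ints_mult)
        show "\<exists>d\<in>\<int>. real N * g T i b - real N * g T i a = real N * d \<and> real D / d \<in> \<int>"
          if "{a} \<in> K" "{b} \<in> K" "a \<in> T" "b \<in> T" for a b i
        proof (intro bexI conjI)
          have "g T i b - g T i a \<in> X"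
            using that T unfolding X_def by force
          then show "g T i b - g T i a \<in> \<int>" "real D / (g T i b - g T i a) \<in> \<int>"
            using X_Ints D(2) by auto
        qed (simp add: right_diff_distrib)
      qed (use DIM K \<open>0 < N\<close> D in auto)
      have "subdivision_of mesh K \<and> subcomplex_of inner_mesh mesh \<and>
          \<Union>mesh - \<Union>inner_mesh \<subseteq> {x. \<exists>y \<in> \<Union>(skeleton (int 2 - 1) K). norm (x - y) < \<epsilon>} \<and>
          simplicial_regularity mesh \<le> ennreal (4 * (324 * (real D)\<^sup>2)\<^sup>2 + 2 * (324 * (real D)\<^sup>2)) \<and>
          simplicial_regularity inner_mesh \<le> ennreal (4 * 324\<^sup>2 + 2 * 324)"
      proof (intro conjI mesh_subdivision inner_mesh_subcomplex mesh_regularity inner_mesh_regularity)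
        show "K \<noteq> {}"
          by fact
        show "\<Union>mesh - \<Union>inner_mesh \<subseteq> {x. \<exists>y \<in> \<Union>(skeleton (int 2 - 1) K). norm (x - y) < \<epsilon>}"
        proof
          fix x assume "x \<in> \<Union>mesh - \<Union>inner_mesh"
          then obtain y where y: "y \<in> \<Union>(skeleton 1 K)" "x = y \<or> (\<exists>T\<in>tris. norm (x - y) \<le> \<eta> T / real N)"
            using uncovered_near_skeleton \<open>K \<noteq> {}\<close> by blast
          have "norm (x - y) < \<epsilon>"
            using y(2) small \<open>0 < \<epsilon>\<close> by (force simp: tris_def tr_def)
          then show "x \<in> {x. \<exists>y \<in> \<Union>(skeleton (int 2 - 1) K). norm (x - y) < \<epsilon>}"
            using y(1) by auto
        qed
      qed
      then show "\<exists>M M'. subdivision_of M K \<and> subcomplex_of M' M \<and>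
          \<Union>M - \<Union>M' \<subseteq> {x. \<exists>y \<in> \<Union>(skeleton (int 2 - 1) K). norm (x - y) < \<epsilon>} \<and>
          simplicial_regularity M \<le> ennreal (4 * (324 * (real D)\<^sup>2)\<^sup>2 + 2 * (324 * (real D)\<^sup>2)) \<and>
          simplicial_regularity M' \<le> ennreal (4 * 324\<^sup>2 + 2 * 324)"
        by blast
    qed
  qed
  then show ?thesis
    unfolding Reg_def by blast
qed

theorem theorem3p3p5:
  fixes p :: nat
  assumes "(p = 1 \<and> p \<le> CARD('q::finite)) \<or> (p = 2 \<and> CARD('q) = 2)"
  shows "Reg p TYPE(real ^ 'q)"
  using assms Reg_1 Reg_2[where 'a = "real ^ 'q"] by auto

end
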